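(* Let $V=\mathbb C^3$ and let $W$ be a single-cycle web (a non-elliptic web with exactly one internal cycle, of length at least six), of arbitrary signature, which has no quadrilateral with one vertex on the boundary attached to its internal cycle. Then for every integer $k\geq 0$, $$[\mathrm{brac}_k(W)]=T_k([W],[B(W)])$$ in $R_{a,b}(V)$, where $T_k(x,y)$ is the rescaled Chebyshev polynomial of the first kind defined by $T_0(x,y)=2$, $T_1(x,y)=x$, $T_k(x,y)=xT_{k-1}(x,y)-yT_{k-2}(x,y)$ for $k\ge 2$.
   Context: $V=\mathbb C^3$, $V^\ast$ its dual, $X=(V^\ast)^a\times V^b$, and $R_{a,b}(V)=\mathbb C[X]^{\mathrm{SL}(V)}$ is the ring of $\mathrm{SL}(V)$-invariant polynomial functions on $X$. A tensor diagram is a finite bipartite graph whose vertices are properly colored black/white and split into boundary and internal vertices, each internal vertex trivalent with a fixed cyclic order of incident edges (edges may cross transversally); it is drawn in an oriented disk with boundary vertices on the boundary circle. Each tensor diagram $D$ of type $(a,b)$ defines an invariant $[D]\in R_{a,b}(V)$ obtained by contracting copies of the volume form $\mathrm{vol}$ on $V$ and dual volume form on $V^\ast$ (one per internal vertex) along the edges, with boundary vertices giving the vector/covector arguments; boundary vertices may have several incident edges (restitution). Superimposing diagrams (gluing at common boundary vertices) multiplies invariants; invariants satisfy the standard $\mathrm{SL}_3$ skein relations. A web is a planar tensor diagram (no crossings) in the disk, up to isotopy fixing the boundary; it is non-elliptic if it has no multiple edges and no internal cycles of length $\le 4$. The signature of a web is the cyclic word in $\{\circ,\bullet\}$ read off its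 boundary; a single-cycle web has alternating signature if adjacent boundary vertices have different colors. Every single-cycle web $W$ contains a single-cycle web $S$ of alternating signature. The $k$-thickening $\mathrm{thick}_k(W)$ of a non-elliptic web $W$: replace each internal vertex of $W$ by a honeycomb fragment $H_k$ of the same color (the hexagonal-tiled triangular web fragment with $k$ edges leaving each of its three sides) and each edge of $W$ by $k$ parallel edges connecting the corresponding honeycombs and/or boundary vertices. $B(W)$: the web obtained from $\mathrm{thick}_2(W)$ by removing $\mathrm{thick}_2(S)$ (where $S\subseteq W$ is the single-cycle web of alternating signature) and joining the vertices formerly serving as endpoints of $\mathrm{thick}_2(S)$. (Equivalently, $[B(W)]=\tfrac12([W]^2-[\mathrm{brac}_2(W)])$.) The $k$-bracelet $\mathrm{brac}_k(W)$: the tensor diagram in the disk obtained by superimposing $k$ copies of $W$ so that the internal cycles form a single closed curve with $k-1$ self-crossings, and gluing together the $k$ endpoints of the copies at each boundary point; by convention $[\mathrm{brac}_0(W)]=2$. *)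

theory Defs
  imports "HOL-Analysis.Analysis" "HOL-Library.Function_Algebras"
begin

section \<open>The ring of invariants\<close>

text \<open>
  A point of \<open>X = (V*)^a \<times> V^b\<close> with \<open>V = \<complex>\<^sup>3\<close> is a pair \<open>(f, v)\<close> of sequences of which only
  \<open>f 0, \<dots>, f (a - 1)\<close> and \<open>v 0, \<dots>, v (b - 1)\<close> matter. Covectors are given by their coordinates in
  the dual of the standard basis, i.e. as row vectors.
\<close>

type_synonym config = "(nat \<Rightarrow> complex^3) \<times> (nat \<Rightarrow> complex^3)"

definition act :: "complex^3^3 \<Rightarrow> config \<Rightarrow> config" where
  "act g x = ((\<lambda>i. fst x i v* matrix_inv g), (\<lambda>j. g *v snd x j))"

inductive_set polynomial_functions :: "nat \<Rightarrow> nat \<Rightarrow> (config \<Rightarrow> complex) set"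
  for a b :: nat where
  const: "(\<lambda>x. z) \<in> polynomial_functions a b"
| cov: "i < a \<Longrightarrow> (\<lambda>x. fst x i $ r) \<in> polynomial_functions a b"
| vec: "j < b \<Longrightarrow> (\<lambda>x. snd x j $ r) \<in> polynomial_functions a b"
| add: "p \<in> polynomial_functions a b \<Longrightarrow> q \<in> polynomial_functions a b
    \<Longrightarrow> (\<lambda>x. p x + q x) \<in> polynomial_functions a b"
| mult: "p \<in> polynomial_functions a b \<Longrightarrow> q \<in> polynomial_functions a b
    \<Longrightarrow> (\<lambda>x. p x * q x) \<in> polynomial_functions a b"

definition invariant_ring :: "nat \<Rightarrow> nat \<Rightarrow> (config \<Rightarrow> complex) set" where
  "invariant_ring a b = {p \<in> polynomial_functions a b. \<forall>g x. det g = 1 \<longrightarrow> p (act g x) = p x}"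


section \<open>Tensor diagrams\<close>

datatype colour = White | Black

fun opp :: "colour \<Rightarrow> colour" where
  "opp White = Black"
| "opp Black = White"

text \<open>
  The boundary vertex \<open>Bd White i\<close> carries the \<open>i\<close>-th covector and \<open>Bd Black j\<close> the \<open>j\<close>-th vector.
  Diagrams are bipartite, so an edge has exactly one end of each colour; parallel edges are allowed.
  \<open>rot D u\<close> lists the edges at \<open>u\<close> in clockwise order: at an internal vertex this is a cyclic order,
  at a boundary vertex it is the order in which a clockwise rotation through the inside of the disk
  meets them. \<open>circ D\<close> lists the boundary vertices clockwise along the boundary circle.
\<close>

datatype 'v vert = Bd colour nat | Inn 'v

record ('v, 'e) tdiag =
  internal :: "'v set"
  icol :: "'v \<Rightarrow> colour"
  edges :: "'e set"
  endp :: "colour \<Rightarrow> 'e \<Rightarrow> 'v vert"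
  rot :: "'v vert \<Rightarrow> 'e list"
  circ :: "(colour \<times> nat) list"

fun vcol :: "('v, 'e) tdiag \<Rightarrow> 'v vert \<Rightarrow> colour" where
  "vcol D (Bd c n) = c"
| "vcol D (Inn v) = icol D v"

definition bverts :: "nat \<Rightarrow> nat \<Rightarrow> 'v vert set" where
  "bverts a b = Bd White ` {..<a} \<union> Bd Black ` {..<b}"

definition tensor_diagram :: "nat \<Rightarrow> nat \<Rightarrow> ('v, 'e) tdiag \<Rightarrow> bool" where
  "tensor_diagram a b D \<longleftrightarrow>
     finite (internal D) \<and> finite (edges D) \<and>
     (\<forall>e\<in>edges D. \<forall>c. endp D c e \<in> bverts a b \<union> Inn ` internal D \<and> vcol D (endp D c e) = c) \<and>
     (\<forall>u \<in> bverts a b \<union> Inn ` internal D.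
        distinct (rot D u) \<and> set (rot D u) = {e \<in> edges D. endp D (vcol D u) e = u}) \<and>
     (\<forall>v \<in> internal D. length (rot D (Inn v)) = 3) \<and>
     distinct (circ D) \<and> set (circ D) = {White} \<times> {..<a} \<union> {Black} \<times> {..<b}"

text \<open>
  Contraction in coordinates: an edge carries a summation index in \<open>{1, 2, 3}\<close>, an internal vertex
  contributes the (dual) volume form evaluated on the (dual) basis vectors named by its three
  edges in clockwise order, and each end of an edge at a boundary vertex contributes a coordinate of
  the argument placed there.
\<close>

definition vol :: "complex^3 \<Rightarrow> complex^3 \<Rightarrow> complex^3 \<Rightarrow> complex" where
  "vol x y z = det (vector [x, y, z] :: complex^3^3)"

definition eps :: "3 list \<Rightarrow> complex" where
  "eps is = vol (axis (is ! 0) 1) (axis (is ! 1) 1) (axis (is ! 2) 1)"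

fun bcoord :: "config \<Rightarrow> 'v vert \<Rightarrow> 3 \<Rightarrow> complex" where
  "bcoord x (Bd White i) r = fst x i $ r"
| "bcoord x (Bd Black j) r = snd x j $ r"
| "bcoord x (Inn v) r = 1"

definition invariant :: "('v, 'e) tdiag \<Rightarrow> config \<Rightarrow> complex" where
  "invariant D x =
     (\<Sum>l \<in> edges D \<rightarrow>\<^sub>E UNIV.
        (\<Prod>v\<in>internal D. eps (map l (rot D (Inn v)))) *
        (\<Prod>e\<in>edges D. bcoord x (endp D White e) (l e) * bcoord x (endp D Black e) (l e)))"


subsection \<open>Diagrams define elements of the ring of invariants\<close>

lemma eps_transform:
  fixes A :: "complex^3^3"
  assumes "det A = 1"
  shows "(\<Sum>p\<in>UNIV. \<Sum>q\<in>UNIV. \<Sum>r\<in>UNIV. eps [p, q, r] * (A $ p $ i * A $ q $ j * A $ r $ k)) = eps [i, j, k]"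
proof -
  have *: "A$1$1 * A$2$2 * A$3$3 + A$1$2 * A$2$3 * A$3$1 + A$1$3 * A$2$1 * A$3$2
      - A$1$1 * A$2$3 * A$3$2 - A$1$2 * A$2$1 * A$3$3 - A$1$3 * A$2$2 * A$3$1 = 1"
    using assms by (simp add: det_3)
  have val: "eps [p, q, r] = (if (p, q, r) \<in> {(1,2,3), (2,3,1), (3,1,2)} then 1
      else if (p, q, r) \<in> {(1,3,2), (2,1,3), (3,2,1)} then -1 else 0)" for p q r
    using exhaust_3[of p] exhaust_3[of q] exhaust_3[of r]
    by (elim disjE) (simp_all add: eps_def vol_def det_3 axis_def)
  show ?thesis
    using exhaust_3[of i] exhaust_3[of j] exhaust_3[of k] *
    by (elim disjE) (simp_all add: sum_3 val, simp_all add: algebra_simps)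
qed

lemma sum_PiE_blocks:
  fixes h :: "'u \<Rightarrow> ('e \<Rightarrow> 'l::finite) \<Rightarrow> 'c::comm_semiring_1"
  assumes "finite U" "finite E" "own ` E \<subseteq> U"
    and loc: "\<And>u m. u \<in> U \<Longrightarrow> h u (restrict m {e \<in> E. own e = u}) = h u m"
  shows "(\<Sum>m \<in> E \<rightarrow>\<^sub>E UNIV. \<Prod>u\<in>U. h u m) = (\<Prod>u\<in>U. \<Sum>m \<in> {e \<in> E. own e = u} \<rightarrow>\<^sub>E UNIV. h u m)"
proof -
  have "(\<Prod>u\<in>U. \<Sum>m \<in> {e \<in> E. own e = u} \<rightarrow>\<^sub>E UNIV. h u m) =
        (\<Sum>p \<in> (\<Pi>\<^sub>E u\<in>U. {e \<in> E. own e = u} \<rightarrow>\<^sub>E UNIV). \<Prod>u\<in>U. h u (p u))"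
    by (rule prod_sum_PiE) (use assms in \<open>auto intro!: finite_PiE\<close>)
  also have "\<dots> = (\<Sum>m \<in> E \<rightarrow>\<^sub>E UNIV. \<Prod>u\<in>U. h u m)"
  proof (rule sum.reindex_bij_witness[of _ "\<lambda>m. \<lambda>u\<in>U. restrict m {e \<in> E. own e = u}" "\<lambda>p. \<lambda>e\<in>E. p (own e) e"])
    fix p assume p: "p \<in> (\<Pi>\<^sub>E u\<in>U. {e \<in> E. own e = u} \<rightarrow>\<^sub>E (UNIV :: 'l set))"
    show "(\<lambda>u\<in>U. restrict (\<lambda>e\<in>E. p (own e) e) {e \<in> E. own e = u}) = p"
    proof
      fix u
      show "(\<lambda>u\<in>U. restrict (\<lambda>e\<in>E. p (own e) e) {e \<in> E. own e = u}) u = p u"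
      proof (cases "u \<in> U")
        case True
        then have "p u \<in> {e \<in> E. own e = u} \<rightarrow>\<^sub>E UNIV" using p by blast
        then show ?thesis using True
          by (intro ext) (auto simp: restrict_def PiE_def extensional_def)
      next
        case False
        then show ?thesis using p by (auto simp: restrict_def PiE_def extensional_def)
      qed
    qed
    show "(\<lambda>e\<in>E. p (own e) e) \<in> E \<rightarrow>\<^sub>E UNIV" by auto
    have "h u (\<lambda>e\<in>E. p (own e) e) = h u (p u)" if u: "u \<in> U" for u
    proof -
      have "p u \<in> {e \<in> E. own e = u} \<rightarrow>\<^sub>E UNIV" using p u by blast
      then have "restrict (\<lambda>e\<in>E. p (own e) e) {e \<in> E. own e = u} = p u"
        by (intro ext) (auto simp: restrict_def PiE_def extensional_def)
      then show ?thesis using loc[OF u, of "\<lambda>e\<in>E. p (own e) e"] by simp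
    qed
    then show "(\<Prod>u\<in>U. h u (\<lambda>e\<in>E. p (own e) e)) = (\<Prod>u\<in>U. h u (p u))" by simp
  next
    fix m assume m: "m \<in> E \<rightarrow>\<^sub>E (UNIV :: 'l set)"
    show "(\<lambda>e\<in>E. (\<lambda>u\<in>U. restrict m {e \<in> E. own e = u}) (own e) e) = m"
      using m assms(3) by (intro ext) (auto simp: restrict_def PiE_def extensional_def image_subset_iff)
    show "(\<lambda>u\<in>U. restrict m {e \<in> E. own e = u}) \<in> (\<Pi>\<^sub>E u\<in>U. {e \<in> E. own e = u} \<rightarrow>\<^sub>E UNIV)"
      by auto
  qed
  finally show ?thesis by simp
qed

lemma sum_PiE_three:
  fixes h :: "'l::finite list \<Rightarrow> 'c::comm_monoid_add"
  assumes "distinct [x, y, z]"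
  shows "(\<Sum>m \<in> {x, y, z} \<rightarrow>\<^sub>E UNIV. h [m x, m y, m z]) = (\<Sum>p\<in>UNIV. \<Sum>q\<in>UNIV. \<Sum>r\<in>UNIV. h [p, q, r])"
proof -
  have "(\<Sum>p\<in>UNIV. \<Sum>q\<in>UNIV. \<Sum>r\<in>UNIV. h [p, q, r]) = (\<Sum>(p, q, r)\<in>UNIV. h [p, q, r])"
    by (simp add: sum.cartesian_product flip: UNIV_Times_UNIV)
  also have "\<dots> = (\<Sum>m \<in> {x, y, z} \<rightarrow>\<^sub>E UNIV. h [m x, m y, m z])"
    by (rule sum.reindex_bij_witness[of _ "\<lambda>m. (m x, m y, m z)"
          "\<lambda>(p, q, r). \<lambda>e\<in>{x, y, z}. if e = x then p else if e = y then q else r"])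
       (use assms in \<open>auto simp: restrict_def PiE_def extensional_def fun_eq_iff\<close>)
  finally show ?thesis by simp
qed

lemma polynomial_sum:
  "finite A \<Longrightarrow> (\<And>i. i \<in> A \<Longrightarrow> p i \<in> polynomial_functions a b)
    \<Longrightarrow> (\<lambda>x. \<Sum>i\<in>A. p i x) \<in> polynomial_functions a b"
  by (induction A rule: finite_induct) (auto intro: polynomial_functions.intros)

lemma polynomial_prod:
  "finite A \<Longrightarrow> (\<And>i. i \<in> A \<Longrightarrow> p i \<in> polynomial_functions a b)
    \<Longrightarrow> (\<lambda>x. \<Prod>i\<in>A. p i x) \<in> polynomial_functions a b"
  by (induction A rule: finite_induct) (auto intro: polynomial_functions.intros)

lemma invariant_polynomial:
  assumes "tensor_diagram a b D"
  shows "invariant D \<in> polynomial_functions a b"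
proof -
  have fin: "finite (edges D)" and E: "\<And>e c. e \<in> edges D \<Longrightarrow> endp D c e \<in> bverts a b \<union> Inn ` internal D"
    using assms by (auto simp: tensor_diagram_def)
  have *: "(\<lambda>x. bcoord x (endp D c e) r) \<in> polynomial_functions a b" if "e \<in> edges D" for c e r
    using E[OF that, of c] by (auto simp: bverts_def intro: polynomial_functions.intros)
  have "(\<lambda>x. invariant D x) \<in> polynomial_functions a b"
    unfolding invariant_def using fin
    by (intro polynomial_sum polynomial_functions.mult polynomial_functions.const polynomial_prod *)
       (auto intro!: finite_PiE)
  then show ?thesis by simp
qed

text \<open>The matrix by which the ends of colour \<open>c\<close> transform under \<open>g\<close>.\<close>

fun end_matrix :: "colour \<Rightarrow> complex^3^3 \<Rightarrow> complex^3^3" where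
  "end_matrix White g = matrix_inv g"
| "end_matrix Black g = transpose g"

definition half :: "('v, 'e) tdiag \<Rightarrow> colour \<Rightarrow> config \<Rightarrow> ('e \<Rightarrow> 3) \<Rightarrow> complex" where
  "half D c x l = (\<Prod>v | v \<in> internal D \<and> icol D v = c. eps (map l (rot D (Inn v)))) *
     (\<Prod>e\<in>edges D. bcoord x (endp D c e) (l e))"

lemma invariant_half:
  assumes "tensor_diagram a b D"
  shows "invariant D x = (\<Sum>l \<in> edges D \<rightarrow>\<^sub>E UNIV. half D White x l * half D Black x l)"
proof -
  have fin: "finite (internal D)" using assms by (auto simp: tensor_diagram_def)
  have c2: "icol D v = Black \<longleftrightarrow> icol D v \<noteq> White" for v by (cases "icol D v") auto
  have "(\<Prod>v\<in>internal D. f v) = (\<Prod>v | v \<in> internal D \<and> icol D v = White. f v) *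
      (\<Prod>v | v \<in> internal D \<and> icol D v = Black. f v)" for f :: "'a \<Rightarrow> complex"
    by (subst prod.union_disjoint[symmetric]) (use fin in \<open>auto simp: c2 intro!: prod.cong\<close>)
  then show ?thesis
    by (simp add: invariant_def half_def prod.distrib mult_ac)
qed

lemma matrix_inv_left_SL:
  fixes g :: "complex^3^3"
  assumes "det g = 1"
  shows "matrix_inv g ** g = mat 1"
proof -
  have "invertible g" using assms by (simp add: invertible_det_nz)
  then have "\<exists>h. g ** h = mat 1 \<and> h ** g = mat 1" by (simp add: invertible_def)
  from someI_ex[OF this] show ?thesis by (simp add: matrix_inv_def)
qed

lemma det_end_matrix: "det g = 1 \<Longrightarrow> det (end_matrix c g) = 1"
proof (cases c)
  case White
  assume g: "det g = 1"
  then have "matrix_inv g ** g = mat 1" by (rule matrix_inv_left_SL)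
  then have "det (matrix_inv g) * det g = 1" by (metis det_I det_mul)
  then show ?thesis using g White by simp
qed (simp add: det_transpose)

lemma end_matrix_contract:
  assumes "det g = 1"
  shows "(\<Sum>s\<in>UNIV. end_matrix White g $ p $ s * end_matrix Black g $ q $ s) = (if p = q then 1 else 0)"
proof -
  have "matrix_inv g ** g = mat 1" using assms by (rule matrix_inv_left_SL)
  then have "(matrix_inv g ** g) $ p $ q = (mat 1 :: complex^3^3) $ p $ q" by simp
  then show ?thesis by (simp add: matrix_matrix_mult_def transpose_def mat_def)
qed

lemma bcoord_act:
  "bcoord (act g x) (Bd c n :: 'v vert) s =
     (\<Sum>r\<in>UNIV. bcoord x (Bd c n :: 'v vert) r * end_matrix c g $ r $ s)"
  by (cases c) (simp_all add: act_def vector_matrix_mult_def matrix_vector_mult_def transpose_def mult_ac)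

lemma half_act:
  assumes D: "tensor_diagram a b D" and g: "det g = 1"
  shows "half D c (act g x) l =
    (\<Sum>m \<in> edges D \<rightarrow>\<^sub>E UNIV. half D c x m * (\<Prod>e\<in>edges D. end_matrix c g $ m e $ l e))"
proof -
  define U where "U = {u \<in> bverts a b \<union> Inn ` internal D. vcol D u = c}"
  define F where "F u = {e \<in> edges D. endp D c e = u}" for u
  define tau where "tau x m u = (case u of Inn v \<Rightarrow> eps (map m (rot D u)) | Bd c n \<Rightarrow> \<Prod>e\<in>F u. bcoord x u (m e))"
    for x and m :: "'b \<Rightarrow> 3" and u
  have fin: "finite (internal D)" "finite (edges D)" "finite U"
    using D by (auto simp: tensor_diagram_def U_def bverts_def)
  then have finF: "finite (F u)" for u by (simp add: F_def)
  have own: "endp D c ` edges D \<subseteq> U"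
    using D by (auto simp: tensor_diagram_def U_def)
  have rot: "distinct (rot D u)" "set (rot D u) = F u" if "u \<in> U" for u
    using D that by (auto simp: tensor_diagram_def U_def F_def)
  have edge_prod: "(\<Prod>e\<in>edges D. f e) = (\<Prod>u\<in>U. \<Prod>e\<in>F u. f e)" for f :: "'b \<Rightarrow> complex"
    unfolding F_def by (rule prod.group[OF fin(2) fin(3) own, symmetric])
  have half_tau: "half D c x m = (\<Prod>u\<in>U. tau x m u)" for x m
  proof -
    have "(\<Prod>v | v \<in> internal D \<and> icol D v = c. eps (map m (rot D (Inn v)))) =
       (\<Prod>u \<in> Inn ` {v. v \<in> internal D \<and> icol D v = c}. eps (map m (rot D u)))"
      by (subst prod.reindex) (auto simp: inj_on_def)
    also have "\<dots> = (\<Prod>u\<in>U. case u of Inn v \<Rightarrow> eps (map m (rot D u)) | Bd _ _ \<Rightarrow> 1)"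
      by (rule prod.mono_neutral_cong_left) (use fin in \<open>auto simp: U_def bverts_def split: vert.splits\<close>)
    moreover have "(\<Prod>e\<in>edges D. bcoord x (endp D c e) (m e)) = (\<Prod>u\<in>U. \<Prod>e\<in>F u. bcoord x u (m e))"
      unfolding edge_prod by (intro prod.cong refl) (simp add: F_def)
    moreover have "tau x m u = (case u of Inn v \<Rightarrow> eps (map m (rot D u)) | Bd _ _ \<Rightarrow> 1) * (\<Prod>e\<in>F u. bcoord x u (m e))" for u
      by (cases u) (auto simp: tau_def)
    ultimately show ?thesis unfolding half_def by (simp add: prod.distrib)
  qed
  have local: "tau (act g x) l u = (\<Sum>m \<in> F u \<rightarrow>\<^sub>E UNIV. tau x m u * (\<Prod>e\<in>F u. end_matrix c g $ m e $ l e))"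
    if u: "u \<in> U" for u
  proof (cases u)
    case (Bd c' n)
    then have [simp]: "c' = c" using u by (auto simp: U_def)
    have "tau (act g x) l u = (\<Prod>e\<in>F u. \<Sum>r\<in>UNIV. bcoord x u r * end_matrix c g $ r $ l e)"
      unfolding tau_def Bd by (simp add: bcoord_act)
    also have "\<dots> = (\<Sum>m \<in> F u \<rightarrow>\<^sub>E UNIV. \<Prod>e\<in>F u. bcoord x u (m e) * end_matrix c g $ m e $ l e)"
      by (rule prod_sum_PiE) (auto simp: finF)
    finally show ?thesis by (simp add: tau_def Bd prod.distrib)
  next
    case (Inn v)
    then have "length (rot D u) = 3" using u D by (auto simp: U_def tensor_diagram_def bverts_def)
    then obtain e1 e2 e3 where r: "rot D u = [e1, e2, e3]"
      by (auto simp: numeral_3_eq_3 length_Suc_conv)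
    then have d: "distinct [e1, e2, e3]" and Fu: "F u = {e1, e2, e3}" using rot[OF u] by auto
    define h where "h is = eps is * (end_matrix c g $ (is ! 0) $ l e1 * end_matrix c g $ (is ! 1) $ l e2 *
      end_matrix c g $ (is ! 2) $ l e3)" for "is"
    have "(\<Sum>m \<in> F u \<rightarrow>\<^sub>E UNIV. tau x m u * (\<Prod>e\<in>F u. end_matrix c g $ m e $ l e)) =
        (\<Sum>m \<in> {e1, e2, e3} \<rightarrow>\<^sub>E UNIV. h [m e1, m e2, m e3])"
      unfolding Fu using d r by (simp add: tau_def Inn h_def mult_ac)
    also have "\<dots> = (\<Sum>p\<in>UNIV. \<Sum>q\<in>UNIV. \<Sum>r\<in>UNIV. h [p, q, r])"
      by (rule sum_PiE_three[OF d])
    also have "\<dots> = eps [l e1, l e2, l e3]"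
      unfolding h_def using eps_transform[OF det_end_matrix[OF g]] by simp
    finally show ?thesis using r Inn by (simp add: tau_def)
  qed
  have restr: "tau x (restrict m (F u)) u * (\<Prod>e\<in>F u. end_matrix c g $ restrict m (F u) e $ l e) =
      tau x m u * (\<Prod>e\<in>F u. end_matrix c g $ m e $ l e)" if "u \<in> U" for m u
  proof -
    have "map (restrict m (F u)) (rot D u) = map m (rot D u)"
      using rot(2)[OF that] by auto
    then have "tau x (restrict m (F u)) u = tau x m u"
      by (cases u) (simp_all add: tau_def del: map_eq_conv)
    then show ?thesis by simp
  qed
  have "half D c (act g x) l = (\<Prod>u\<in>U. \<Sum>m \<in> F u \<rightarrow>\<^sub>E UNIV. tau x m u * (\<Prod>e\<in>F u. end_matrix c g $ m e $ l e))"
    unfolding half_tau using local by simp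
  also have "\<dots> = (\<Sum>m \<in> edges D \<rightarrow>\<^sub>E UNIV. \<Prod>u\<in>U. tau x m u * (\<Prod>e\<in>F u. end_matrix c g $ m e $ l e))"
    using sum_PiE_blocks[OF fin(3) fin(2) own,
        of "\<lambda>u m. tau x m u * (\<Prod>e\<in>F u. end_matrix c g $ m e $ l e)"] restr
    unfolding F_def by simp
  also have "\<dots> = (\<Sum>m \<in> edges D \<rightarrow>\<^sub>E UNIV. half D c x m * (\<Prod>e\<in>edges D. end_matrix c g $ m e $ l e))"
    by (simp add: half_tau edge_prod prod.distrib)
  finally show ?thesis .
qed

lemma invariant_act:
  assumes D: "tensor_diagram a b D" and g: "det g = 1"
  shows "invariant D (act g x) = invariant D x"
proof -
  let ?L = "edges D \<rightarrow>\<^sub>E (UNIV :: 3 set)"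
  let ?w = "\<lambda>m n l e. end_matrix White g $ m e $ l e * end_matrix Black g $ n e $ l e"
  have fin: "finite (edges D)" using D by (simp add: tensor_diagram_def)
  then have finL: "finite ?L" by (auto intro: finite_PiE)
  have delta: "(\<Sum>l\<in>?L. \<Prod>e\<in>edges D. ?w m n l e) = (if m = n then 1 else 0)"
    if mn: "m \<in> ?L" "n \<in> ?L" for m n
  proof -
    have "(\<Sum>l\<in>?L. \<Prod>e\<in>edges D. ?w m n l e) =
        (\<Prod>e\<in>edges D. \<Sum>s\<in>UNIV. end_matrix White g $ m e $ s * end_matrix Black g $ n e $ s)"
      by (rule prod_sum_PiE[symmetric]) (auto simp: fin)
    also have "\<dots> = (\<Prod>e\<in>edges D. if m e = n e then 1 else 0)"
      by (simp only: end_matrix_contract[OF g])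
    also have "\<dots> = (if m = n then 1 else 0)"
    proof (cases "m = n")
      case False
      then obtain e where "e \<in> edges D" "m e \<noteq> n e" using mn by (meson PiE_ext)
      then show ?thesis using False fin by (auto intro!: prod_zero)
    qed simp
    finally show ?thesis .
  qed
  have "invariant D (act g x) = (\<Sum>l\<in>?L. \<Sum>m\<in>?L. \<Sum>n\<in>?L.
      half D White x m * half D Black x n * (\<Prod>e\<in>edges D. ?w m n l e))"
    unfolding invariant_half[OF D] half_act[OF D g] sum_product
    by (simp add: prod.distrib mult_ac)
  also have "\<dots> = (\<Sum>m\<in>?L. \<Sum>l\<in>?L. \<Sum>n\<in>?L.
      half D White x m * half D Black x n * (\<Prod>e\<in>edges D. ?w m n l e))"
    by (rule sum.swap)
  also have "\<dots> = (\<Sum>m\<in>?L. \<Sum>n\<in>?L. \<Sum>l\<in>?L.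
      half D White x m * half D Black x n * (\<Prod>e\<in>edges D. ?w m n l e))"
    by (intro sum.cong refl sum.swap)
  also have "\<dots> = (\<Sum>m\<in>?L. \<Sum>n\<in>?L. half D White x m * half D Black x n * (if m = n then 1 else 0))"
    by (intro sum.cong refl) (simp only: delta flip: sum_distrib_left)
  also have "\<dots> = invariant D x"
    unfolding invariant_half[OF D] by (simp add: finL if_distrib cong: if_cong)
  finally show ?thesis .
qed

theorem invariant_in_ring: "tensor_diagram a b D \<Longrightarrow> invariant D \<in> invariant_ring a b"
  by (simp add: invariant_ring_def invariant_polynomial invariant_act)


section \<open>Webs\<close>

text \<open>
  A web is a planar tensor diagram up to isotopy, i.e. a combinatorial map of genus 0. The map has
  the edges of the diagram and the arcs of the boundary circle as its edges. \<open>Half c e\<close> is the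
  half-edge of \<open>e\<close> at its end of colour \<open>c\<close>; \<open>ArcF i\<close> and \<open>ArcB i\<close> are the half-arcs at the \<open>i\<close>-th
  boundary vertex towards the clockwise next and previous one. Planarity is Euler's formula
  \<open>V - E + F = 2 C\<close> where \<open>F\<close> counts face orbits and \<open>C\<close> connected components; the exterior of
  the disk is one of the faces, since \<open>ArcF i\<close> follows \<open>ArcB i\<close> in the rotation.
\<close>

datatype 'e dart = Half colour 'e | ArcF nat | ArcB nat

definition darts :: "('v, 'e) tdiag \<Rightarrow> 'e dart set" where
  "darts D = {Half c e | c e. e \<in> edges D} \<union> ArcF ` {..<length (circ D)} \<union> ArcB ` {..<length (circ D)}"

fun mate :: "('v, 'e) tdiag \<Rightarrow> 'e dart \<Rightarrow> 'e dart" where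
  "mate D (Half c e) = Half (opp c) e"
| "mate D (ArcF i) = ArcB (Suc i mod length (circ D))"
| "mate D (ArcB i) = ArcF ((i + length (circ D) - 1) mod length (circ D))"

definition vertex_cycles :: "('v, 'e) tdiag \<Rightarrow> 'e dart list set" where
  "vertex_cycles D =
     {map (Half (icol D v)) (rot D (Inn v)) | v. v \<in> internal D} \<union>
     {ArcF i # map (Half c) (rot D (Bd c n)) @ [ArcB i] | i c n. i < length (circ D) \<and> circ D ! i = (c, n)}"

definition turn :: "('v, 'e) tdiag \<Rightarrow> ('e dart \<times> 'e dart) set" where
  "turn D = {(ds ! i, ds ! (Suc i mod length ds)) | ds i. ds \<in> vertex_cycles D \<and> i < length ds}"

definition face_step :: "('v, 'e) tdiag \<Rightarrow> ('e dart \<times> 'e dart) set" where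
  "face_step D = {(d, d'). d \<in> darts D \<and> (mate D d, d') \<in> turn D}"

definition num_classes :: "'a set \<Rightarrow> ('a \<times> 'a) set \<Rightarrow> nat" where
  "num_classes A r = card ((\<lambda>x. (r \<union> r\<inverse>)\<^sup>* `` {x}) ` A)"

definition planar :: "('v, 'e) tdiag \<Rightarrow> bool" where
  "planar D \<longleftrightarrow>
     card (internal D) + length (circ D) + num_classes (darts D) (face_step D) =
     card (edges D) + length (circ D) + 2 * num_classes (darts D) (turn D \<union> face_step D)"

definition web :: "nat \<Rightarrow> nat \<Rightarrow> ('v, 'e) tdiag \<Rightarrow> bool" where
  "web a b W \<longleftrightarrow> tensor_diagram a b W \<and> planar W"

definition is_cycle :: "('v, 'e) tdiag \<Rightarrow> 'v vert list \<Rightarrow> 'e list \<Rightarrow> bool" where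
  "is_cycle D us es \<longleftrightarrow>
     2 \<le> length es \<and> length us = length es \<and> distinct us \<and> distinct es \<and> set es \<subseteq> edges D \<and>
     (\<forall>i<length es. {endp D White (es ! i), endp D Black (es ! i)} = {us ! i, us ! (Suc i mod length es)})"

text \<open>A cycle is identified with its set of edges, so that it has no base point or direction.\<close>

definition internal_cycle :: "('v, 'e) tdiag \<Rightarrow> 'e set \<Rightarrow> bool" where
  "internal_cycle D C \<longleftrightarrow> (\<exists>us es. is_cycle D us es \<and> set us \<subseteq> Inn ` internal D \<and> C = set es)"

definition non_elliptic :: "('v, 'e) tdiag \<Rightarrow> bool" where
  "non_elliptic W \<longleftrightarrow>
     (\<forall>e\<in>edges W. \<forall>e'\<in>edges W. (\<forall>c. endp W c e = endp W c e') \<longrightarrow> e = e') \<and>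
     \<not> (\<exists>C. internal_cycle W C \<and> card C \<le> 4)"

definition single_cycle_web :: "nat \<Rightarrow> nat \<Rightarrow> ('v, 'e) tdiag \<Rightarrow> bool" where
  "single_cycle_web a b W \<longleftrightarrow>
     web a b W \<and> non_elliptic W \<and> (\<exists>!C. internal_cycle W C) \<and>
     (\<forall>C. internal_cycle W C \<longrightarrow> 6 \<le> card C)"

definition the_cycle :: "('v, 'e) tdiag \<Rightarrow> 'e set" where
  "the_cycle W = (THE C. internal_cycle W C)"

text \<open>
  An internal vertex of \<open>W\<close> has only three edges, so a quadrilateral that meets the internal cycle
  shares an edge with it.
\<close>

definition boundary_quad_at_cycle :: "('v, 'e) tdiag \<Rightarrow> bool" where
  "boundary_quad_at_cycle W \<longleftrightarrow>
     (\<exists>us es. is_cycle W us es \<and> length es = 4 \<and>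
        card {u \<in> set us. u \<notin> Inn ` internal W} = 1 \<and> set es \<inter> the_cycle W \<noteq> {})"


section \<open>Thickening\<close>

text \<open>
  The honeycomb \<open>H_k\<close> replacing an internal vertex \<open>v\<close> is a triangle with corners numbered 0, 1, 2
  clockwise and side \<open>d\<close> opposite to corner \<open>d\<close>, facing the edge \<open>rot W (Inn v) ! d\<close>. Its vertices
  are \<open>(v, x)\<close> with \<open>x\<close> a list of three barycentric coordinates, of sum \<open>k - 1\<close> for the colour of
  \<open>v\<close> and of sum \<open>k - 2\<close> for the opposite colour. From a vertex with coordinates \<open>x\<close> of the first kind
  an edge points towards each side \<open>d\<close>: if \<open>x ! d > 0\<close> it is the inner edge \<open>Hon v x d\<close> ending at the
  vertex with \<open>x ! d\<close> lowered by 1, otherwise it leaves the honeycomb through side \<open>d\<close>.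
  \<open>Par e j\<close> is the \<open>j\<close>-th of the \<open>k\<close> copies of \<open>e\<close>, counted clockwise at the black end and
  therefore anticlockwise at the white end.
\<close>

datatype ('v, 'e) tedge = Par 'e nat | Hon 'v "nat list" nat

definition copy_at :: "nat \<Rightarrow> colour \<Rightarrow> nat \<Rightarrow> nat" where
  "copy_at k c t = (if c = Black then t else k - 1 - t)"

text \<open>The \<open>t\<close>-th vertex on side \<open>d\<close> of \<open>H_k\<close>, clockwise.\<close>

definition side_point :: "nat \<Rightarrow> nat \<Rightarrow> nat \<Rightarrow> nat list" where
  "side_point k d t = [0, 0, 0][(d + 1) mod 3 := k - 1 - t, (d + 2) mod 3 := t]"

definition idx :: "'a list \<Rightarrow> 'a \<Rightarrow> nat" where
  "idx xs y = length (takeWhile (\<lambda>z. z \<noteq> y) xs)"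

fun thick_endp :: "nat \<Rightarrow> ('v, 'e) tdiag \<Rightarrow> colour \<Rightarrow> ('v, 'e) tedge \<Rightarrow> ('v \<times> nat list) vert" where
  "thick_endp k W c (Par e j) =
     (case endp W c e of
        Bd c' n \<Rightarrow> Bd c' n
      | Inn v \<Rightarrow> Inn (v, side_point k (idx (rot W (Inn v)) e) (copy_at k c j)))"
| "thick_endp k W c (Hon v x d) =
     (if c = icol W v then Inn (v, x) else Inn (v, x[d := x ! d - 1]))"

fun thick_rot :: "nat \<Rightarrow> ('v, 'e) tdiag \<Rightarrow> ('v \<times> nat list) vert \<Rightarrow> ('v, 'e) tedge list" where
  "thick_rot k W (Bd c n) =
     concat (map (\<lambda>e. map (\<lambda>t. Par e (copy_at k c t)) [0..<k]) (rot W (Bd c n)))"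
| "thick_rot k W (Inn (v, x)) =
     map (\<lambda>d. if sum_list x + 1 = k
              then if 0 < x ! d then Hon v x d
                   else Par (rot W (Inn v) ! d) (copy_at k (icol W v) (x ! ((d + 2) mod 3)))
              else Hon v (x[d := x ! d + 1]) d) [0, 1, 2]"

definition thick :: "nat \<Rightarrow> ('v, 'e) tdiag \<Rightarrow> ('v \<times> nat list, ('v, 'e) tedge) tdiag" where
  "thick k W =
     \<lparr> internal = {(v, x). v \<in> internal W \<and> length x = 3 \<and> (sum_list x + 1 = k \<or> sum_list x + 2 = k)},
       icol = (\<lambda>(v, x). if sum_list x + 1 = k then icol W v else opp (icol W v)),
       edges = {Par e j | e j. e \<in> edges W \<and> j < k} \<union>
               {Hon v x d | v x d. v \<in> internal W \<and> length x = 3 \<and> sum_list x + 1 = k \<and> d < 3 \<and> 0 < x ! d},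
       endp = thick_endp k W,
       rot = thick_rot k W,
       circ = circ W \<rparr>"


section \<open>The web \<open>B(W)\<close>\<close>

text \<open>
  Each vertex of the internal cycle of \<open>W\<close> has one further edge, its leg. The cycle together with
  its legs is the single-cycle web \<open>S\<close> of alternating signature contained in \<open>W\<close>.
\<close>

definition S_verts :: "('v, 'e) tdiag \<Rightarrow> 'v set" where
  "S_verts W = {v \<in> internal W. \<exists>e\<in>the_cycle W. \<exists>c. endp W c e = Inn v}"

definition S_edges :: "('v, 'e) tdiag \<Rightarrow> 'e set" where
  "S_edges W = {e \<in> edges W. \<exists>c. endp W c e \<in> Inn ` S_verts W}"

definition thick_S_edges :: "('v, 'e) tdiag \<Rightarrow> ('v, 'e) tedge set" where
  "thick_S_edges W = {Par e j | e j. e \<in> S_edges W} \<union> {Hon v x d | v x d. v \<in> S_verts W}"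

definition leg :: "('v, 'e) tdiag \<Rightarrow> 'v \<Rightarrow> 'e" where
  "leg W v = (THE e. e \<in> set (rot W (Inn v)) \<and> e \<notin> the_cycle W)"

text \<open>
  Removing \<open>thick\<^sub>2(S)\<close> frees the outer ends of the two copies of every leg, and each of the two
  is joined to the nearest one coming from the neighbouring leg. Thus there is one joining edge
  \<open>Join e\<close> along every edge \<open>e\<close> of the cycle. If \<open>v\<close> is the end of \<open>e\<close> of colour \<open>opp c\<close>, then the
  leg at \<open>v\<close> has its outer end of colour \<open>c\<close>, and \<open>strand W c e\<close> is the copy of that leg lying on the
  side of \<open>e\<close>: the clockwise last one, seen from \<open>v\<close>, if \<open>e\<close> follows the leg clockwise at \<open>v\<close>, and
  the first one if \<open>e\<close> precedes it.
\<close>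

datatype ('v, 'e) bedge = Old "('v, 'e) tedge" | Join 'e

definition strand :: "('v, 'e) tdiag \<Rightarrow> colour \<Rightarrow> 'e \<Rightarrow> ('v, 'e) tedge" where
  "strand W c e =
     (case endp W (opp c) e of
        Inn v \<Rightarrow>
          (let r = rot W (Inn v); l = leg W v;
               t = (if r ! (Suc (idx r l) mod 3) = e then 1 else 0)
           in Par l (copy_at 2 (opp c) t)))"

fun B_endp :: "('v, 'e) tdiag \<Rightarrow> colour \<Rightarrow> ('v, 'e) bedge \<Rightarrow> ('v \<times> nat list) vert" where
  "B_endp W c (Old e) = endp (thick 2 W) c e"
| "B_endp W c (Join e) = endp (thick 2 W) c (strand W c e)"

definition B_rot :: "('v, 'e) tdiag \<Rightarrow> ('v \<times> nat list) vert \<Rightarrow> ('v, 'e) bedge list" where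
  "B_rot W u =
     map (\<lambda>e. if e \<in> thick_S_edges W
              then Join (THE e'. e' \<in> the_cycle W \<and> strand W (vcol (thick 2 W) u) e' = e)
              else Old e) (rot (thick 2 W) u)"

definition B_web :: "('v, 'e) tdiag \<Rightarrow> ('v \<times> nat list, ('v, 'e) bedge) tdiag" where
  "B_web W =
     \<lparr> internal = {(v, x) \<in> internal (thick 2 W). v \<notin> S_verts W},
       icol = icol (thick 2 W),
       edges = Old ` (edges (thick 2 W) - thick_S_edges W) \<union> Join ` the_cycle W,
       endp = B_endp W,
       rot = B_rot W,
       circ = circ W \<rparr>"


section \<open>Bracelets and Chebyshev polynomials\<close>

text \<open>
  The \<open>k\<close>-bracelet consists of copies \<open>0, \<dots>, k - 1\<close> of \<open>W\<close> with common boundary vertices, in which the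
  strands of one edge \<open>e\<^sub>0\<close> of the internal cycle are cyclically shifted: the \<open>i\<close>-th copy of \<open>e\<^sub>0\<close> runs
  from the \<open>i\<close>-th copy of its white end to the \<open>(i + 1)\<close>-st copy (modulo \<open>k\<close>) of its black end. This
  merges the internal cycles into one closed curve, at the cost of the \<open>k - 1\<close> crossings of the
  strand that returns from copy \<open>k - 1\<close> to copy \<open>0\<close>. Another choice of \<open>e\<^sub>0\<close> on the cycle gives the same
  diagram up to renaming.
\<close>

definition brac_endp :: "nat \<Rightarrow> ('v, 'e) tdiag \<Rightarrow> 'e \<Rightarrow> colour \<Rightarrow> 'e \<times> nat \<Rightarrow> ('v \<times> nat) vert" where
  "brac_endp k W e\<^sub>0 c p =
     (case endp W c (fst p) of
        Bd c' n \<Rightarrow> Bd c' n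
      | Inn v \<Rightarrow> Inn (v, if fst p = e\<^sub>0 \<and> c = Black then Suc (snd p) mod k else snd p))"

fun brac_rot :: "nat \<Rightarrow> ('v, 'e) tdiag \<Rightarrow> 'e \<Rightarrow> ('v \<times> nat) vert \<Rightarrow> ('e \<times> nat) list" where
  "brac_rot k W e\<^sub>0 (Bd c n) = concat (map (\<lambda>e. map (\<lambda>i. (e, i)) [0..<k]) (rot W (Bd c n)))"
| "brac_rot k W e\<^sub>0 (Inn (v, i)) =
     map (\<lambda>e. (e, if e = e\<^sub>0 \<and> icol W v = Black then (i + k - 1) mod k else i)) (rot W (Inn v))"

definition brac :: "nat \<Rightarrow> ('v, 'e) tdiag \<Rightarrow> 'e \<Rightarrow> ('v \<times> nat, 'e \<times> nat) tdiag" where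
  "brac k W e\<^sub>0 =
     \<lparr> internal = internal W \<times> {..<k},
       icol = icol W \<circ> fst,
       edges = edges W \<times> {..<k},
       endp = brac_endp k W e\<^sub>0,
       rot = brac_rot k W e\<^sub>0,
       circ = circ W \<rparr>"

definition brac_invariant :: "nat \<Rightarrow> ('v, 'e) tdiag \<Rightarrow> 'e \<Rightarrow> config \<Rightarrow> complex" where
  "brac_invariant k W e\<^sub>0 = (if k = 0 then 2 else invariant (brac k W e\<^sub>0))"

fun chebyshev_T :: "nat \<Rightarrow> 'a::comm_ring_1 \<Rightarrow> 'a \<Rightarrow> 'a" where
  "chebyshev_T 0 x y = 2"
| "chebyshev_T (Suc 0) x y = x"
| "chebyshev_T (Suc (Suc k)) x y = x * chebyshev_T (Suc k) x y - y * chebyshev_T k x y"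

end

theory Submission
  imports Defs
begin

text \<open>
  Cut \<open>W\<close> open at the edge \<open>e\<^sub>0\<close> of its internal cycle. For fixed arguments this leaves a \<open>3 \<times> 3\<close> matrix
  \<open>N\<close> with \<open>[W] = tr N\<close> and \<open>[brac\<^sub>k(W)] = tr (N\<^sup>k)\<close>. By the Cayley-Hamilton theorem it suffices to
  show that \<open>det N = 0\<close> and that the second elementary symmetric function of the eigenvalues of \<open>N\<close>,
  the trace of its cofactor matrix, is \<open>[B(W)]\<close>.

  Away from the cycle \<open>W\<close> is a forest, since a further internal cycle does not exist. A tree can be
  evaluated from its leaves: a vertex with two evaluated edges, carrying \<open>x\<close> and \<open>y\<close>, is replaced by the
  value \<open>x \<times> y\<close> on its third edge, and the honeycomb replacing that vertex in the 2-thickening turns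
  \<open>x \<otimes> x\<close> and \<open>y \<otimes> y\<close> into \<open>(x \<times> y) \<otimes> (x \<times> y)\<close>. Once every leg \<open>i\<close> of the cycle carries a value \<open>u\<^sub>i\<close>,
  the matrix \<open>N\<close> is up to a scalar the product of the singular matrices of \<open>v \<mapsto> \<plusminus> u\<^sub>i \<times> v\<close>. The cofactor
  matrix is multiplicative and that of \<open>v \<mapsto> \<plusminus> u \<times> v\<close> is \<open>u u\<^sup>T\<close>, so the trace of the cofactor matrix of
  the product is the product of the pairings of neighbouring legs, which are the joining edges of \<open>B(W)\<close>.
\<close>

section \<open>Sums over labellings\<close>

text \<open>If the eigenvalues of \<open>N\<close> are 0, \<open>r\<close> and \<open>s\<close>,
  then \<open>tr (N^k)\<close> is \<open>r^k + s^k\<close> for positive \<open>k\<close>, which is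
  \<open>T_k\<close> at the sum and the product of \<open>r\<close> and \<open>s\<close>. For
  \<open>k = 0\<close> the trace is 3, so that case rests on the convention 2. The second elementary
  symmetric function is quadratic in \<open>N\<close> and so can match a web in which everything is
  doubled. Being quadratic it also ignores the signs that the cyclic orders at the cycle vertices
  produce, and scalars from parts of the web away from the cycle enter squared. The value of a tree
  is never written in closed form. Instead \<open>[W]\<close> and \<open>[B(W)]\<close> are both
  described by sums with the same arbitrary weights at the ends of the edges. Removing a vertex with
  at most one edge to a remaining vertex changes the weights in the same way in both sums, so the
  two sides have to be computed only when nothing but the cycle, its legs and isolated edges is
  left. That such a vertex always exists is where the uniqueness of the cycle enters, through a
  longest path argument.\<close>

lemma sum_PiE_insert:
  assumes "a \<notin> A"
  shows "(\<Sum>l \<in> insert a A \<rightarrow>\<^sub>E UNIV. F l) = (\<Sum>l \<in> A \<rightarrow>\<^sub>E UNIV. \<Sum>s\<in>(UNIV::'l::finite set). F (l(a := s)))"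
proof -
  have "(\<Sum>l \<in> A \<rightarrow>\<^sub>E UNIV. \<Sum>s\<in>(UNIV::'l set). F (l(a := s))) =
      (\<Sum>(l, s) \<in> (A \<rightarrow>\<^sub>E UNIV) \<times> UNIV. F (l(a := s)))"
    by (simp add: sum.cartesian_product)
  also have "\<dots> = (\<Sum>l \<in> insert a A \<rightarrow>\<^sub>E UNIV. F l)"
    by (rule sum.reindex_bij_witness[of _ "\<lambda>l. (restrict l A, l a)" "\<lambda>(l, s). l(a := s)"])
       (use assms in \<open>auto simp: PiE_def extensional_def fun_eq_iff restrict_def\<close>)
  finally show ?thesis by simp
qed

text \<open>The summands are compared for labellings that agree along \<open>f\<close>, so
  applications need neither an explicit inverse of \<open>f\<close> nor restrictions to the index
  sets.\<close>

lemma sum_PiE_transfer: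
  fixes H :: "('a \<Rightarrow> 'l) \<Rightarrow> 'c::comm_monoid_add"
  assumes f: "bij_betw f A B"
    and eq: "\<And>m l. m \<in> A \<rightarrow>\<^sub>E UNIV \<Longrightarrow> l \<in> B \<rightarrow>\<^sub>E UNIV \<Longrightarrow> (\<And>a. a \<in> A \<Longrightarrow> m a = l (f a)) \<Longrightarrow> H m = G l"
  shows "(\<Sum>m \<in> A \<rightarrow>\<^sub>E UNIV. H m) = (\<Sum>l \<in> B \<rightarrow>\<^sub>E UNIV. G l)"
proof (rule sum.reindex_bij_witness[of _ "\<lambda>l. restrict (l \<circ> f) A" "\<lambda>m. restrict (m \<circ> inv_into A f) B"])
  have inv: "inv_into A f (f a) = a" if "a \<in> A" for a
    using f that by (simp add: bij_betw_def)
  have fB: "f a \<in> B" if "a \<in> A" for a using f that by (auto simp: bij_betw_def)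
  fix m :: "'a \<Rightarrow> 'l" assume m: "m \<in> A \<rightarrow>\<^sub>E UNIV"
  show "restrict (restrict (m \<circ> inv_into A f) B \<circ> f) A = m"
    using m by (auto simp: fun_eq_iff PiE_def extensional_def restrict_def inv fB)
  show "G (restrict (m \<circ> inv_into A f) B) = H m"
    by (rule eq[symmetric]) (use m in \<open>auto simp: inv fB\<close>)
next
  have inv2: "f (inv_into A f b) = b" "inv_into A f b \<in> A" if "b \<in> B" for b
    using f that by (auto simp: bij_betw_def f_inv_into_f inv_into_into)
  fix l :: "'b \<Rightarrow> 'l" assume l: "l \<in> B \<rightarrow>\<^sub>E UNIV"
  show "restrict (restrict (l \<circ> f) A \<circ> inv_into A f) B = l"
    using l by (auto simp: fun_eq_iff PiE_def extensional_def restrict_def inv2)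
qed auto

text \<open>The assumption asks that the summand depend only on the values on the two parts, so the
  glued labelling never appears in applications.\<close>

lemma sum_PiE_union:
  fixes H :: "('a \<Rightarrow> 'l) \<Rightarrow> 'c::comm_monoid_add"
  assumes disj: "A \<inter> B = {}"
    and eq: "\<And>l l1 l2. l1 \<in> A \<rightarrow>\<^sub>E UNIV \<Longrightarrow> l2 \<in> B \<rightarrow>\<^sub>E UNIV \<Longrightarrow> (\<And>a. a \<in> A \<Longrightarrow> l a = l1 a) \<Longrightarrow>
      (\<And>b. b \<in> B \<Longrightarrow> l b = l2 b) \<Longrightarrow> H l = G l1 l2"
  shows "(\<Sum>l \<in> A \<union> B \<rightarrow>\<^sub>E UNIV. H l) = (\<Sum>l1 \<in> A \<rightarrow>\<^sub>E UNIV. \<Sum>l2 \<in> B \<rightarrow>\<^sub>E UNIV. G l1 l2)"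
proof -
  have "(\<Sum>l1 \<in> A \<rightarrow>\<^sub>E UNIV. \<Sum>l2 \<in> B \<rightarrow>\<^sub>E UNIV. G l1 l2) =
      (\<Sum>(l1, l2) \<in> (A \<rightarrow>\<^sub>E UNIV) \<times> (B \<rightarrow>\<^sub>E UNIV). G l1 l2)"
    by (simp add: sum.cartesian_product)
  also have "\<dots> = (\<Sum>l \<in> A \<union> B \<rightarrow>\<^sub>E UNIV. H l)"
    by (rule sum.reindex_bij_witness[of _ "\<lambda>l. (restrict l A, restrict l B)"
      "\<lambda>(l1, l2). \<lambda>e. if e \<in> A then l1 e else l2 e"])
       (use disj in \<open>auto simp: PiE_def extensional_def fun_eq_iff restrict_def intro!: eq\<close>)
  finally show ?thesis by simp
qed

section \<open>Matrices of size 3\<close>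

definition next3 :: "3 \<Rightarrow> 3" where
  "next3 i = (if i = 1 then 2 else if i = 2 then 3 else 1)"

lemma next3_simps [simp]: "next3 1 = 2" "next3 2 = 3" "next3 3 = 1"
  by (simp_all add: next3_def)

text \<open>Cyclic successors of the indices pick the complementary minor in an order that absorbs
  the sign \<open>(-1)^(i+j)\<close>. This is the cofactor matrix and not its transpose, the
  adjugate, so products keep their order.\<close>

definition cof :: "complex^3^3 \<Rightarrow> complex^3^3" where
  "cof A = (\<chi> i j. A $ next3 i $ next3 j * A $ next3 (next3 i) $ next3 (next3 j)
     - A $ next3 i $ next3 (next3 j) * A $ next3 (next3 i) $ next3 j)"

text \<open>Cauchy-Binet for the minors of size 2.\<close>

lemma cof_mult: "cof (A ** B) = cof A ** cof B"
proof -
  have "cof (A ** B) $ i $ j = (cof A ** cof B) $ i $ j" for i j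
    by (simp add: cof_def matrix_matrix_mult_def sum_3) (simp only: algebra_simps)
  then show ?thesis by (simp add: vec_eq_iff)
qed

lemma cof_transpose: "cof (transpose A) = transpose (cof A)"
  by (simp add: cof_def transpose_def vec_eq_iff mult.commute)

lemma trace_3: "trace (A :: complex^3^3) = A $ 1 $ 1 + A $ 2 $ 2 + A $ 3 $ 3"
  by (simp add: trace_def sum_3)

fun matpow :: "complex^3^3 \<Rightarrow> nat \<Rightarrow> complex^3^3" where
  "matpow A 0 = mat 1"
| "matpow A (Suc k) = matpow A k ** A"

lemma cayley_hamilton_3:
  fixes A :: "complex^3^3"
  shows "(A ** A ** A) $ i $ j =
    trace A * (A ** A) $ i $ j - trace (cof A) * A $ i $ j + det A * mat 1 $ i $ j"
  using exhaust_3[of i] exhaust_3[of j]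
  by (elim disjE; hypsubst; simp add: cof_def matrix_matrix_mult_def sum_3 next3_simps trace_3 det_3
    mat_def algebra_simps)

text \<open>With determinant zero, Cayley-Hamilton multiplied by a power of \<open>A\<close> is a
  two-term recursion for traces. It reaches down to the first and second powers only, since the
  trace of \<open>mat 1\<close> is 3 whereas \<open>T_0\<close> is 2. The second power is Newton's
  identity, in which that 2 is the coefficient of \<open>trace (cof A)\<close>.\<close>

lemma trace_matpow_chebyshev:
  assumes "det A = 0"
  shows "trace (matpow A (Suc k)) = chebyshev_T (Suc k) (trace A) (trace (cof A))"
proof (induction "Suc k" arbitrary: k rule: less_induct)
  case less
  consider "k = 0" | "k = 1" | j where "k = Suc (Suc j)"
    by (metis One_nat_def not0_implies_Suc)
  then show ?case
  proof cases
    case 1 then show ?thesis by simp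
  next
    case 2
    have "trace (A ** A) = trace A * trace A - trace (cof A) * 2"
      by (simp add: cof_def matrix_matrix_mult_def sum_3 next3_simps trace_3 algebra_simps)
    then show ?thesis using 2 by simp
  next
    case 3
    have "matpow A (Suc k) $ r $ s =
      trace A * matpow A k $ r $ s - trace (cof A) * matpow A (Suc j) $ r $ s" for r s
    proof -
      have "matpow A (Suc k) = matpow A j ** (A ** A ** A)" "matpow A k = matpow A j ** (A ** A)"
        using 3 by (simp_all add: matrix_mul_assoc)
      then show ?thesis
        by (simp add: matrix_matrix_mult_def[of
          "matpow A j"] cayley_hamilton_3 assms sum_3 algebra_simps)
    qed
    then have "trace (matpow A (Suc k)) =
      trace A * trace (matpow A k) - trace (cof A) * trace (matpow A (Suc j))"
      unfolding trace_def[of "matpow A _"] by (simp only: sum_subtractf sum_distrib_left)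
    then show ?thesis using less[of "Suc j"] less[of j] 3 by simp
  qed
qed

text \<open>The product has \<open>Suc m\<close> factors and is never empty, so that a singular
  first factor makes it singular.\<close>

fun mprod :: "(nat \<Rightarrow> complex^3^3) \<Rightarrow> nat \<Rightarrow> complex^3^3" where
  "mprod M 0 = M 0"
| "mprod M (Suc m) = mprod M m ** M (Suc m)"

lemma mprod_const: "mprod (\<lambda>_. A) m = matpow A (Suc m)"
  by (induction m) auto

text \<open>The index \<open>t i\<close> sits between \<open>M i\<close> and
  \<open>M (Suc i)\<close>, and the outer indices are \<open>p\<close> and \<open>q\<close>. A sum
  over the labels of the edges along a cut cycle has this shape.\<close>

lemma mprod_sum:
  "(\<Sum>t \<in> {..<m} \<rightarrow>\<^sub>E UNIV. \<Prod>i\<le>m. M i $ (if i = 0 then p else t (i - 1)) $ (if i = m then q else t i)) =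
    mprod M m $ p $ q"
proof (induction m arbitrary: q)
  case 0
  then show ?case by simp
next
  case (Suc m)
  have "(\<Sum>t \<in> {..<Suc m} \<rightarrow>\<^sub>E UNIV. \<Prod>i\<le>Suc m. M i $ (if i = 0 then p else t (i - 1)) $ (if i =
    Suc m then q else t i))
    = (\<Sum>t \<in> {..<m} \<rightarrow>\<^sub>E UNIV. \<Sum>s\<in>UNIV.
        (\<Prod>i\<le>m. M i $ (if i = 0 then p else t (i - 1)) $ (if i = m then s else t i)) * M (Suc m) $ s
          $ q)"
    unfolding lessThan_Suc
  proof (subst sum_PiE_insert, simp, intro sum.cong refl)
    fix t :: "nat \<Rightarrow> 3" and s
    show "(\<Prod>i\<le>Suc m. M i $ (if i = 0 then p else (t(m := s)) (i - 1)) $ (if i =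
      Suc m then q else (t(m := s)) i)) =
      (\<Prod>i\<le>m. M i $ (if i = 0 then p else t (i - 1)) $ (if i = m then s else t i)) * M (Suc m) $ s $ q"
      unfolding prod.atMost_Suc by (intro arg_cong2[where f = "(*)"] prod.cong refl) auto
  qed
  also have "\<dots> = (\<Sum>s\<in>UNIV. (\<Sum>t \<in> {..<m} \<rightarrow>\<^sub>E UNIV.
        (\<Prod>i\<le>m. M i $ (if i = 0 then p else t (i - 1)) $ (if i = m then s else t i))) * M (Suc m) $ s
          $ q)"
    by (subst sum.swap) (simp add: sum_distrib_right)
  also have "\<dots> = mprod M (Suc m) $ p $ q"
    by (simp add: Suc.IH matrix_matrix_mult_def)
  finally show ?case .
qed

lemma cof_mprod: "cof (mprod M m) = mprod (\<lambda>i. cof (M i)) m"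
  by (induction m) (auto simp: cof_mult)

lemma det_mprod: "det (M 0) = 0 \<Longrightarrow> det (mprod M m) = 0"
  by (induction m) (auto simp: det_mul)

lemma mprod_rank_one:
  "mprod (\<lambda>i. \<chi> r s. u i r * u i s) m $ p $ q = u 0 p * (\<Prod>i<m. \<Sum>s\<in>UNIV. u i s * u (Suc i) s) * u m q"
proof (induction m arbitrary: q)
  case (Suc m)
  show ?case
    by (simp add: matrix_matrix_mult_def Suc.IH sum_3 algebra_simps)
qed simp

text \<open>The trace closes the chain by the pairing of the last vector with the first, hence the
  index modulo \<open>n\<close>.\<close>

lemma trace_mprod_rank_one:
  assumes "n = Suc m"
  shows "trace (mprod (\<lambda>i. \<chi> r s. u i r * u i s) m) = (\<Prod>i<n. \<Sum>s\<in>UNIV. u i s * u (Suc i mod n) s)"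
proof -
  have "(\<Prod>i<n. \<Sum>s\<in>UNIV. u i s * u (Suc i mod n) s) =
      (\<Prod>i<m. \<Sum>s\<in>UNIV. u i s * u (Suc i) s) * (\<Sum>s\<in>UNIV. u m s * u 0 s)"
    by (simp add: assms)
  then show ?thesis
    by (simp add: trace_def mprod_rank_one sum_distrib_left sum_distrib_right mult_ac)
qed

lemma mprod_cong: "(\<And>i. i \<le> m \<Longrightarrow> M i = M' i) \<Longrightarrow> mprod M m = mprod M' m"
  by (induction m) auto

lemma trace_cof_scale: "trace (cof (\<chi> i j. c * A $ i $ j)) = c\<^sup>2 * trace (cof A)"
  by (simp add: trace_3 cof_def power2_eq_square algebra_simps)

lemma det_scale_3: "det (\<chi> i j. c * A $ i $ j :: complex^3^3) = c ^ 3 * det A"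
  by (simp add: det_3 power3_eq_cube algebra_simps)

lemma trace_transpose: "trace (transpose A) = trace (A :: complex^3^3)"
  by (simp add: trace_def transpose_def)

section \<open>The honeycomb tensor\<close>

lemma eps_val: "eps [p, q, r] = (if (p, q, r) \<in> {(1,2,3), (2,3,1), (3,1,2)} then 1
      else if (p, q, r) \<in> {(1,3,2), (2,1,3), (3,2,1)} then -1 else 0)"
  using exhaust_3[of p] exhaust_3[of q] exhaust_3[of r]
  by (elim disjE) (simp_all add: eps_def vol_def det_3 axis_def)

text \<open>The value of \<open>H_2\<close> when the \<open>t\<close>-th edge leaving side
  \<open>d\<close>, counted clockwise, has label \<open>y d t\<close>. The labels \<open>p\<close>,
  \<open>q\<close>, \<open>r\<close> belong to the inner edges from the centre to the corners 0, 1,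
  2. Corner \<open>d\<close> is the last point of side \<open>d + 1\<close> and the first of side
  \<open>d + 2\<close>, modulo 3.\<close>

definition honeycomb_tensor :: "(nat \<Rightarrow> nat \<Rightarrow> 3) \<Rightarrow> complex" where
  "honeycomb_tensor y = (\<Sum>p\<in>UNIV. \<Sum>q\<in>UNIV. \<Sum>r\<in>UNIV.
     eps [p, q, r] * eps [p, y 1 1, y 2 0] * eps [y 0 0, q, y 2 1] * eps [y 0 1, y 1 0, r])"

text \<open>Let \<open>z\<close> be the cross product of \<open>x\<close> and \<open>y\<close>.
  After the outer sums the centre takes the triple product of \<open>y \<times> e_c\<close>,
  \<open>e_c' \<times> x\<close> and \<open>z\<close>. Since \<open>z\<close> is orthogonal to
  \<open>x\<close>, expanding the double cross product leaves \<open>z_c'\<close> times the pairing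
  of \<open>y \<times> e_c\<close> with \<open>x\<close>, and the latter is
  \<open>z_c\<close>.\<close>

lemma honeycomb_tensor_contract:
  fixes x y :: "3 \<Rightarrow> complex"
  shows "(\<Sum>a\<in>UNIV. \<Sum>a'\<in>UNIV. \<Sum>b\<in>UNIV. \<Sum>b'\<in>UNIV. (\<Sum>p\<in>UNIV. \<Sum>q\<in>UNIV. \<Sum>r\<in>UNIV.
     eps [p, q, r] * eps [p, b', c] * eps [a, q, c'] * eps [a', b, r]) * (x a * x a' * (y b * y b'))) =
     (\<Sum>a\<in>UNIV. \<Sum>b\<in>UNIV. eps [a, b, c] * (x a * y b)) * (\<Sum>a\<in>UNIV. \<Sum>b\<in>UNIV. eps [a, b, c'] * (x a * y b))"
proof -
  let ?X = "\<lambda>c. \<Sum>a\<in>UNIV. \<Sum>b\<in>UNIV. eps [a, b, c] * (x a * y b)"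
  have "(\<Sum>a\<in>UNIV. \<Sum>a'\<in>UNIV. \<Sum>b\<in>UNIV. \<Sum>b'\<in>UNIV. (\<Sum>p\<in>UNIV. \<Sum>q\<in>UNIV. \<Sum>r\<in>UNIV.
     eps [p, q, r] * eps [p, b', c] * eps [a, q, c'] * eps [a', b, r]) * (x a * x a' * (y b * y b'))) =
    (\<Sum>p\<in>UNIV. \<Sum>q\<in>UNIV. \<Sum>r\<in>UNIV. eps [p, q, r] * (\<Sum>b'\<in>UNIV. eps [p, b', c] * y b') *
       (\<Sum>a\<in>UNIV. eps [a, q, c'] * x a) * (\<Sum>a'\<in>UNIV. \<Sum>b\<in>UNIV. eps [a', b, r] * (x a' * y b)))"
    (is "?L = ?R")
  proof -
    let ?t = "\<lambda>a a' b b' p q r. eps [p, q, r] * eps [p, b', c] * eps [a, q, c'] * eps [a', b, r] *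
      (x a * x a' * (y b * y b'))"
    have "?L = (\<Sum>(a, a', b, b', p, q, r)\<in>UNIV. ?t a a' b b' p q r)"
      unfolding sum_distrib_right by (simp add: sum.cartesian_product flip: UNIV_Times_UNIV)
    also have "\<dots> = (\<Sum>(p, q, r, b', a, a', b)\<in>UNIV. ?t a a' b b' p q r)"
      by (rule sum.reindex_bij_witness[of _ "\<lambda>(p, q, r, b', a, a', b). (a, a', b, b', p, q, r)"
            "\<lambda>(a, a', b, b', p, q, r). (p, q, r, b', a, a', b)"]) auto
    also have "\<dots> = (\<Sum>p\<in>UNIV. \<Sum>q\<in>UNIV. \<Sum>r\<in>UNIV. \<Sum>b'\<in>UNIV. \<Sum>a\<in>UNIV. \<Sum>a'\<in>UNIV. \<Sum>b\<in>UNIV.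
      ?t a a' b b' p q r)"
      by (simp add: sum.cartesian_product flip: UNIV_Times_UNIV)
    also have "\<dots> = ?R"
      by (simp only: sum_distrib_left sum_distrib_right mult_ac)
    finally show ?thesis .
  qed
  also have "\<dots> = ?X c * ?X c'"
    using exhaust_3[of c] exhaust_3[of c']
    by (elim disjE; hypsubst; simp add: sum_3 eps_val; simp add: algebra_simps)
  finally show ?thesis .
qed


lemma nat_less_3_cases: "d < 3 \<Longrightarrow> (d = 0 \<Longrightarrow> P) \<Longrightarrow> (d = 1 \<Longrightarrow> P) \<Longrightarrow> (d = 2 \<Longrightarrow> P) \<Longrightarrow> P" for d :: nat
  by linarith

lemma eps_rotate: "eps [q, r, p] = eps [p, q, r]"
  by (auto simp: eps_val)

text \<open>A third of a turn of \<open>H_2\<close> permutes its corners cyclically;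
  \<open>eps\<close> is invariant under cyclic shifts, and the inner labels are renamed.\<close>

lemma honeycomb_tensor_rotate:
  "honeycomb_tensor (\<lambda>d t. y (Suc d mod 3) t) = honeycomb_tensor y"
proof -
  have "honeycomb_tensor (\<lambda>d t. y (Suc d mod 3) t) = (\<Sum>p\<in>UNIV. \<Sum>q\<in>UNIV. \<Sum>r\<in>UNIV.
     eps [r, p, q] * eps [r, y 1 1, y 2 0] * eps [y 0 0, p, y 2 1] * eps [y 0 1, y 1 0, q])"
       (is "_ = (\<Sum>p\<in>UNIV. \<Sum>q\<in>UNIV. \<Sum>r\<in>UNIV. ?t r p q)")
    unfolding honeycomb_tensor_def
    by (simp add: eps_rotate[of _ _ "y 0 0"] eps_rotate[of _ _ "y 0 1"] eps_rotate[of
      "y 1 1"] eps_rotate[of "y (Suc 0) (Suc 0)"]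
      eps_rotate[of _ _ "y 0 (Suc 0)"] mult_ac)
       (intro sum.cong refl, subst eps_rotate, simp add: numeral_2_eq_2)
  also have "\<dots> = (\<Sum>p\<in>UNIV. \<Sum>r\<in>UNIV. \<Sum>q\<in>UNIV. ?t r p q)"
    by (intro sum.cong refl sum.swap)
  also have "\<dots> = (\<Sum>r\<in>UNIV. \<Sum>p\<in>UNIV. \<Sum>q\<in>UNIV. ?t r p q)"
    by (rule sum.swap)
  finally show ?thesis by (simp add: honeycomb_tensor_def)
qed

text \<open>The form used for pruning a tree: side \<open>d\<close> stays free with labels
  \<open>cc\<close>, while both edges of side \<open>d + 1\<close> carry \<open>x\<close> and both
  edges of side \<open>d + 2\<close> carry \<open>y\<close>. Rotation reduces every \<open>d\<close>
  to \<open>d = 2\<close>.\<close>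

lemma honeycomb_tensor_cherry:
  fixes x y :: "3 \<Rightarrow> complex"
  assumes "d < 3"
  defines "X \<equiv> \<lambda>c. \<Sum>a\<in>UNIV. \<Sum>b\<in>UNIV.
    eps (map (\<lambda>j. if j = d then c else if j = Suc d mod 3 then a else b) [0, 1, 2]) * (x a * y b)"
  shows "(\<Sum>a\<in>UNIV. \<Sum>a'\<in>UNIV. \<Sum>b\<in>UNIV. \<Sum>b'\<in>UNIV. honeycomb_tensor (\<lambda>j t. if j = d then cc t else
      if j = Suc d mod 3 then (if t = 0 then a else a')
        else (if t = 0 then b else b')) * (x a * x a' * (y b * y b'))) =
     X (cc 0) * X (cc (Suc 0))"
proof -
  have H: "honeycomb_tensor (\<lambda>j t. if j = 2 then cc t else if j =
    0 then (if t = 0 then a else a') else (if t = 0 then b else b')) =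
     (\<Sum>p\<in>UNIV. \<Sum>q\<in>UNIV. \<Sum>r\<in>UNIV.
     eps [p, q, r] * eps [p, b', cc 0] * eps [a, q, cc (Suc 0)] * eps [a', b, r])" for a a' b b'
    by (simp add: honeycomb_tensor_def)
  have rot: "honeycomb_tensor y = honeycomb_tensor z"
    if "\<And>d t. d < 3 \<Longrightarrow> t < 2 \<Longrightarrow> z d t = y (Suc d mod 3) t" for y z
  proof -
    have "honeycomb_tensor z = honeycomb_tensor (\<lambda>d t. y (Suc d mod 3) t)"
      unfolding honeycomb_tensor_def by (simp add: that)
    then show ?thesis by (simp add: honeycomb_tensor_rotate)
  qed
  have key: "(\<Sum>a\<in>UNIV. \<Sum>a'\<in>UNIV. \<Sum>b\<in>UNIV. \<Sum>b'\<in>UNIV. honeycomb_tensor (\<lambda>j t. if j = d then cc t else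
      if j = Suc d mod 3 then (if t = 0 then a else a')
        else (if t = 0 then b else b')) * (x a * x a' * (y b * y b'))) =
     (\<Sum>a\<in>UNIV. \<Sum>b\<in>UNIV. eps [a, b, cc 0] * (x a * y b)) *
       (\<Sum>a\<in>UNIV. \<Sum>b\<in>UNIV. eps [a, b, cc (Suc 0)] * (x a * y b))"
    if "\<And>a a' b b'. honeycomb_tensor (\<lambda>j t. if j = d then cc t else
      if j = Suc d mod 3 then (if t = 0 then a else a') else (if t = 0 then b else b')) =
      honeycomb_tensor (\<lambda>j t. if j = 2 then cc t else
        if j = 0 then (if t = 0 then a else a') else (if t = 0 then b else b'))"
    unfolding that H by (rule honeycomb_tensor_contract)
  have X: "X c = (\<Sum>a\<in>UNIV. \<Sum>b\<in>UNIV. eps [a, b, c] * (x a * y b))" for c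
  proof -
    have "eps (map (\<lambda>j. if j = d then c else if j = Suc d mod 3 then a else b) [0, 1, 2]) =
      eps [a, b, c]" for a b
    proof -
      consider "d = 2" | "d = 0" | "d = 1" using assms by linarith
      then show ?thesis
        by cases (simp_all add: eps_rotate[of b c a] eps_rotate[of a b c])
    qed
    then show ?thesis unfolding X_def by simp
  qed
  consider "d = 2" | "d = 0" | "d = 1" using assms by linarith
  then show ?thesis
  proof cases
    case 1
    then have "Suc d mod 3 = 0" by simp
    then show ?thesis unfolding X by (intro key) (simp only: 1)
  next
    case 2
    have "Suc d mod 3 = 1" using 2 by simp
    then show ?thesis unfolding X
      by (intro key rot) (simp only: 2, erule nat_less_3_cases; simp)
  next
    case 3
    have "Suc d mod 3 = 2" using 3 by simp
    then show ?thesis unfolding X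
      by (intro key rot[symmetric]) (simp only: 3, erule nat_less_3_cases; simp)
  qed
qed

lemma eps_swap: "eps [q, p, r] = - eps [p, q, r]"
  by (auto simp: eps_val)

text \<open>With \<open>u\<close> on the edge \<open>g\<close> the vertex acts as plus or minus the
  matrix of the cross product with \<open>u\<close>; the sign tells whether \<open>rs\<close> is a
  rotation of \<open>[e, f, g]\<close>. Cofactors are quadratic and lose the sign, and a skew matrix
  of size 3 has determinant zero.\<close>

lemma cross_matrix:
  fixes u :: "3 \<Rightarrow> complex"
  assumes "distinct [e, f, g]" "set rs = {e, f, g}" "length rs = 3"
  defines "M \<equiv> \<chi> p q. \<Sum>s\<in>UNIV. eps (map (\<lambda>h. if h = g then s else if h = e then p else q) rs) * u s"
  shows "cof M = (\<chi> r s. u r * u s)" and "det M = 0"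
proof -
  define K :: "complex^3^3" where "K = (\<chi> p q. \<Sum>s\<in>UNIV. eps [p, q, s] * u s)"
  obtain x y z where rs: "rs = [x, y, z]"
    using assms(3) by (metis length_0_conv length_Suc_conv numeral_3_eq_3)
  have "distinct rs" by (rule card_distinct) (use assms in simp)
  then have ne: "x \<noteq> y" "x \<noteq> z" "y \<noteq> z" unfolding rs by simp_all
  have "x \<in> {e, f, g}" "y \<in> {e, f, g}" "z \<in> {e, f, g}" unfolding assms(2)[symmetric] rs by simp_all
  with ne have "(x, y, z) \<in> {(e, f, g), (f, g, e), (g, e, f), (f, e, g), (e, g, f), (g, f, e)}"
    by (elim insertE emptyE; simp)
  then consider "rs = [e, f, g] \<or> rs = [f, g, e] \<or> rs = [g, e, f]" | "rs = [f, e, g] \<or> rs =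
    [e, g, f] \<or> rs = [g, f, e]"
    unfolding rs by blast
  then have "(\<forall>p q s. eps (map (\<lambda>h. if h = g then s else if h = e then p else q) rs) = eps [p, q, s]) \<or>
     (\<forall>p q s. eps (map (\<lambda>h. if h = g then s else if h = e then p else q) rs) = - eps [p, q, s])"
  proof cases
    case 1
    have "eps (map (\<lambda>h. if h = g then s else if h = e then p else q) rs) = eps [p, q, s]" for p q s
      using 1 assms(1) eps_rotate[of q s p] eps_rotate[of s p q] by (elim disjE) (simp_all, auto)
    then show ?thesis by blast
  next
    case 2
    have "eps (map (\<lambda>h. if h = g then s else if h = e then p else q) rs) = - eps [p, q, s]" for p q s
      using 2 assms(1) eps_swap[of q p s] eps_rotate[of p s q] eps_rotate[of s q p]
        by (elim disjE) (simp_all, auto)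
    then show ?thesis by blast
  qed
  then have M: "M = K \<or> M = - K"
    by (auto simp: M_def K_def vec_eq_iff sum_negf)
  have K: "K $ 1 $ 1 = 0" "K $ 2 $ 2 = 0" "K $ 3 $ 3 = 0" "K $ 1 $ 2 = u 3" "K $ 2 $ 3 = u 1"
    "K $ 3 $ 1 = u 2"
    "K $ 2 $ 1 = - u 3" "K $ 3 $ 2 = - u 1" "K $ 1 $ 3 = - u 2"
    by (simp_all add: K_def sum_3 eps_val)
  show "cof M = (\<chi> r s. u r * u s)"
    using M by (auto simp: vec_eq_iff forall_3 cof_def K)
  show "det M = 0"
    using M by (auto simp: det_3 K)
qed

lemma honeycomb_tensor_cong: "(\<And>d t. d < 3 \<Longrightarrow> t < 2 \<Longrightarrow> y d t = z d t) \<Longrightarrow> honeycomb_tensor y =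
  honeycomb_tensor z"
  unfolding honeycomb_tensor_def by simp

section \<open>Combinatorics of single-cycle webs\<close>

lemma idx_nth:
  assumes "y \<in> set xs" shows "idx xs y < length xs" "xs ! idx xs y = y"
  using assms by (induction xs) (auto simp: idx_def)

text \<open>The corners of \<open>H_2\<close>; its only other vertex is the centre
  \<open>[0, 0, 0]\<close>.\<close>

definition unit_point :: "nat \<Rightarrow> nat list" where
  "unit_point d = [0, 0, 0][d := 1]"

lemma unit_point_simps: "unit_point 0 = [1, 0, 0]" "unit_point 1 = [0, 1, 0]" "unit_point (Suc 0) =
  [0, 1, 0]" "unit_point 2 = [0, 0, 1]"
  by (simp_all add: unit_point_def)

lemma length_3_conv: "length x = 3 \<longleftrightarrow> (\<exists>a b c. x = [a, b, c])"
  by (auto simp: numeral_3_eq_3 length_Suc_conv)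

lemma sum_list_1_conv:
  "length x = 3 \<and> sum_list x + 1 = 2 \<longleftrightarrow> x \<in> {unit_point 0, unit_point 1, unit_point 2}"
    for x :: "nat list"
proof
  assume "length x = 3 \<and> sum_list x + 1 = 2"
  then obtain a b c where x: "x = [a, b, c]" "a + b + c = 1" by (auto simp: length_3_conv)
  then have "a = 1 \<and> b = 0 \<and> c = 0 \<or> a = 0 \<and> b = 1 \<and> c = 0 \<or> a = 0 \<and> b = 0 \<and> c = 1" by linarith
  then show "x \<in> {unit_point 0, unit_point 1, unit_point 2}" unfolding x unit_point_simps by blast
qed (auto simp: unit_point_def)

lemma sum_list_0_conv: "length x = 3 \<and> sum_list x + 2 = 2 \<longleftrightarrow> x = [0, 0, 0]" for x :: "nat list"
  by (auto simp: length_3_conv)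

locale single_cycle =
  fixes a b :: nat and W :: "('v, 'e) tdiag" and e\<^sub>0 :: 'e
  assumes single_cycle_web: "single_cycle_web a b W" and e\<^sub>0_cycle: "e\<^sub>0 \<in> the_cycle W"
begin

lemma tensor_diagram: "tensor_diagram a b W"
  using single_cycle_web by (simp add: single_cycle_web_def web_def)

lemma finite_internal: "finite (internal W)" and finite_edges: "finite (edges W)"
  using tensor_diagram by (auto simp: tensor_diagram_def)

lemma endp_col: "e \<in> edges W \<Longrightarrow> vcol W (endp W c e) = c"
  using tensor_diagram by (auto simp: tensor_diagram_def)

lemma endp_Inn: "e \<in> edges W \<Longrightarrow> endp W c e = Inn v \<Longrightarrow> v \<in> internal W \<and> icol W v = c"
proof -
  assume e: "e \<in> edges W" "endp W c e = Inn v"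
  have "endp W c e \<in> bverts a b \<union> Inn ` internal W" using tensor_diagram e(1)
    unfolding tensor_diagram_def by blast
  then have "v \<in> internal W" unfolding e(2) bverts_def by auto
  then show "v \<in> internal W \<and> icol W v = c" using endp_col[OF e(1), of c] e(2) by simp
qed

lemma rot_internal:
  assumes "v \<in> internal W"
  shows "distinct (rot W (Inn v))" "length (rot W (Inn v)) = 3"
    "set (rot W (Inn v)) = {e \<in> edges W. endp W (icol W v) e = Inn v}"
  using tensor_diagram assms by (auto simp: tensor_diagram_def)

lemma endp_neq: "e \<in> edges W \<Longrightarrow> endp W White e \<noteq> endp W Black e"
  using endp_col[of e White] endp_col[of e Black] by auto

lemma in_rot: "e \<in> edges W \<Longrightarrow> endp W c e = Inn v \<Longrightarrow> e \<in> set (rot W (Inn v))"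
  using endp_Inn[of e c v] rot_internal(3)[of v] by auto

lemma cycle_unique:
  assumes "is_cycle W us es" "set us \<subseteq> Inn ` internal W"
  shows "set es = the_cycle W"
proof -
  have ex: "\<exists>!C. internal_cycle W C" using single_cycle_web unfolding single_cycle_web_def by blast
  have "internal_cycle W (set es)" using assms by (auto simp: internal_cycle_def)
  then show ?thesis unfolding the_cycle_def using the1_equality[OF ex] by simp
qed

lemma the_cycle_cycle: "internal_cycle W (the_cycle W)"
proof -
  have "\<exists>!C. internal_cycle W C" using single_cycle_web unfolding single_cycle_web_def by blast
  then show ?thesis unfolding the_cycle_def by (rule theI')
qed

lemma the_cycle_card: "6 \<le> card (the_cycle W)"
  using single_cycle_web the_cycle_cycle unfolding single_cycle_web_def by blast

text \<open>The enumeration is turned so that the cut edge comes last: the cut cycle runs from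
  \<open>vs 0\<close> to \<open>vs (n - 1)\<close> along the other edges. Its direction is not tied
  to the colours.\<close>

lemma cycle_enumeration:
  obtains n and vs :: "nat \<Rightarrow> 'v" and es :: "nat \<Rightarrow> 'e"
  where "6 \<le> n" "inj_on vs {..<n}" "inj_on es {..<n}" "es (n - 1) = e\<^sub>0"
    "the_cycle W = es ` {..<n}" "S_verts W = vs ` {..<n}"
    "\<And>i. i < n \<Longrightarrow> {endp W White (es i), endp W Black (es i)} = {Inn (vs i), Inn (vs (Suc i mod n))}"
    "the_cycle W \<subseteq> edges W"
proof -
  obtain us xs where cyc: "is_cycle W us xs" "set us \<subseteq> Inn ` internal W" "the_cycle W = set xs"
    using the_cycle_cycle by (auto simp: internal_cycle_def)
  define n where "n = length xs"
  have len: "length us = n" and d: "distinct us" "distinct xs" and sub: "set xs \<subseteq> edges W"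
    and ends: "\<And>i. i < n \<Longrightarrow> {endp W White (xs ! i), endp W Black (xs ! i)} =
      {us ! i, us ! (Suc i mod n)}"
    using cyc(1) by (auto simp: is_cycle_def n_def)
  have n6: "6 \<le> n" using the_cycle_card cyc(3) d(2) by (simp add: distinct_card n_def)
  obtain k where k: "k < n" "xs ! k = e\<^sub>0"
    using e\<^sub>0_cycle cyc(3) by (auto simp: in_set_conv_nth n_def)
  \<comment> \<open>The shift by \<open>k + 1\<close> sends the last index \<open>n - 1\<close> to
    the position \<open>k\<close> of \<open>e\<^sub>0\<close>.\<close>
  define sh where "sh i = (i + (k + 1)) mod n" for i
  define es where "es i = xs ! sh i" for i
  define vs where "vs i = (case us ! sh i of Inn v \<Rightarrow> v)" for i
  have shn: "sh i < n" for i using n6 by (simp add: sh_def)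
  have inj: "inj_on sh {..<n}"
  proof (rule inj_onI)
    fix i j assume ij: "i \<in> {..<n}" "j \<in> {..<n}" "sh i = sh j"
    have sh: "sh i = (if i + (k + 1) < n then i + (k + 1) else i + (k + 1) - n)" if "i < n" for i
      using that k(1) by (auto simp: sh_def le_mod_geq)
    show "i = j" using ij k(1) by (auto simp: sh split: if_splits)
  qed
  have img: "sh ` {..<n} = {..<n}"
    by (rule endo_inj_surj) (use inj shn in auto)
  have Suc: "sh (Suc i mod n) = Suc (sh i) mod n" for i
    unfolding sh_def by (metis add_Suc mod_Suc_eq mod_add_left_eq)
  have vs: "Inn (vs i) = us ! sh i" for i
  proof -
    have "us ! sh i \<in> set us" using shn len by simp
    then show ?thesis using cyc(2) by (auto simp: vs_def)
  qed
  have ends': "{endp W White (es i), endp W Black (es i)} = {Inn (vs i), Inn (vs (Suc i mod n))}" for i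
    unfolding vs Suc es_def using ends[OF shn] .
  have C: "the_cycle W = es ` {..<n}"
  proof -
    have "es ` {..<n} = (!) xs ` sh ` {..<n}" unfolding es_def by (simp add: image_image)
    then show ?thesis unfolding img cyc(3) by (auto simp: in_set_conv_nth n_def)
  qed
  have vsi: "vs i \<in> internal W" for i
  proof -
    have "us ! sh i \<in> Inn ` internal W" using shn[of i] len cyc(2) nth_mem[of "sh i" us]
      by (metis subsetD)
    then show ?thesis unfolding vs[symmetric] by auto
  qed
  have inV: "inj_on vs {..<n}"
  proof (rule inj_onI)
    fix i j assume ij: "i \<in> {..<n}" "j \<in> {..<n}" "vs i = vs j"
    then have "us ! sh i = us ! sh j" by (simp flip: vs)
    then have "sh i = sh j" using d(1) len shn by (simp add: nth_eq_iff_index_eq)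
    then show "i = j" using inj ij by (auto dest: inj_onD)
  qed
  have "S_verts W = vs ` {..<n}"
  proof (intro set_eqI iffI)
    fix v assume "v \<in> S_verts W"
    then obtain i c where i: "i < n" "endp W c (es i) = Inn v"
      unfolding S_verts_def C by auto
    then have "Inn v \<in> {endp W White (es i), endp W Black (es i)}" by (cases c) auto
    then have "v = vs i \<or> v = vs (Suc i mod n)" unfolding ends' by auto
    then show "v \<in> vs ` {..<n}" using i(1) by auto
  next
    fix v assume "v \<in> vs ` {..<n}"
    then obtain i where i: "i < n" "v = vs i" by auto
    then have "Inn v \<in> {endp W White (es i), endp W Black (es i)}" unfolding ends' by auto
    then obtain c where "endp W c (es i) = Inn v" by auto
    then show "v \<in> S_verts W" using vsi i unfolding S_verts_def C by blast
  qed
  moreover have "inj_on es {..<n}"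
    using d(2) shn inj by (auto simp: inj_on_def es_def nth_eq_iff_index_eq n_def)
  moreover have "sh (n - 1) = k" using k n6 by (simp add: sh_def)
  then have "es (n - 1) = e\<^sub>0" using k by (simp add: es_def)
  ultimately show thesis using that[OF n6 inV _ _ C _ ends'] sub cyc(3) by blast
qed

section \<open>Paths that avoid the cut edge, and subgraphs of minimum degree two\<close>

definition in_sub :: "'v set \<Rightarrow> 'e \<Rightarrow> bool" where
  "in_sub K e \<longleftrightarrow> e \<in> edges W \<and> (\<forall>c. endp W c e \<in> Inn ` K)"

definition ends :: "'e \<Rightarrow> 'v vert set" where
  "ends e = {endp W White e, endp W Black e}"

text \<open>Avoiding \<open>e\<^sub>0\<close> is the point: the only internal cycle passes through
  \<open>e\<^sub>0\<close>, so no edge other than \<open>e\<^sub>0\<close> can close such a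
  path.\<close>

definition sub_path :: "'v set \<Rightarrow> 'v vert list \<Rightarrow> 'e list \<Rightarrow> bool" where
  "sub_path K us es \<longleftrightarrow> length us = Suc (length es) \<and> distinct us \<and> set us \<subseteq> Inn ` K \<and>
     (\<forall>i<length es. in_sub K (es ! i) \<and> es ! i \<noteq> e\<^sub>0 \<and> ends (es ! i) = {us ! i, us ! Suc i})"

lemma sub_path_rev:
  assumes "sub_path K us es"
  shows "sub_path K (rev us) (rev es)"
proof -
  have l: "length us = Suc (length es)" using assms by (simp add: sub_path_def)
  show ?thesis unfolding sub_path_def
  proof (intro conjI allI impI)
    fix i assume i: "i < length (rev es)"
    define j where "j = length es - Suc i"
    have "rev es ! i = es ! j" "rev us ! i = us ! Suc j" "rev us ! Suc i = us ! j" "j < length es"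
      using i l by (simp_all add: rev_nth j_def Suc_diff_Suc)
    then show "in_sub K (rev es ! i)" "rev es ! i \<noteq> e\<^sub>0" "ends (rev es ! i) =
      {rev us ! i, rev us ! Suc i}"
      using assms by (auto simp: sub_path_def)
  qed (use assms in \<open>auto simp: sub_path_def\<close>)
qed

lemma sub_path_distinct_edges:
  assumes "sub_path K us es"
  shows "distinct es"
  unfolding distinct_conv_nth
proof (intro allI impI)
  fix i j assume ij: "i < length es" "j < length es" "i \<noteq> j"
  have d: "distinct us" "length us = Suc (length es)" using assms by (auto simp: sub_path_def)
  show "es ! i \<noteq> es ! j"
  proof
    assume "es ! i = es ! j"
    then have "{us ! i, us ! Suc i} = {us ! j, us ! Suc j}" using assms ij unfolding sub_path_def
      by metis
    then show False using d ij by (auto simp: doubleton_eq_iff nth_eq_iff_index_eq)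
  qed
qed

text \<open>The closed piece is an internal cycle, and there is only one. For \<open>i = 1\<close>
  it would be a pair of parallel edges, which \<open>is_cycle\<close> admits;
  \<open>h \<notin> set es\<close> prevents one edge from being run through twice.\<close>

lemma sub_path_close:
  assumes p: "sub_path K us es" and K: "K \<subseteq> internal W" and h: "h \<in> edges W" "h \<notin> set es"
    and i: "1 \<le> i" "i \<le> length es" and eh: "ends h = {us ! 0, us ! i}"
  shows "insert h (set (take i es)) = the_cycle W"
proof -
  have l: "length us = Suc (length es)" "distinct us" using p by (auto simp: sub_path_def)
  have "is_cycle W (take (Suc i) us) (take i es @ [h])"
    unfolding is_cycle_def
  proof (intro conjI allI impI)
    show "2 \<le> length (take i es @ [h])" "length (take (Suc i) us) = length (take i es @ [h])"
      using i l by auto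
    show "distinct (take i es @ [h])" using sub_path_distinct_edges[OF p] h by (auto dest: in_set_takeD)
    show "set (take i es @ [h]) \<subseteq> edges W"
      using p h by (auto simp: sub_path_def in_sub_def in_set_conv_nth dest!: in_set_takeD)
    fix j assume j: "j < length (take i es @ [h])"
    show "{endp W White ((take i es @ [h]) ! j), endp W Black ((take i es @ [h]) ! j)} =
       {take (Suc i) us ! j, take (Suc i) us ! (Suc j mod length (take i es @ [h]))}"
    proof (cases "j = i")
      case True
      then show ?thesis using i eh l unfolding ends_def by (auto simp: nth_append)
    next
      case False
      then have "j < i" using i j by simp
      then show ?thesis using p i l by (auto simp: nth_append sub_path_def ends_def)
    qed
  qed (use l in auto)
  moreover have "set (take (Suc i) us) \<subseteq> Inn ` internal W"
    using p K unfolding sub_path_def by (meson image_mono order_trans set_take_subset)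
  ultimately show ?thesis using cycle_unique by fastforce
qed

text \<open>At a head that is no end of \<open>e\<^sub>0\<close> the degree condition supplies an
  edge other than the first one of the path. By maximality its other end lies on the path, so it
  closes a cycle without \<open>e\<^sub>0\<close>, against uniqueness.\<close>

lemma sub_path_head:
  assumes p: "sub_path K us es" and K: "K \<subseteq> internal W" and ne: "es \<noteq> []"
    and deg: "\<And>v. v \<in> K \<Longrightarrow> \<exists>h h'. h \<noteq> h' \<and> in_sub K h \<and> in_sub K h' \<and> Inn v \<in> ends h \<and> Inn v \<in> ends h'"
    and max: "\<And>u g. \<not> sub_path K (u # us) (g # es)"
  shows "us ! 0 \<in> ends e\<^sub>0"
proof (rule ccontr)
  assume nin: "us ! 0 \<notin> ends e\<^sub>0"
  have l: "length us = Suc (length es)" "distinct us" "set us \<subseteq> Inn ` K" using p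
    by (auto simp: sub_path_def)
  then have "us ! 0 \<in> Inn ` K" by (metis nth_mem subsetD zero_less_Suc)
  then obtain h h' where "h \<noteq> h'" "in_sub K h" "in_sub K h'" "us ! 0 \<in> ends h" "us ! 0 \<in> ends h'"
    using deg by (metis imageE)
  then obtain g where g: "in_sub K g" "us ! 0 \<in> ends g" "g \<noteq> es ! 0" by metis
  have gE: "g \<in> edges W" using g by (simp add: in_sub_def)
  have ge0: "g \<noteq> e\<^sub>0" using g nin by auto
  obtain w where w: "ends g = {us ! 0, w}" "w \<noteq> us ! 0" "w \<in> Inn ` K"
    using g endp_neq[OF gE] unfolding ends_def in_sub_def by fastforce
  show False
  proof (cases "w \<in> set us")
    case False
    have "sub_path K (w # us) (g # es)"
      using p w g ge0 False unfolding sub_path_def by (auto simp: nth_Cons split: nat.splits)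
    then show False using max by blast
  next
    case True
    then obtain i where i: "i < length us" "us ! i = w" by (auto simp: in_set_conv_nth)
    have i1: "1 \<le> i" using w i by (metis One_nat_def Suc_leI gr0I)
    have "g \<notin> set es"
    proof
      assume "g \<in> set es"
      then obtain j where j: "j < length es" "es ! j = g" by (auto simp: in_set_conv_nth)
      then have "us ! 0 \<in> {us ! j, us ! Suc j}" using p g by (auto simp: sub_path_def)
      then have "j = 0" using l j by (auto simp: nth_eq_iff_index_eq)
      then show False using g j by simp
    qed
    then have "insert g (set (take i es)) = the_cycle W"
      using sub_path_close[OF p K gE _ i1] i l w by simp
    then have "e\<^sub>0 \<in> set es" using e\<^sub>0_cycle ge0 by (metis in_set_takeD insertE)
    then show False using p by (auto simp: sub_path_def in_set_conv_nth)
  qed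
qed

text \<open>
  A longest path through \<open>h\<close> that avoids \<open>e\<^sub>0\<close> can only end at the two ends of \<open>e\<^sub>0\<close>, where \<open>e\<^sub>0\<close> closes
    it to
  a cycle.
\<close>

lemma in_sub_cycle:
  assumes K: "K \<subseteq> internal W"
    and deg: "\<And>v. v \<in> K \<Longrightarrow> \<exists>h h'. h \<noteq> h' \<and> in_sub K h \<and> in_sub K h' \<and> Inn v \<in> ends h \<and> Inn v \<in> ends h'"
    and h: "in_sub K h"
  shows "h \<in> the_cycle W"
proof (rule ccontr)
  assume hC: "h \<notin> the_cycle W"
  define P where "P = (\<lambda>(us, es). sub_path K us es \<and> h \<in> set es)"
  have hE: "h \<in> edges W" using h by (simp add: in_sub_def)
  have "sub_path K [endp W White h, endp W Black h] [h]"
    using h hC e\<^sub>0_cycle endp_neq[OF hE] by (auto simp: sub_path_def in_sub_def ends_def)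
  then have P0: "P ([endp W White h, endp W Black h], [h])" by (simp add: P_def)
  have finK: "finite K" using K finite_internal finite_subset by blast
  have bound: "\<forall>y. P y \<longrightarrow> length (snd y) < Suc (card (Inn ` K :: 'v vert set))"
  proof (intro allI impI)
    fix y assume "P y"
    then have "length (fst y) = Suc (length (snd y))" "distinct (fst y)" "set (fst y) \<subseteq> Inn ` K"
      unfolding P_def sub_path_def by (simp_all add: case_prod_beta)
    moreover then have "length (fst y) \<le> card (Inn ` K :: 'v vert set)"
      using finK by (metis card_mono distinct_card finite_imageI)
    ultimately show "length (snd y) < Suc (card (Inn ` K :: 'v vert set))" by simp
  qed
  obtain us es where p: "sub_path K us es" "h \<in> set es"
    and max: "\<And>us' es'. sub_path K us' es' \<Longrightarrow> h \<in> set es' \<Longrightarrow> length es' \<le> length es"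
  proof -
    obtain y where y: "P y" "\<And>z. P z \<Longrightarrow> length (snd z) \<le> length (snd y)"
      using ex_has_greatest_nat[of P _ "\<lambda>y. length (snd y)", OF P0 bound] by blast
    obtain us es where "y = (us, es)" by (cases y)
    then show thesis using y that[of us es] unfolding P_def by auto
  qed
  have l: "length us = Suc (length es)" "distinct us" using p by (auto simp: sub_path_def)
  have ne: "es \<noteq> []" using p by auto
  have 1: "us ! 0 \<in> ends e\<^sub>0"
  proof (rule sub_path_head[OF p(1) K ne deg])
    fix u g show "\<not> sub_path K (u # us) (g # es)" using max[of "u # us" "g # es"] p by auto
  qed
  have 2: "rev us ! 0 \<in> ends e\<^sub>0"
  proof (rule sub_path_head[OF sub_path_rev[OF p(1)] K _ deg])
    fix u g show "\<not> sub_path K (u # rev us) (g # rev es)" using max[of "u # rev us" "g # rev es"] p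
      by auto
  qed (use ne in auto)
  have r: "rev us ! 0 = us ! length es" using l by (simp add: rev_nth)
  have "us ! 0 \<noteq> us ! length es" using l ne by (simp add: nth_eq_iff_index_eq)
  then have "ends e\<^sub>0 = {us ! 0, us ! length es}" using 1 2 r by (auto simp: ends_def)
  moreover have "e\<^sub>0 \<in> edges W" using e\<^sub>0_cycle cycle_enumeration by blast
  moreover have "e\<^sub>0 \<notin> set es" using p by (auto simp: sub_path_def in_set_conv_nth)
  moreover have "1 \<le> length es" using ne by (cases es) auto
  ultimately have "insert e\<^sub>0 (set (take (length es) es)) = the_cycle W"
    using sub_path_close[OF p(1) K] by blast
  then show False using hC p by auto
qed

section \<open>The surroundings of the cycle: chords, cherries and legs\<close>

lemma S_verts_internal: "S_verts W \<subseteq> internal W"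
  by (auto simp: S_verts_def)

lemma cycle_edges: "the_cycle W \<subseteq> edges W"
  by (rule cycle_enumeration) blast

lemma ends_in_rot: "v \<in> internal W \<Longrightarrow> e \<in> edges W \<Longrightarrow> Inn v \<in> ends e \<longleftrightarrow> e \<in> set (rot W (Inn v))"
proof -
  assume v: "v \<in> internal W" "e \<in> edges W"
  have "Inn v \<in> ends e \<longleftrightarrow> (\<exists>c. endp W c e = Inn v)"
    unfolding ends_def by (metis colour.exhaust insert_iff singletonD)
  then show ?thesis using v rot_internal(3)[OF v(1)] in_rot[of e _ v] by blast
qed

lemma cycle_in_sub:
  assumes "e \<in> the_cycle W"
  shows "in_sub (S_verts W) e"
proof -
  obtain n vs es where enum: "the_cycle W = es ` {..<n}" "S_verts W = vs ` {..<n}"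
    "\<And>i. i < n \<Longrightarrow> {endp W White (es i), endp W Black (es i)} = {Inn (vs i), Inn (vs (Suc i mod n))}"
    using cycle_enumeration by metis
  obtain i where i: "i < n" "e = es i" using assms enum by auto
  have "endp W c e \<in> {endp W White e, endp W Black e}" for c by (cases c) auto
  then have "endp W c e \<in> {Inn (vs i), Inn (vs (Suc i mod n))}" for c using enum(3)[of i] i by simp
  moreover have "Suc i mod n < n" using i by simp
  ultimately show ?thesis using assms i cycle_edges unfolding in_sub_def enum(2) by blast
qed

lemma cycle_edges_at:
  assumes "v \<in> S_verts W"
  obtains e f where "e \<noteq> f" "{x \<in> the_cycle W. Inn v \<in> ends x} = {e, f}"
proof -
  obtain n vs es where enum: "6 \<le> n" "inj_on vs {..<n}" "inj_on es {..<n}"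
    "the_cycle W = es ` {..<n}" "S_verts W = vs ` {..<n}"
    "\<And>i. i < n \<Longrightarrow> {endp W White (es i), endp W Black (es i)} = {Inn (vs i), Inn (vs (Suc i mod n))}"
    using cycle_enumeration by metis
  obtain i where i: "i < n" "v = vs i" using assms enum by auto
  define j where "j = (if i = 0 then n - 1 else i - 1)"
  have j: "j < n" "j \<noteq> i" "Suc j mod n = i" using i enum(1) by (auto simp: j_def)
  have "es i \<noteq> es j" using enum(3) i j by (auto dest: inj_onD)
  moreover have "{x \<in> the_cycle W. Inn v \<in> ends x} = {es i, es j}"
  proof (intro set_eqI iffI)
    fix x assume "x \<in> {x \<in> the_cycle W. Inn v \<in> ends x}"
    then obtain k where k: "k < n" "x = es k" "Inn v \<in> ends (es k)" using enum(4) by auto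
    then have "vs i = vs k \<or> vs i = vs (Suc k mod n)" using enum(6)[of k] i unfolding ends_def by auto
    then have "i = k \<or> i = Suc k mod n" using enum(2) i k by (auto dest: inj_onD)
    then have "k = i \<or> k = j" using i k unfolding j_def by (auto simp: mod_Suc split: if_splits)
    then show "x \<in> {es i, es j}" using k by auto
  next
    fix x assume "x \<in> {es i, es j}"
    then show "x \<in> {x \<in> the_cycle W. Inn v \<in> ends x}"
      using enum(6)[of i] enum(6)[of j] i j enum(4) unfolding ends_def by auto
  qed
  ultimately show thesis using that by blast
qed

text \<open>The cycle itself gives each of its vertices two edges within \<open>S_verts W\<close>,
  which is the degree condition of \<open>in_sub_cycle\<close> for this set.\<close>

lemma chord_in_cycle: "in_sub (S_verts W) e \<Longrightarrow> e \<in> the_cycle W"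
proof (rule in_sub_cycle[OF S_verts_internal])
  fix v assume "v \<in> S_verts W"
  then obtain e f where "e \<noteq> f" "{x \<in> the_cycle W. Inn v \<in> ends x} = {e, f}" by (rule cycle_edges_at)
  then show "\<exists>h h'. h \<noteq> h' \<and> in_sub (S_verts W) h \<and> in_sub (S_verts W) h' \<and> Inn v \<in> ends h \<and>
    Inn v \<in> ends h'"
    using cycle_in_sub by blast
qed

lemma in_sub_mono: "in_sub K e \<Longrightarrow> K \<subseteq> K' \<Longrightarrow> in_sub K' e"
  unfolding in_sub_def by blast

text \<open>The forest property in the form needed for pruning: at \<open>v\<close> only the edge
  number \<open>d\<close> may lead to a remaining vertex. Without such a \<open>v\<close> every
  vertex of \<open>U \<union> S_verts W\<close> would have two edges within this set, those of the
  cycle by the cycle itself, and \<open>in_sub_cycle\<close> would place a vertex of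
  \<open>U\<close> on the cycle.\<close>

lemma cherry_exists:
  assumes U: "U \<subseteq> internal W - S_verts W" "U \<noteq> {}"
  shows "\<exists>v\<in>U. \<exists>d<3. \<forall>j<3. j \<noteq> d \<longrightarrow> endp W (opp (icol W v)) (rot W (Inn v) ! j) \<notin> Inn ` (U \<union> S_verts W)"
proof (rule ccontr)
  assume neg: "\<not> ?thesis"
  let ?K = "U \<union> S_verts W"
  have K: "?K \<subseteq> internal W" using U S_verts_internal by auto
  have two: "\<exists>h h'. h \<noteq> h' \<and> in_sub ?K h \<and> in_sub ?K h' \<and> Inn v \<in> ends h \<and> Inn v \<in> ends h'"
    if v: "v \<in> U" for v
  proof -
    have vi: "v \<in> internal W" using v U by auto
    let ?r = "rot W (Inn v)"
    have ex: "\<exists>j<3. j \<noteq> d \<and> endp W (opp (icol W v)) (?r ! j) \<in> Inn ` ?K" if "d < 3" for d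
      using neg v that by blast
    \<comment> \<open>Excluding number 0 yields one edge inside \<open>?K\<close>; excluding that
      one yields a second.\<close>
    obtain j where j: "j < 3" "endp W (opp (icol W v)) (?r ! j) \<in> Inn ` ?K" using ex[of 0] by auto
    obtain k where k: "k < 3" "k \<noteq> j" "endp W (opp (icol W v)) (?r ! k) \<in> Inn ` ?K" using ex[of j] j
      by auto
    have *: "in_sub ?K (?r ! i) \<and> Inn v \<in> ends (?r ! i)"
      if i: "i < 3" "endp W (opp (icol W v)) (?r ! i) \<in> Inn ` ?K" for i
    proof -
      have "?r ! i \<in> set ?r" using i rot_internal(2)[OF vi] by simp
      then have e: "?r ! i \<in> edges W" "endp W (icol W v) (?r ! i) = Inn v" using rot_internal(3)[OF vi]
        by auto
      have "endp W c (?r ! i) \<in> Inn ` ?K" for c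
        using e i(2) v by (cases c; cases "icol W v") auto
      then show ?thesis using e by (cases "icol W v") (auto simp: in_sub_def ends_def)
    qed
    have "?r ! j \<noteq> ?r ! k" using rot_internal[OF vi] j k by (simp add: nth_eq_iff_index_eq)
    then show ?thesis using *[of j] *[of k] j k by blast
  qed
  have all: "\<exists>h h'. h \<noteq> h' \<and> in_sub ?K h \<and> in_sub ?K h' \<and> Inn v \<in> ends h \<and> Inn v \<in> ends h'" if "v \<in> ?K"
    for v
  proof (cases "v \<in> U")
    case True then show ?thesis by (rule two)
  next
    case False
    then have "v \<in> S_verts W" using that by simp
    then obtain e f where "e \<noteq> f" "{x \<in> the_cycle W. Inn v \<in> ends x} = {e, f}" by (rule cycle_edges_at)
    moreover then have "in_sub ?K e" "in_sub ?K f"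
      using in_sub_mono[OF cycle_in_sub Un_upper2] by blast+
    ultimately show ?thesis by blast
  qed
  obtain v where v: "v \<in> U" using U by auto
  obtain h where h: "in_sub ?K h" "Inn v \<in> ends h" using two[OF v] by blast
  have "h \<in> the_cycle W" using in_sub_cycle[OF K all h(1)] by blast
  then have "Inn v \<in> Inn ` S_verts W" using cycle_in_sub[of h] h(2) unfolding in_sub_def ends_def
    by auto
  then show False using v U by auto
qed

lemma leg:
  assumes v: "v \<in> S_verts W"
  shows "leg W v \<in> set (rot W (Inn v))" "leg W v \<notin> the_cycle W"
    and leg_unique: "\<And>e. e \<in> set (rot W (Inn v)) \<Longrightarrow> e \<notin> the_cycle W \<Longrightarrow> e = leg W v"
proof -
  have vi: "v \<in> internal W" using v S_verts_internal by auto
  obtain e f where ef: "e \<noteq> f" "{x \<in> the_cycle W. Inn v \<in> ends x} = {e, f}" using v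
    by (rule cycle_edges_at)
  have C: "set (rot W (Inn v)) \<inter> the_cycle W = {e, f}"
    unfolding ef(2)[symmetric] using ends_in_rot[OF vi] cycle_edges by blast
  have "card (set (rot W (Inn v))) = 3" using rot_internal(1,2)[OF vi] distinct_card by metis
  then have "card (set (rot W (Inn v)) - {e, f}) = 1"
    using C ef(1) by (subst card_Diff_subset) auto
  moreover have "set (rot W (Inn v)) - {e, f} = set (rot W (Inn v)) - the_cycle W" using C by blast
  ultimately obtain g where g: "set (rot W (Inn v)) - the_cycle W = {g}" by (auto simp: card_Suc_eq)
  then have "leg W v = g" unfolding leg_def by blast
  then show "leg W v \<in> set (rot W (Inn v))" "leg W v \<notin> the_cycle W"
    "\<And>e. e \<in> set (rot W (Inn v)) \<Longrightarrow> e \<notin> the_cycle W \<Longrightarrow> e = leg W v"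
    using g by blast+
qed

lemma leg_edge: "v \<in> S_verts W \<Longrightarrow> leg W v \<in> edges W \<and> endp W (icol W v) (leg W v) = Inn v"
  using leg(1) rot_internal(3) S_verts_internal by blast

lemma leg_outer:
  assumes "v \<in> S_verts W" shows "endp W (opp (icol W v)) (leg W v) \<notin> Inn ` S_verts W"
proof
  assume *: "endp W (opp (icol W v)) (leg W v) \<in> Inn ` S_verts W"
  have "endp W c (leg W v) \<in> Inn ` S_verts W" for c
    using * leg_edge[OF assms] assms by (cases c; cases "icol W v") auto
  then have "in_sub (S_verts W) (leg W v)" using leg_edge[OF assms] by (simp add: in_sub_def)
  then show False using chord_in_cycle leg(2)[OF assms] by blast
qed

text \<open>A leg shared by two cycle vertices would have its outer end on the cycle.\<close>

lemma leg_inj: "inj_on (leg W) (S_verts W)"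
proof (rule inj_onI)
  fix v v' assume v: "v \<in> S_verts W" "v' \<in> S_verts W" "leg W v = leg W v'"
  have "icol W v' \<noteq> opp (icol W v)"
    using leg_outer[OF v(1)] leg_edge[OF v(2)] v by (metis imageI)
  then have "icol W v = icol W v'" by (cases "icol W v"; cases "icol W v'") auto
  then show "v = v'" using leg_edge[OF v(1)] leg_edge[OF v(2)] v(3) by (metis vert.inject(2))
qed

lemma S_edges_eq: "S_edges W = the_cycle W \<union> leg W ` S_verts W"
proof (intro set_eqI iffI)
  fix e assume "e \<in> S_edges W"
  then obtain c v where "e \<in> edges W" "v \<in> S_verts W" "endp W c e = Inn v" by (auto simp: S_edges_def)
  then show "e \<in> the_cycle W \<union> leg W ` S_verts W" using leg_unique[of v e] in_rot[of e c v] by blast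
next
  fix e assume "e \<in> the_cycle W \<union> leg W ` S_verts W"
  then show "e \<in> S_edges W"
    using cycle_in_sub leg_edge unfolding S_edges_def in_sub_def by blast
qed

subsection \<open>Cutting the cycle open\<close>

text \<open>
  In a partially evaluated web, \<open>U\<close> is the set of remaining vertices off the cycle, \<open>F\<close> the set
    of remaining
  edges and \<open>w c e\<close> the vector placed at the end of \<open>e\<close> of colour \<open>c\<close>; it is constantly 1 at ends that
    still
  are vertices. The rows of \<open>cut_matrix\<close> belong to the white half of \<open>e\<^sub>0\<close>, the columns to the black
    half.
\<close>

definition cut_label :: "('e \<Rightarrow> 3) \<Rightarrow> 3 \<Rightarrow> 3 \<Rightarrow> 'v \<Rightarrow> 'e \<Rightarrow> 3" where
  "cut_label l p q v e = (if e = e\<^sub>0 then (if icol W v = Black then q else p) else l e)"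

definition cut_matrix :: "'v set \<Rightarrow> 'e set \<Rightarrow> (colour \<Rightarrow> 'e \<Rightarrow> 3 \<Rightarrow> complex) \<Rightarrow> complex^3^3" where
  "cut_matrix U F w = (\<chi> p q. \<Sum>l \<in> (F - {e\<^sub>0}) \<rightarrow>\<^sub>E UNIV.
     (\<Prod>v\<in>U \<union> S_verts W. eps (map (cut_label l p q v) (rot W (Inn v)))) *
     (\<Prod>e\<in>F - {e\<^sub>0}. w White e (l e) * w Black e (l e)))"

definition bweight :: "config \<Rightarrow> colour \<Rightarrow> 'e \<Rightarrow> 3 \<Rightarrow> complex" where
  "bweight x c e s = bcoord x (endp W c e) s"

abbreviation full_matrix :: "config \<Rightarrow> complex^3^3" where
  "full_matrix x \<equiv> cut_matrix (internal W - S_verts W) (edges W) (bweight x)"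

lemma e\<^sub>0_edge: "e\<^sub>0 \<in> edges W"
  using e\<^sub>0_cycle cycle_edges by blast

lemma bweight_cycle: "e \<in> the_cycle W \<Longrightarrow> bweight x c e s = 1"
  using cycle_in_sub[of e] unfolding in_sub_def bweight_def by (metis bcoord.simps(3) imageE)

lemma internal_split: "internal W - S_verts W \<union> S_verts W = internal W"
  using S_verts_internal by auto

text \<open>Gluing the halves of \<open>e\<^sub>0\<close> identifies the row label with the column
  label. Both ends of \<open>e\<^sub>0\<close> are internal, so no coordinate of an argument is lost
  with it.\<close>

lemma invariant_trace: "invariant W x = trace (full_matrix x)"
proof -
  have E: "edges W = insert e\<^sub>0 (edges W - {e\<^sub>0})" using e\<^sub>0_edge by auto
  have fin: "finite (edges W - {e\<^sub>0})" using finite_edges by simp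
  define g where "g p l = (\<Prod>v\<in>internal W. eps (map (cut_label l p p v) (rot W (Inn v)))) *
        (\<Prod>e\<in>edges W - {e\<^sub>0}. bweight x White e (l e) * bweight x Black e (l e))" for p l
  have "invariant W x = (\<Sum>l \<in> (edges W - {e\<^sub>0}) \<rightarrow>\<^sub>E UNIV. \<Sum>p\<in>UNIV. g p l)"
    unfolding invariant_def
  proof (subst E, subst sum_PiE_insert, simp, intro sum.cong refl)
    fix l :: "'e \<Rightarrow> 3" and p
    have "(\<Prod>e\<in>edges W. bcoord x (endp W White e) ((l(e\<^sub>0 := p)) e) *
      bcoord x (endp W Black e) ((l(e\<^sub>0 := p)) e)) =
      (\<Prod>e\<in>edges W. bweight x White e ((l(e\<^sub>0 := p)) e) * bweight x Black e ((l(e\<^sub>0 := p)) e))"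
      by (simp add: bweight_def)
    also have "\<dots> = (\<Prod>e\<in>edges W - {e\<^sub>0}. bweight x White e (l e) * bweight x Black e (l e))"
      by (subst E, subst prod.insert[OF fin]) (auto simp: bweight_cycle[OF e\<^sub>0_cycle] intro!: prod.cong)
    finally have 1: "(\<Prod>e\<in>edges W. bcoord x (endp W White e) ((l(e\<^sub>0 := p)) e) *
      bcoord x (endp W Black e) ((l(e\<^sub>0 := p)) e)) = \<dots>" .
    have 2: "cut_label l p p v = l(e\<^sub>0 := p)" for v by (auto simp: cut_label_def)
    show "(\<Prod>v\<in>internal W. eps (map (l(e\<^sub>0 := p)) (rot W (Inn v)))) *
       (\<Prod>e\<in>edges W. bcoord x (endp W White e) ((l(e\<^sub>0 := p)) e) * bcoord x (endp W Black e)
         ((l(e\<^sub>0 := p)) e)) = g p l"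
      unfolding 1 g_def 2 ..
  qed
  also have "\<dots> = (\<Sum>p\<in>UNIV. \<Sum>l \<in> (edges W - {e\<^sub>0}) \<rightarrow>\<^sub>E UNIV. g p l)" by (rule sum.swap)
  also have "\<dots> = trace (full_matrix x)"
    by (simp only: trace_def cut_matrix_def internal_split g_def vec_lambda_beta)
  finally show ?thesis .
qed

text \<open>Copy \<open>i\<close> of the web meets copy \<open>i\<close> of \<open>e\<^sub>0\<close>
  at the white end but copy \<open>i - 1\<close> at the black end. With the labels \<open>t\<close>
  of these edges fixed the copies decouple, and copy \<open>i\<close> contributes the entry of
  \<open>N\<close> at \<open>t i\<close>, \<open>t (i - 1)\<close>. The indices run backwards,
  whence the transpose.\<close>

lemma invariant_brac:
  "invariant (brac (Suc m) W e\<^sub>0) x = trace (matpow (transpose (full_matrix x)) (Suc m))"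
proof -
  define k where "k = Suc m"
  define N where "N = full_matrix x"
  define R where "R = edges W - {e\<^sub>0}"
  \<comment> \<open>The cyclic predecessor; adding \<open>k\<close> first avoids truncated
    subtraction at 0.\<close>
  define pr where "pr i = (i + k - 1) mod k" for i
  define h where "h p q i l =
    (\<Prod>v\<in>internal W. eps (map (\<lambda>e.
    if e = e\<^sub>0 then (if icol W v = Black then q else p) else l (e, i)) (rot W (Inn v)))) *
     (\<Prod>e\<in>R. bweight x White e (l (e, i)) * bweight x Black e (l (e, i)))" for p q and i :: nat and l ::
       "'e \<times> nat \<Rightarrow> 3"
  have finR: "finite R" using finite_edges by (simp add: R_def)
  have E: "edges W \<times> {..<k} = {e\<^sub>0} \<times> {..<k} \<union> R \<times> {..<k}" using e\<^sub>0_edge by (auto simp: R_def)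
  have bw: "bcoord x (brac_endp k W e\<^sub>0 c p) s = bweight x c (fst p) s" for c p s
  proof (cases "endp W c (fst p)")
    case (Bd c' n)
    then show ?thesis by (cases c') (simp_all add: brac_endp_def bweight_def)
  next
    case (Inn v)
    then show ?thesis by (simp add: brac_endp_def bweight_def)
  qed
  have step1: "invariant (brac k W e\<^sub>0) x =
     (\<Sum>t \<in> {e\<^sub>0} \<times> {..<k} \<rightarrow>\<^sub>E UNIV. \<Sum>l \<in> R \<times> {..<k} \<rightarrow>\<^sub>E UNIV. \<Prod>i<k. h (t (e\<^sub>0, i)) (t (e\<^sub>0, pr i)) i l)"
    unfolding invariant_def brac_def tdiag.simps E
  proof (rule sum_PiE_union)
    show "{e\<^sub>0} \<times> {..<k} \<inter> R \<times> {..<k} = {}" by (auto simp: R_def)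
    fix l t l' :: "'e \<times> nat \<Rightarrow> 3"
    assume t: "\<And>a. a \<in> {e\<^sub>0} \<times> {..<k} \<Longrightarrow> l a = t a" and l': "\<And>b. b \<in> R \<times> {..<k} \<Longrightarrow> l b = l' b"
    have e1: "eps (map l (brac_rot k W e\<^sub>0 (Inn (v, i)))) =
      eps (map (\<lambda>e. if e = e\<^sub>0 then (if icol W v = Black then t (e\<^sub>0, pr i) else t (e\<^sub>0, i))
        else l' (e, i)) (rot W (Inn v)))"
      if "v \<in> internal W" "i < k" for v i
    proof -
      have "e \<in> edges W" if "e \<in> set (rot W (Inn v))" for e
        using rot_internal(3)[OF \<open>v \<in> internal W\<close>] that by auto
      moreover have "pr i < k" by (simp add: pr_def k_def)
      ultimately show ?thesis using \<open>i < k\<close>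
        by (intro arg_cong[where f = eps]) (auto simp: t l' R_def pr_def)
    qed
    have "(\<Prod>v\<in>internal W \<times> {..<k}. eps (map l (brac_rot k W e\<^sub>0 (Inn v)))) =
       (\<Prod>i<k. \<Prod>v\<in>internal W. eps (map l (brac_rot k W e\<^sub>0 (Inn (v, i)))))"
      by (subst prod.swap) (simp add: prod.cartesian_product case_prod_unfold del: brac_rot.simps)
    also have "\<dots> = (\<Prod>i<k. \<Prod>v\<in>internal W.
      eps (map (\<lambda>e. if e = e\<^sub>0 then (if icol W v = Black then t (e\<^sub>0, pr i) else t (e\<^sub>0, i))
      else l' (e, i)) (rot W (Inn v))))"
      by (intro prod.cong refl e1) auto
    finally have A: "(\<Prod>v\<in>internal W \<times> {..<k}. eps (map l (brac_rot k W e\<^sub>0 (Inn v)))) = \<dots>" .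
    have "(\<Prod>e\<in>edges W \<times> {..<k}. bcoord x (brac_endp k W e\<^sub>0 White e) (l e) *
      bcoord x (brac_endp k W e\<^sub>0 Black e) (l e)) =
      (\<Prod>e\<in>R \<times> {..<k}. bweight x White (fst e) (l' e) * bweight x Black (fst e) (l' e))"
      unfolding bw
      by (rule prod.mono_neutral_cong_right)
         (use finite_edges l' in \<open>auto simp: R_def bweight_cycle[OF e\<^sub>0_cycle]\<close>)
    also have "\<dots> = (\<Prod>i<k. \<Prod>e\<in>R. bweight x White e (l' (e, i)) * bweight x Black e (l' (e, i)))"
      by (subst prod.swap) (simp add: prod.cartesian_product case_prod_unfold)
    finally have B: "(\<Prod>e\<in>edges W \<times> {..<k}. bcoord x (brac_endp k W e\<^sub>0 White e) (l e) *
      bcoord x (brac_endp k W e\<^sub>0 Black e) (l e)) = \<dots>" .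
    show "(\<Prod>v\<in>internal W \<times> {..<k}. eps (map l (brac_rot k W e\<^sub>0 (Inn v)))) *
      (\<Prod>e\<in>{e\<^sub>0} \<times> {..<k} \<union> R \<times> {..<k}. bcoord x (brac_endp k W e\<^sub>0 White e) (l e) * bcoord x
        (brac_endp k W e\<^sub>0 Black e) (l e)) =
      (\<Prod>i<k. h (t (e\<^sub>0, i)) (t (e\<^sub>0, pr i)) i l')"
      unfolding A E[symmetric] B unfolding h_def prod.distrib ..
  qed
  have step2: "(\<Sum>l \<in> R \<times> {..<k} \<rightarrow>\<^sub>E UNIV. \<Prod>i<k. h (p i) (q i) i l) = (\<Prod>i<k. N $ p i $ q i)" for p q
  proof -
    have "(\<Sum>l \<in> R \<times> {..<k} \<rightarrow>\<^sub>E UNIV. \<Prod>i<k. h (p i) (q i) i l) =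
      (\<Prod>i<k. \<Sum>l \<in> {e \<in> R \<times> {..<k}. snd e = i} \<rightarrow>\<^sub>E UNIV. h (p i) (q i) i l)"
    proof (rule sum_PiE_blocks)
      fix i and l :: "'e \<times> nat \<Rightarrow> 3" assume i: "i \<in> {..<k}"
      have r: "restrict l {e \<in> R \<times> {..<k}. snd e = i} (e, i) = l (e, i)" if "e \<in> R" for e
        using i that by auto
      have "eps (map (\<lambda>e. if e =
        e\<^sub>0 then (if icol W v = Black then q i else p i)
        else restrict l {e \<in> R \<times> {..<k}. snd e = i} (e, i)) (rot W (Inn v))) =
        eps (map (\<lambda>e. if e = e\<^sub>0 then (if icol W v = Black then q i else p i)
          else l (e, i)) (rot W (Inn v)))" if "v \<in> internal W" for v
        using rot_internal(3)[OF that] i by (intro arg_cong[where f = eps]) (auto simp: R_def)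
      then show "h (p i) (q i) i (restrict l {e \<in> R \<times> {..<k}. snd e = i}) = h (p i) (q i) i l"
        unfolding h_def by (intro arg_cong2[where f = "(*)"] prod.cong refl) (simp_all only: r)
    qed (use finR in auto)
    also have "(\<Sum>l \<in> {e \<in> R \<times> {..<k}. snd e = i} \<rightarrow>\<^sub>E UNIV. h (p i) (q i) i l) = N $ p i $ q i"
      if "i < k" for i
      unfolding N_def cut_matrix_def vec_lambda_beta internal_split R_def[symmetric]
    proof (rule sum_PiE_transfer[symmetric, of "\<lambda>e. (e, i)"])
      show "bij_betw (\<lambda>e. (e, i)) R {e \<in> R \<times> {..<k}. snd e = i}" using that
        by (auto simp: bij_betw_def inj_on_def)
      fix m :: "'e \<Rightarrow> 3" and l :: "'e \<times> nat \<Rightarrow> 3" assume m: "\<And>e. e \<in> R \<Longrightarrow> m e = l (e, i)"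
      have "map (cut_label m (p i) (q i) v) (rot W (Inn v)) =
         map (\<lambda>e. if e = e\<^sub>0 then (if icol W v = Black then q i else p i)
           else l (e, i)) (rot W (Inn v))" if "v \<in> internal W" for v
        using rot_internal(3)[OF that] by (auto simp: cut_label_def m R_def)
      then show "(\<Prod>v\<in>internal W. eps (map (cut_label m (p i) (q i) v) (rot W (Inn v)))) *
        (\<Prod>e\<in>R. bweight x White e (m e) * bweight x Black e (m e)) = h (p i) (q i) i l"
        unfolding h_def by (intro arg_cong2[where f = "(*)"] prod.cong refl) (simp_all only: m)
    qed
    then have "(\<Prod>i<k. \<Sum>l \<in> {e \<in> R \<times> {..<k}. snd e = i} \<rightarrow>\<^sub>E UNIV. h (p i) (q i) i l) =
      (\<Prod>i<k. N $ p i $ q i)"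
      by (intro prod.cong refl) auto
    finally show ?thesis .
  qed
  have "invariant (brac k W e\<^sub>0) x =
    (\<Sum>t \<in> {e\<^sub>0} \<times> {..<k} \<rightarrow>\<^sub>E UNIV. \<Prod>i<k. N $ t (e\<^sub>0, i) $ t (e\<^sub>0, pr i))"
    unfolding step1 step2 ..
  also have "\<dots> = (\<Sum>t \<in> {..<k} \<rightarrow>\<^sub>E UNIV. \<Prod>i<k. N $ t i $ t (pr i))"
  proof (rule sum_PiE_transfer[symmetric, of "\<lambda>i. (e\<^sub>0, i)"])
    show "bij_betw (\<lambda>i. (e\<^sub>0, i)) {..<k} ({e\<^sub>0} \<times> {..<k})" by (auto simp: bij_betw_def inj_on_def)
    fix m :: "nat \<Rightarrow> 3" and l :: "'e \<times> nat \<Rightarrow> 3" assume m: "\<And>i. i \<in> {..<k} \<Longrightarrow> m i = l (e\<^sub>0, i)"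
    have "pr i < k" for i by (simp add: pr_def k_def)
    then show "(\<Prod>i<k. N $ m i $ m (pr i)) = (\<Prod>i<k. N $ l (e\<^sub>0, i) $ l (e\<^sub>0, pr i))"
      by (intro prod.cong refl) (simp add: m)
  qed
  \<comment> \<open>The label \<open>t m\<close>, shared by the copies 0 and \<open>m\<close>,
    becomes the index of the trace.\<close>
  also have "\<dots> = (\<Sum>t \<in> {..<m} \<rightarrow>\<^sub>E UNIV. \<Sum>c\<in>UNIV.
      \<Prod>i\<le>m. transpose N $ (if i = 0 then c else t (i - 1)) $ (if i = m then c else t i))"
    unfolding k_def lessThan_Suc
  proof (subst sum_PiE_insert, simp, intro sum.cong refl)
    fix t :: "nat \<Rightarrow> 3" and c
    have pr0: "pr 0 = m" and prS: "i \<le> m \<Longrightarrow> i \<noteq> 0 \<Longrightarrow> pr i = i - 1" for i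
      by (auto simp: pr_def k_def mod_if)
    have "insert m {..<m} = {..m}" by auto
    then show "(\<Prod>i\<in>insert m {..<m}. N $ (t(m := c)) i $ (t(m := c)) (pr i)) =
      (\<Prod>i\<le>m. transpose N $ (if i = 0 then c else t (i - 1)) $ (if i = m then c else t i))"
      by (intro prod.cong) (auto simp: transpose_def pr0 prS)
  qed
  also have "\<dots> = (\<Sum>c\<in>UNIV. mprod (\<lambda>_. transpose N) m $ c $ c)"
    by (subst sum.swap) (simp add: mprod_sum)
  also have "\<dots> = trace (matpow (transpose N) (Suc m))"
    by (simp add: trace_def mprod_const)
  finally show ?thesis unfolding k_def N_def .
qed

subsection \<open>Evaluating the trees\<close>

text \<open>
  The edge of \<open>B(W)\<close> that carries the \<open>i\<close>-th copy of an edge \<open>e\<close> off the cycle is \<open>slot e i\<close>: the two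
    copies
  of a leg are carried by the joining edges along its two neighbours on the cycle.
\<close>

definition joint :: "'e \<Rightarrow> nat \<Rightarrow> 'e" where
  "joint g i = (THE e. e \<in> the_cycle W \<and> (\<exists>c. strand W c e = Par g i))"

definition slot :: "'e \<Rightarrow> nat \<Rightarrow> ('v, 'e) bedge" where
  "slot e i = (if e \<in> S_edges W then Join (joint e i) else Old (Par e i))"

definition slots :: "'e set \<Rightarrow> ('v, 'e) bedge set" where
  "slots F = Join ` the_cycle W \<union> {Old (Par e i) | e i. e \<in> F - S_edges W \<and> i < 2}"

text \<open>The analogue of \<open>cut_matrix\<close> for \<open>B(W)\<close>, with the inner edges of the honeycombs summed out.\<close>

definition double_sum :: "'v set \<Rightarrow> 'e set \<Rightarrow> (colour \<Rightarrow> 'e \<Rightarrow> 3 \<Rightarrow> complex) \<Rightarrow> complex" where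
  "double_sum U F w = (\<Sum>l \<in> slots F \<rightarrow>\<^sub>E UNIV.
     (\<Prod>v\<in>U. honeycomb_tensor (\<lambda>d t. l (slot (rot W (Inn v) ! d) (copy_at 2 (icol W v) t)))) *
     (\<Prod>e\<in>F - the_cycle W. \<Prod>i<2. w White e (l (slot e i)) * w Black e (l (slot e i))))"

lemma slot_neq: "e \<noteq> f \<Longrightarrow> slot e i \<noteq> Old (Par f j)"
  by (simp add: slot_def)

text \<open>The edges \<open>f\<close> and \<open>g\<close> touch no remaining vertex other than
  \<open>v\<close>, so their labels can be summed at \<open>v\<close>. What results is the cross
  product \<open>X\<close> of the vectors on them, to be placed at the end of \<open>r\<close> that
  was at \<open>v\<close>. The single sum evaluates \<open>X\<close> at the label of
  \<open>r\<close>, the doubled sum at the labels of both copies of \<open>r\<close>; hence one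
  change of weights serves both.\<close>

lemma cherry_step:
  fixes w :: "colour \<Rightarrow> 'e \<Rightarrow> 3 \<Rightarrow> complex"
  assumes U: "U \<subseteq> internal W - S_verts W" and F: "F \<subseteq> edges W"
    "\<forall>v\<in>U \<union> S_verts W. set (rot W (Inn v)) \<subseteq> F"
    and v: "v \<in> U" and d: "d < 3"
    and free: "\<forall>j<3. j \<noteq> d \<longrightarrow> endp W (opp (icol W v)) (rot W (Inn v) ! j) \<notin> Inn ` (U \<union> S_verts W)"
  defines "r \<equiv> rot W (Inn v) ! d" and "f \<equiv> rot W (Inn v) ! (Suc d mod 3)" and
    "g \<equiv> rot W (Inn v) ! ((d + 2) mod 3)"
    and "c \<equiv> icol W v"
  defines "X \<equiv> \<lambda>s. \<Sum>a\<in>UNIV. \<Sum>b\<in>UNIV.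
    eps (map (\<lambda>j. if j = d then s else if j = Suc d mod 3 then a else b) [0, 1, 2]) *
     ((w White f a * w Black f a) * (w White g b * w Black g b))"
  defines "w' \<equiv> w(c := (w c)(r := \<lambda>s. w c r s * X s))"
  shows "cut_matrix U F w = cut_matrix (U - {v}) (F - {f, g}) w'"
    and "double_sum U F w = double_sum (U - {v}) (F - {f, g}) w'"
    and "\<forall>v'\<in>U - {v} \<union> S_verts W. set (rot W (Inn v')) \<subseteq> F - {f, g}"
proof -
  have vi: "v \<in> internal W" and vS: "v \<notin> S_verts W" using U v by auto
  note rv = rot_internal[OF vi]
  define h where "h j = rot W (Inn v) ! j" for j
  have hset: "h j \<in> set (rot W (Inn v))" if "j < 3" for j using that rv(2) by (simp add: h_def)
  have hE: "h j \<in> edges W" "endp W c (h j) = Inn v" if "j < 3" for j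
    using hset[OF that] rv(3) by (auto simp: c_def)
  have hF: "h j \<in> F" if "j < 3" for j using F(2)[rule_format, of v] v hset[OF that] by auto
  have hC: "h j \<notin> the_cycle W" if "j < 3" for j
    using cycle_in_sub[of "h j"] hE[OF that] vS unfolding in_sub_def by (metis imageE vert.inject(2))
  have hinj: "h i = h j \<longleftrightarrow> i = j" if "i < 3" "j < 3" for i j
    using that rv(1,2) by (simp add: h_def nth_eq_iff_index_eq)
  have js: "Suc d mod 3 < 3" "(d + 2) mod 3 < 3" "Suc d mod 3 \<noteq> d" "(d + 2) mod 3 \<noteq> d"
    "Suc d mod 3 \<noteq> (d + 2) mod 3"
    "\<And>j. j < 3 \<Longrightarrow> j \<noteq> d \<Longrightarrow> j \<noteq> Suc d mod 3 \<Longrightarrow> j = (d + 2) mod 3"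
    using d by presburger+
  have hd: "h d = r" "h (Suc d mod 3) = f" "h ((d + 2) mod 3) = g"
    by (simp_all add: h_def r_def f_def g_def)
  have dist: "r \<noteq> f" "r \<noteq> g" "f \<noteq> g" using hinj js d by (auto simp flip: hd)
  have fgF: "r \<in> F" "f \<in> F" "g \<in> F" using hF[of d] hF[OF js(1)] hF[OF js(2)] d hd by auto
  have fgC: "r \<notin> the_cycle W" "f \<notin> the_cycle W" "g \<notin> the_cycle W"
    using hC[of d] hC[OF js(1)] hC[OF js(2)] d hd by auto
  have fge0: "r \<noteq> e\<^sub>0" "f \<noteq> e\<^sub>0" "g \<noteq> e\<^sub>0" using fgC e\<^sub>0_cycle by auto
  \<comment> \<open>The end of the opposite colour is free, so an end at a remaining vertex is the
    end at \<open>v\<close>.\<close>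
  have ends: "endp W c' (h j) = Inn v' \<Longrightarrow> v' \<in> U \<union> S_verts W \<Longrightarrow> v' = v" if "j < 3" "j \<noteq> d" for c' j v'
  proof -
    assume a: "endp W c' (h j) = Inn v'" "v' \<in> U \<union> S_verts W"
    have "c' \<noteq> opp (icol W v)" using free[rule_format, OF that] a unfolding h_def by auto
    then have "c' = c" unfolding c_def by (cases c'; cases "icol W v") auto
    then show "v' = v" using hE[OF that(1)] a by simp
  qed
  have notin: "f \<notin> set (rot W (Inn v'))" "g \<notin> set (rot W (Inn v'))" if v': "v' \<in> U - {v} \<union> S_verts W"
    for v'
  proof -
    have "v' \<in> internal W" "v' \<in> U \<union> S_verts W" "v' \<noteq> v" using v' U S_verts_internal vS by auto
    then show "f \<notin> set (rot W (Inn v'))" "g \<notin> set (rot W (Inn v'))"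
      using ends[OF js(1,3), unfolded hd] ends[OF js(2,4), unfolded hd] rot_internal(3)[of v'] by blast+
  qed
  show "\<forall>v'\<in>U - {v} \<union> S_verts W. set (rot W (Inn v')) \<subseteq> F - {f, g}"
    using F(2) notin by blast
  \<comment> \<open>Hence neither \<open>f\<close> nor \<open>g\<close> is a leg, and their copies
    are \<open>Old\<close> slots that can be summed out. The edge \<open>r\<close> may be a leg, and
    then its slots are joining edges.\<close>
  have nS: "f \<notin> S_edges W" "g \<notin> S_edges W"
    using ends[OF js(1,3), unfolded hd] ends[OF js(2,4), unfolded hd] vS unfolding S_edges_def by blast+
  have finF: "finite F" using F(1) finite_edges finite_subset by blast
  have finU: "finite U" using U finite_internal finite_subset by blast
  have finS: "finite (S_verts W)" using S_verts_internal finite_internal finite_subset by blast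
  have rot3: "rot W (Inn v) = map h [0, 1, 2]"
    by (rule nth_equalityI) (use rv(2) in
      \<open>auto simp: h_def nth_Cons less_Suc_eq numeral_3_eq_3 numeral_2_eq_2 split: nat.splits\<close>)
  have w'eq: "w' White e s * w' Black e s = w White e s * w Black e s * (if e = r then X s else 1)"
    for e s
    by (cases c) (auto simp: w'_def)
  define R where "R = F - {f, g} - {e\<^sub>0}"
  have FR: "F - {e\<^sub>0} = insert f (insert g R)" using fgF fge0 by (auto simp: R_def)
  have R: "f \<notin> insert g R" "g \<notin> R" "finite R" "r \<in> R" using dist finF fgF fge0 by (auto simp: R_def)
  have US: "U \<union> S_verts W = insert v (U - {v} \<union> S_verts W)" "v \<notin> U - {v} \<union> S_verts W"
    "finite (U - {v} \<union> S_verts W)"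
    using v vS finU finS by auto
  show "cut_matrix U F w = cut_matrix (U - {v}) (F - {f, g}) w'"
    unfolding cut_matrix_def vec_eq_iff vec_lambda_beta
  proof (intro allI)
    fix p q
    let ?G = "\<lambda>l. (\<Prod>v\<in>U \<union> S_verts W. eps (map (cut_label l p q v) (rot W (Inn v)))) *
      (\<Prod>e\<in>F - {e\<^sub>0}. w White e (l e) * w Black e (l e))"
    have "(\<Sum>l\<in>F - {e\<^sub>0} \<rightarrow>\<^sub>E UNIV. ?G l) = (\<Sum>l\<in>R \<rightarrow>\<^sub>E UNIV. \<Sum>b\<in>UNIV. \<Sum>a\<in>UNIV. ?G (l(g := b, f := a)))"
      unfolding FR by (subst sum_PiE_insert[OF R(1)], subst sum_PiE_insert[OF R(2)]) (rule refl)
    also have "\<dots> = (\<Sum>l\<in>R \<rightarrow>\<^sub>E UNIV.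
      (\<Prod>v\<in>U - {v} \<union> S_verts W. eps (map (cut_label l p q v) (rot W (Inn v)))) *
      (\<Prod>e\<in>R. w' White e (l e) * w' Black e (l e)))"
    proof (rule sum.cong[OF refl])
      fix l :: "'e \<Rightarrow> 3"
      let ?P = "\<Prod>v\<in>U - {v} \<union> S_verts W. eps (map (cut_label l p q v) (rot W (Inn v)))"
      let ?Q = "\<Prod>e\<in>R. w White e (l e) * w Black e (l e)"
      have G: "?G (l(g := b, f := a)) =
        ?P * ?Q * (eps (map (\<lambda>j. if j = d then l r else if j = Suc d mod 3 then a else b) [0, 1, 2]) *
         ((w White f a * w Black f a) * (w White g b * w Black g b)))" for a b
      proof -
        let ?l = "l(g := b, f := a)"
        have 1: "eps (map (cut_label ?l p q v') (rot W (Inn v'))) =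
          eps (map (cut_label l p q v') (rot W (Inn v')))"
          if "v' \<in> U - {v} \<union> S_verts W" for v'
          using notin[OF that] by (intro arg_cong[where f = eps] map_cong refl)
            (auto simp: cut_label_def)
        have 2: "map (cut_label ?l p q v) (rot W (Inn v)) =
          map (\<lambda>j. if j = d then l r else if j = Suc d mod 3 then a else b) [0, 1, 2]"
          unfolding rot3 map_map
        proof (rule map_cong[OF refl])
          fix j :: nat assume "j \<in> set [0, 1, 2]"
          then have j: "j < 3" by auto
          have "h j \<noteq> e\<^sub>0" using hC[OF j] e\<^sub>0_cycle by auto
          then have "(cut_label ?l p q v \<circ> h) j = ?l (h j)" by (simp add: cut_label_def)
          also have "\<dots> = (if j = d then l r else if j = Suc d mod 3 then a else b)"
          proof (cases "j = d")
            case True then show ?thesis using dist hd by auto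
          next
            case False
            show ?thesis
            proof (cases "j = Suc d mod 3")
              case True then show ?thesis using False hd by simp
            next
              case nf: False
              then have "h j = g" using js(6)[OF j False] hd by simp
              then show ?thesis using False nf dist by simp
            qed
          qed
          finally show "(cut_label ?l p q v \<circ> h) j =
            (if j = d then l r else if j = Suc d mod 3 then a else b)" .
        qed
        have 3: "(\<Prod>e\<in>F - {e\<^sub>0}. w White e (?l e) * w Black e (?l e)) =
          (w White f a * w Black f a) * ((w White g b * w Black g b) * ?Q)"
        proof -
          have "(\<Prod>e\<in>R. w White e (?l e) * w Black e (?l e)) = ?Q"
            using R by (intro prod.cong refl) auto
          then show ?thesis unfolding FR using R dist by simp
        qed
        have 4: "(\<Prod>v\<in>U \<union> S_verts W. eps (map (cut_label ?l p q v) (rot W (Inn v)))) =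
           eps (map (cut_label ?l p q v) (rot W (Inn v))) * ?P"
          unfolding US(1) prod.insert[OF US(3,2)] by (intro arg_cong2[where f = "(*)"] prod.cong refl 1)
        show ?thesis unfolding 4 2 3 by (simp only: mult_ac)
      qed
      have Q: "(\<Prod>e\<in>R. w' White e (l e) * w' Black e (l e)) = ?Q * X (l r)"
        unfolding w'eq prod.distrib using R by (simp add: prod.delta)
      show "(\<Sum>b\<in>UNIV. \<Sum>a\<in>UNIV. ?G (l(g := b, f := a))) =
        ?P * (\<Prod>e\<in>R. w' White e (l e) * w' Black e (l e))"
        unfolding G Q X_def by (subst sum.swap) (simp only: sum_distrib_left mult.assoc)
    qed
    finally show "(\<Sum>l\<in>F - {e\<^sub>0} \<rightarrow>\<^sub>E UNIV. ?G l) = (\<Sum>l\<in>F - {f, g} - {e\<^sub>0} \<rightarrow>\<^sub>E UNIV.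
       (\<Prod>v\<in>U - {v} \<union> S_verts W. eps (map (cut_label l p q v) (rot W (Inn v)))) *
         (\<Prod>e\<in>F - {f, g} - {e\<^sub>0}. w' White e (l e) * w' Black e (l e)))"
      unfolding R_def .
  qed
  \<comment> \<open>Copies are numbered clockwise at \<open>v\<close>, as on the sides of the
    honeycomb; at a white vertex this reverses the index.\<close>
  define cp where "cp t = copy_at 2 c t" for t
  have cp: "cp 0 < 2" "cp 1 < 2" "cp 0 \<noteq> cp 1" "{..<2} = {cp 0, cp 1}"
    by (auto simp: cp_def copy_at_def)
  have prod2: "(\<Prod>i<2. z i) = z (cp 0) * z (cp 1)" for z :: "nat \<Rightarrow> complex"
    unfolding cp(4) using cp(3) by simp
  define A where "A = Old (Par f (cp 0) :: ('v, 'e) tedge)"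
  define A' where "A' = Old (Par f (cp 1) :: ('v, 'e) tedge)"
  define B where "B = Old (Par g (cp 0) :: ('v, 'e) tedge)"
  define B' where "B' = Old (Par g (cp 1) :: ('v, 'e) tedge)"
  define T where "T = slots (F - {f, g})"
  have ABd: "A \<noteq> A'" "A \<noteq> B" "A \<noteq> B'" "A' \<noteq> B" "A' \<noteq> B'" "B \<noteq> B'"
    using cp dist by (auto simp: A_def A'_def B_def B'_def)
  have ABT: "A \<notin> T" "A' \<notin> T" "B \<notin> T" "B' \<notin> T"
    by (auto simp: A_def A'_def B_def B'_def T_def slots_def)
  have slotsF: "slots F = insert B' (insert B (insert A' (insert A T)))"
  proof -
    have "slots F = T \<union> {Old (Par e i) | e i. e \<in> {f, g} \<and> i \<in> {..<2}}"
      using nS fgF unfolding T_def slots_def by auto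
    then show ?thesis unfolding cp(4) A_def A'_def B_def B'_def by auto
  qed
  have slotAB: "slot e i \<notin> {A, A', B, B'}" if "e \<noteq> f" "e \<noteq> g" for e i
    using slot_neq[OF that(1)] slot_neq[OF that(2)] by (auto simp: A_def A'_def B_def B'_def)
  have slotfg: "slot f (cp 0) = A" "slot f (cp 1) = A'" "slot g (cp 0) = B" "slot g (cp 1) = B'"
    using nS by (auto simp: slot_def A_def A'_def B_def B'_def)
  let ?G = "\<lambda>l. (\<Prod>v\<in>U. honeycomb_tensor (\<lambda>d t. l (slot (rot W (Inn v) ! d) (copy_at 2 (icol W v) t)))) *
     (\<Prod>e\<in>F - the_cycle W. \<Prod>i<2. w White e (l (slot e i)) * w Black e (l (slot e i)))"
  have "double_sum U F w = (\<Sum>l\<in>T \<rightarrow>\<^sub>E UNIV. \<Sum>a\<in>UNIV. \<Sum>a'\<in>UNIV. \<Sum>b\<in>UNIV. \<Sum>b'\<in>UNIV.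
    ?G (l(A := a, A' := a', B := b, B' := b')))"
    unfolding double_sum_def slotsF
    using ABd ABT by (subst sum_PiE_insert, simp)+ (rule refl)
  also have "\<dots> = (\<Sum>l\<in>T \<rightarrow>\<^sub>E UNIV.
    (\<Prod>v\<in>U - {v}. honeycomb_tensor (\<lambda>d t. l (slot (rot W (Inn v) ! d) (copy_at 2 (icol W v) t)))) *
     (\<Prod>e\<in>F - {f, g} - the_cycle W. \<Prod>i<2. w' White e (l (slot e i)) * w' Black e (l (slot e i))))"
  proof (rule sum.cong[OF refl])
    fix l :: "('v, 'e) bedge \<Rightarrow> 3"
    define R' where "R' = F - {f, g} - the_cycle W"
    have FR': "F - the_cycle W = insert f (insert g R')" using fgF fgC by (auto simp: R'_def)
    have R': "f \<notin> insert g R'" "g \<notin> R'" "finite R'" "r \<in> R'" using dist finF fgF fgC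
      by (auto simp: R'_def)
    let ?P = "\<Prod>v\<in>U - {v}. honeycomb_tensor (\<lambda>d t.
      l (slot (rot W (Inn v) ! d) (copy_at 2 (icol W v) t)))"
    let ?Q = "\<Prod>e\<in>R'. \<Prod>i<2. w White e (l (slot e i)) * w Black e (l (slot e i))"
    define cc where "cc t = l (slot r (cp t))" for t
    have G: "?G (l(A := a, A' := a', B := b, B' := b')) =
      ?P * ?Q * (honeycomb_tensor (\<lambda>j t. if j = d then cc t else
      if j = Suc d mod 3 then (if t = 0 then a else a') else (if t = 0 then b else b')) *
      ((w White f a * w Black f a) * (w White f a' * w Black f a') *
        ((w White g b * w Black g b) * (w White g b' * w Black g b'))))" for a a' b b'
    proof -
      let ?l = "l(A := a, A' := a', B := b, B' := b')"
      have ls: "?l (slot e i) = l (slot e i)" if "e \<noteq> f" "e \<noteq> g" for e i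
        using slotAB[OF that, of i] by auto
      have lAB: "?l A = a" "?l A' = a'" "?l B = b" "?l B' = b'" using ABd by auto
      have 1: "honeycomb_tensor (\<lambda>d t. ?l (slot (rot W (Inn v') ! d) (copy_at 2 (icol W v') t))) =
        honeycomb_tensor (\<lambda>d t. l (slot (rot W (Inn v') ! d) (copy_at 2 (icol W v') t)))"
        if v': "v' \<in> U - {v}" for v'
      proof (rule honeycomb_tensor_cong, rule ls)
        fix d :: nat assume "d < 3"
        then have "rot W (Inn v') ! d \<in> set (rot W (Inn v'))" using v' U rot_internal(2)[of v']
          by (intro nth_mem) auto
        then show "rot W (Inn v') ! d \<noteq> f" "rot W (Inn v') ! d \<noteq> g" using notin[of v'] v' by auto
      qed
      have 2: "honeycomb_tensor (\<lambda>d t. ?l (slot (rot W (Inn v) ! d) (copy_at 2 (icol W v) t))) =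
        honeycomb_tensor (\<lambda>j t. if j = d then cc t else
          if j = Suc d mod 3 then (if t = 0 then a else a') else (if t = 0 then b else b'))"
      proof (rule honeycomb_tensor_cong)
        fix j t :: nat assume j: "j < 3" and t: "t < 2"
        have t: "t = 0 \<or> t = 1" using t by auto
        have "?l (slot (h j) (cp t)) = (if j = d then cc t else
          if j = Suc d mod 3 then (if t = 0 then a else a') else (if t = 0 then b else b'))"
        proof (cases "j = d")
          case True then show ?thesis using ls[of r "cp t"] dist hd by (simp add: cc_def)
        next
          case False
          show ?thesis
          proof (cases "j = Suc d mod 3")
            case True
            then have "h j = f" using hd by simp
            then have "?l (slot (h j) (cp t)) = (if t = 0 then a else a')"
              using t by (elim disjE) (simp_all only: slotfg lAB if_True one_neq_zero if_False refl)
            then show ?thesis using False True by (simp only: if_False if_True refl)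
          next
            case nf: False
            then have "h j = g" using js(6)[OF j False] hd by simp
            then have "?l (slot (h j) (cp t)) = (if t = 0 then b else b')"
              using t by (elim disjE) (simp_all only: slotfg lAB if_True one_neq_zero if_False refl)
            then show ?thesis using False nf by (simp only: if_False refl)
          qed
        qed
        then show "?l (slot (rot W (Inn v) ! j) (copy_at 2 (icol W v) t)) = (if j = d then cc t else
          if j = Suc d mod 3 then (if t = 0 then a else a') else (if t = 0 then b else b'))"
          unfolding h_def cp_def c_def .
      qed
      have 3: "(\<Prod>e\<in>F - the_cycle W. \<Prod>i<2. w White e (?l (slot e i)) * w Black e (?l (slot e i))) =
        (w White f a * w Black f a) * (w White f a' * w Black f a') *
          ((w White g b * w Black g b) * (w White g b' * w Black g b') * ?Q)"
      proof -
        have "(\<Prod>e\<in>R'. \<Prod>i<2. w White e (?l (slot e i)) * w Black e (?l (slot e i))) = ?Q"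
          by (intro prod.cong refl, subst (1 2) ls) (auto simp: R'_def)
        moreover have "(\<Prod>i<2. w White f (?l (slot f i)) * w Black f (?l (slot f i))) =
          (w White f a * w Black f a) * (w White f a' * w Black f a')"
          unfolding prod2 slotfg lAB ..
        moreover have "(\<Prod>i<2. w White g (?l (slot g i)) * w Black g (?l (slot g i))) =
          (w White g b * w Black g b) * (w White g b' * w Black g b')"
          unfolding prod2 slotfg lAB ..
        ultimately show ?thesis
          unfolding FR' prod.insert[OF finite.insertI[OF R'(3)] R'(1)] prod.insert[OF R'(3,2)]
            by (simp only:)
      qed
      have 4: "(\<Prod>v\<in>U. honeycomb_tensor (\<lambda>d t. ?l (slot (rot W (Inn v) ! d) (copy_at 2 (icol W v) t)))) =
        honeycomb_tensor (\<lambda>d t. ?l (slot (rot W (Inn v) ! d) (copy_at 2 (icol W v) t))) * ?P"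
        unfolding prod.remove[OF finU v] by (intro arg_cong2[where f = "(*)"] prod.cong refl 1)
      show ?thesis unfolding 4 2 3 by (simp only: mult_ac)
    qed
    have Q: "(\<Prod>e\<in>R'. \<Prod>i<2. w' White e (l (slot e i)) * w' Black e (l (slot e i))) =
      ?Q * (X (cc 0) * X (cc (Suc 0)))"
    proof -
      have "(\<Prod>i<2. if e = r then X (l (slot e i)) else 1) =
        (if e = r then X (cc 0) * X (cc (Suc 0)) else 1)" for e
        unfolding prod2 cc_def by simp
      then show ?thesis unfolding w'eq prod.distrib using R' by (simp add: prod.delta)
    qed
    have H: "(\<Sum>a\<in>UNIV. \<Sum>a'\<in>UNIV. \<Sum>b\<in>UNIV. \<Sum>b'\<in>UNIV. honeycomb_tensor (\<lambda>j t. if j = d then cc t else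
      if j = Suc d mod 3 then (if t = 0 then a else a') else (if t = 0 then b else b')) *
      ((w White f a * w Black f a) * (w White f a' * w Black f a') *
        ((w White g b * w Black g b) * (w White g b' * w Black g b')))) =
      X (cc 0) * X (cc (Suc 0))"
      unfolding X_def using honeycomb_tensor_cherry[OF d, of cc "\<lambda>a. w White f a * w Black f a"
        "\<lambda>b. w White g b * w Black g b"] .
    show "(\<Sum>a\<in>UNIV. \<Sum>a'\<in>UNIV. \<Sum>b\<in>UNIV. \<Sum>b'\<in>UNIV. ?G (l(A := a, A' := a', B := b, B' := b'))) =
      ?P * (\<Prod>e\<in>F - {f, g} - the_cycle W. \<Prod>i<2. w' White e (l (slot e i)) * w' Black e (l (slot e i)))"
      unfolding G R'_def[symmetric] Q sum_distrib_left[symmetric] H by (simp only: mult.assoc)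
  qed
  finally show "double_sum U F w = double_sum (U - {v}) (F - {f, g}) w'"
    unfolding double_sum_def T_def .
qed

subsection \<open>Joining the legs\<close>

definition vend :: "colour \<Rightarrow> 'e \<Rightarrow> 'v" where
  "vend c e = (case endp W c e of Inn v \<Rightarrow> v)"

lemma vend:
  assumes "e \<in> the_cycle W"
  shows "endp W c e = Inn (vend c e)" "vend c e \<in> S_verts W" "icol W (vend c e) = c"
proof -
  obtain v where v: "endp W c e = Inn v" "v \<in> S_verts W" using cycle_in_sub[OF assms]
    unfolding in_sub_def by blast
  then have "vend c e = v" by (simp add: vend_def)
  then show "endp W c e = Inn (vend c e)" "vend c e \<in> S_verts W" "icol W (vend c e) = c"
    using v endp_Inn[of e c v] assms cycle_edges by auto
qed

definition strand_index :: "'v \<Rightarrow> 'e \<Rightarrow> nat" where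
  "strand_index v e = copy_at 2 (icol W v)
     (if rot W (Inn v) ! (Suc (idx (rot W (Inn v)) (leg W v)) mod 3) = e then 1 else 0)"

lemma strand_eq:
  assumes "e \<in> the_cycle W"
  shows "strand W c e = Par (leg W (vend (opp c) e)) (strand_index (vend (opp c) e) e)"
  unfolding strand_def vend(1)[OF assms] strand_index_def by (simp add: Let_def vend(3)[OF assms])

lemma cycle_at_iff:
  assumes "e \<in> the_cycle W"
  shows "Inn v \<in> ends e \<longleftrightarrow> (\<exists>c. v = vend c e)"
proof -
  have "(\<exists>c. v = vend c e) \<longleftrightarrow> v = vend White e \<or> v = vend Black e" by (metis colour.exhaust)
  then show ?thesis unfolding ends_def vend(1)[OF assms] by simp
qed

text \<open>Of the two cycle edges at \<open>v\<close> exactly one is the clockwise successor of the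
  leg. The two therefore select different copies of the leg, and each copy is joined once.\<close>

lemma strand_index_bij:
  assumes v: "v \<in> S_verts W"
  shows "bij_betw (strand_index v) {e \<in> the_cycle W. Inn v \<in> ends e} {..<2}"
proof -
  have vi: "v \<in> internal W" using v S_verts_internal by auto
  let ?r = "rot W (Inn v)"
  note r = rot_internal[OF vi]
  define k where "k = idx ?r (leg W v)"
  have k: "k < 3" "?r ! k = leg W v" using idx_nth[OF leg(1)[OF v]] r(2) by (auto simp: k_def)
  define e where "e = ?r ! (Suc k mod 3)"
  obtain f g where fg: "f \<noteq> g" "{e \<in> the_cycle W. Inn v \<in> ends e} = {f, g}" using v
    by (rule cycle_edges_at)
  have "Suc k mod 3 \<noteq> k" "Suc k mod 3 < 3" using k(1) by presburger+
  then have "e \<noteq> leg W v" "e \<in> set ?r"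
    unfolding e_def k(2)[symmetric] using r(1,2) k(1) by (simp_all add: nth_eq_iff_index_eq)
  then have "e \<in> the_cycle W" using leg_unique[OF v] by blast
  then have "e \<in> {f, g}" unfolding fg(2)[symmetric]
    using \<open>e \<in> set ?r\<close> ends_in_rot[OF vi] cycle_edges by blast
  then obtain e' where e': "{e \<in> the_cycle W. Inn v \<in> ends e} = {e, e'}" "e \<noteq> e'" using fg by blast
  have "strand_index v e = copy_at 2 (icol W v) 1" "strand_index v e' = copy_at 2 (icol W v) 0"
    using e'(2) by (auto simp: strand_index_def e_def k_def)
  then show ?thesis unfolding e'(1) bij_betw_def using e'(2) by (auto simp: copy_at_def)
qed

text \<open>A strand names a leg and a copy. The leg determines its cycle vertex by
  \<open>leg_inj\<close>, and the copy then determines the cycle edge. The second equation is the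
  form in which \<open>B_rot\<close> looks up a joining edge at the outer end of the leg.\<close>

lemma joint_eqI:
  assumes v: "v \<in> S_verts W" and e: "e \<in> the_cycle W" "Inn v \<in> ends e"
  shows "joint (leg W v) (strand_index v e) = e"
    and "(THE e'. e' \<in> the_cycle W \<and> strand W (opp (icol W v)) e' = Par (leg W v) (strand_index v e)) =
      e"
proof -
  have opp: "opp (opp c) = c" for c by (cases c) auto
  have un: "e' = e" if "e' \<in> the_cycle W" "strand W c e' = Par (leg W v) (strand_index v e)" for e' c
  proof -
    have "leg W (vend (opp c) e') = leg W v" "strand_index (vend (opp c) e') e' = strand_index v e"
      using that strand_eq[OF that(1)] by auto
    moreover then have "vend (opp c) e' = v" using leg_inj v vend(2)[OF that(1)] by (auto dest: inj_onD)
    ultimately have "strand_index v e' = strand_index v e" "Inn v \<in> ends e'"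
      using cycle_at_iff[OF that(1)] by auto
    then show "e' = e" using strand_index_bij[OF v] that(1) e by (auto simp: bij_betw_def dest: inj_onD)
  qed
  obtain c where c: "v = vend c e" using e cycle_at_iff by blast
  then have "icol W v = c" using vend(3)[OF e(1)] by simp
  then have st: "strand W (opp (icol W v)) e = Par (leg W v) (strand_index v e)"
    using strand_eq[OF e(1), of "opp c"] c opp by simp
  show "joint (leg W v) (strand_index v e) = e" unfolding joint_def using un e(1) st
    by (intro the_equality) blast+
  show "(THE e'. e' \<in> the_cycle W \<and> strand W (opp (icol W v)) e' = Par (leg W v) (strand_index v e)) =
    e"
    using un e(1) st by (intro the_equality) blast+
qed

lemma joint_the:
  assumes v: "v \<in> S_verts W" and "i < 2"
  shows "joint (leg W v) i \<in> {e \<in> the_cycle W. Inn v \<in> ends e}"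
    and "(THE e'. e' \<in> the_cycle W \<and> strand W (opp (icol W v)) e' = Par (leg W v) i) =
      joint (leg W v) i"
proof -
  obtain e where "e \<in> the_cycle W" "Inn v \<in> ends e" "i = strand_index v e"
    using strand_index_bij[OF v] \<open>i < 2\<close> unfolding bij_betw_def by blast
  then show "joint (leg W v) i \<in> {e \<in> the_cycle W. Inn v \<in> ends e}"
    "(THE e'. e' \<in> the_cycle W \<and> strand W (opp (icol W v)) e' = Par (leg W v) i) = joint (leg W v) i"
    using joint_eqI[OF v] by auto
qed

lemma finite_S: "finite (S_verts W)"
  using S_verts_internal finite_internal finite_subset by blast

lemma finite_C: "finite (the_cycle W)"
  using cycle_edges finite_edges finite_subset by blast

text \<open>Double counting of the incidences between cycle vertices and cycle edges: each copy of a
  leg stands for one of the two cycle edges at its vertex.\<close>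

lemma prod_joint:
  fixes \<phi> :: "'v \<Rightarrow> 'e \<Rightarrow> complex"
  shows "(\<Prod>v\<in>S_verts W. \<Prod>i<2. \<phi> v (joint (leg W v) i)) =
    (\<Prod>e\<in>the_cycle W. \<phi> (vend White e) e * \<phi> (vend Black e) e)"
proof -
  have "(\<Prod>i<2. \<phi> v (joint (leg W v) i)) = (\<Prod>e | e \<in> the_cycle W \<and> Inn v \<in> ends e. \<phi> v e)"
    if v: "v \<in> S_verts W" for v
    by (rule prod.reindex_bij_betw[OF strand_index_bij[OF v], symmetric, of
      "\<lambda>i. \<phi> v (joint (leg W v) i)", THEN trans])
       (simp add: joint_eqI(1)[OF v])
  then have "(\<Prod>v\<in>S_verts W. \<Prod>i<2. \<phi> v (joint (leg W v) i)) =
      (\<Prod>v\<in>S_verts W. \<Prod>e | e \<in> the_cycle W \<and> Inn v \<in> ends e. \<phi> v e)" by simp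
  also have "\<dots> = (\<Prod>e\<in>the_cycle W. \<Prod>v | v \<in> S_verts W \<and> Inn v \<in> ends e. \<phi> v e)"
    by (rule prod.swap_restrict[OF finite_S finite_C])
  also have "\<dots> = (\<Prod>e\<in>the_cycle W. \<phi> (vend White e) e * \<phi> (vend Black e) e)"
  proof (rule prod.cong[OF refl])
    fix e assume e: "e \<in> the_cycle W"
    have "{v. v \<in> S_verts W \<and> Inn v \<in> ends e} = {vend White e, vend Black e}"
      using vend(2)[OF e] unfolding ends_def vend(1)[OF e] by auto
    moreover have "vend White e \<noteq> vend Black e" using vend(3)[OF e] by (metis colour.distinct(1))
    ultimately show "(\<Prod>v | v \<in> S_verts W \<and> Inn v \<in> ends e. \<phi> v e) =
      \<phi> (vend White e) e * \<phi> (vend Black e) e" by simp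
  qed
  finally show ?thesis .
qed

subsection \<open>The evaluated cycle\<close>

definition legs_weight :: "(colour \<Rightarrow> 'e \<Rightarrow> 3 \<Rightarrow> complex) \<Rightarrow> 'v \<Rightarrow> 3 \<Rightarrow> complex" where
  "legs_weight w v s = w (opp (icol W v)) (leg W v) s"

definition unit_weight :: "'e set \<Rightarrow> (colour \<Rightarrow> 'e \<Rightarrow> 3 \<Rightarrow> complex) \<Rightarrow> bool" where
  "unit_weight F w \<longleftrightarrow> (\<forall>e\<in>F. \<forall>c. endp W c e \<in> Inn ` S_verts W \<longrightarrow> w c e = (\<lambda>_. 1))"

text \<open>When all vertices off the cycle are gone, an edge outside \<open>S_edges W\<close> meets
  no remaining internal vertex and contributes a scalar. Such edges stem from parts of the web that
  internal vertices do not link to the cycle.\<close>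

definition loose :: "'e set \<Rightarrow> (colour \<Rightarrow> 'e \<Rightarrow> 3 \<Rightarrow> complex) \<Rightarrow> complex" where
  "loose F w = (\<Prod>e\<in>F - S_edges W. \<Sum>s\<in>UNIV. w White e s * w Black e s)"

lemma leg_weight_eq:
  assumes "unit_weight F w" "v \<in> S_verts W" "leg W v \<in> F"
  shows "w White (leg W v) s * w Black (leg W v) s = legs_weight w v s"
proof -
  have "w (icol W v) (leg W v) = (\<lambda>_. 1)" using assms leg_edge[OF assms(2)]
    by (simp add: unit_weight_def)
  then show ?thesis unfolding legs_weight_def by (cases "icol W v") auto
qed

text \<open>A leg occurs at one cycle vertex and a loose edge at none, so their labels are summed
  out one by one. Only the labels of the uncut cycle edges remain.\<close>

lemma cut_matrix_base_sum:
  assumes F: "F \<subseteq> edges W" "S_edges W \<subseteq> F"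
    and w: "unit_weight F w"
  shows "cut_matrix {} F w $ p $ q = loose F w * (\<Sum>l \<in> (the_cycle W - {e\<^sub>0}) \<rightarrow>\<^sub>E UNIV. \<Prod>v\<in>S_verts W.
     \<Sum>s\<in>UNIV. eps (map (\<lambda>e. if e = leg W v then s else cut_label l p q v e) (rot W (Inn v))) *
       legs_weight w v s)"
proof -
  let ?C = "the_cycle W" and ?S = "S_verts W" and ?L = "leg W ` S_verts W" and ?J = "F - S_edges W"
  have finF: "finite F" using F(1) finite_edges finite_subset by blast
  have fin: "finite ?L" "finite ?J" using finite_S finF by auto
  have LJ: "?L \<inter> ?J = {}" using S_edges_eq by auto
  have CL: "?C \<inter> ?L = {}" using leg(2) by auto
  have FE: "F - {e\<^sub>0} = (?C - {e\<^sub>0}) \<union> (?L \<union> ?J)"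
    using F(2) S_edges_eq CL e\<^sub>0_cycle by auto
  have legF: "leg W v \<in> F" if "v \<in> ?S" for v using F(2) S_edges_eq that by auto
  \<comment> \<open>The factor governed by the label \<open>s\<close> of \<open>e\<close> once the
    cycle labels \<open>l\<close> are fixed. For a leg it includes the volume form at its cycle
    vertex, which \<open>inv_into\<close> recovers.\<close>
  define k where "k l e s =
    (if e \<in> ?L then eps (map (\<lambda>e'.
    if e' = e then s else cut_label l p q (inv_into ?S (leg W) e) e')
    (rot W (Inn (inv_into ?S (leg W) e)))) *
     legs_weight w (inv_into ?S (leg W) e) s else w White e s * w Black e s)" for l e s
  have inv: "inv_into ?S (leg W) (leg W v) = v" if "v \<in> ?S" for v using leg_inj that by simp
  \<comment> \<open>General in \<open>z\<close>, to serve both at a chosen label and for the sum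
    over all labels.\<close>
  have kJ: "(\<Prod>e\<in>?J. z e (k l e)) = (\<Prod>e\<in>?J. z e (\<lambda>s. w White e s * w Black e s))"
    for l and z :: "'e \<Rightarrow> (3 \<Rightarrow> complex) \<Rightarrow> complex"
  proof (rule prod.cong[OF refl])
    fix e assume "e \<in> ?J"
    then have "e \<notin> ?L" using LJ by blast
    then show "z e (k l e) = z e (\<lambda>s. w White e s * w Black e s)" unfolding k_def by simp
  qed
  have kL: "(\<Prod>e\<in>?L. z e (k l e)) =
    (\<Prod>v\<in>?S. z (leg W v) (\<lambda>s. eps (map (\<lambda>e'.
    if e' = leg W v then s else cut_label l p q v e') (rot W (Inn v))) * legs_weight w v s))"
    for l and z :: "'e \<Rightarrow> (3 \<Rightarrow> complex) \<Rightarrow> complex"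
  proof -
    have "k l (leg W v) = (\<lambda>s.
      eps (map (\<lambda>e'. if e' = leg W v then s else cut_label l p q v e') (rot W (Inn v))) * legs_weight w
      v s)"
      if "v \<in> ?S" for v by (rule ext) (simp only: k_def inv[OF that] imageI[OF that] if_True)
    then show ?thesis unfolding prod.reindex[OF leg_inj] comp_def by (intro prod.cong refl) (simp only:)
  qed
  have "cut_matrix {} F w $ p $ q =
    (\<Sum>l1 \<in> ?C - {e\<^sub>0} \<rightarrow>\<^sub>E UNIV. \<Sum>l2 \<in> ?L \<union> ?J \<rightarrow>\<^sub>E UNIV. \<Prod>e\<in>?L \<union> ?J. k l1 e (l2 e))"
    unfolding cut_matrix_def vec_lambda_beta FE
  proof (rule sum_PiE_union)
    show "(?C - {e\<^sub>0}) \<inter> (?L \<union> ?J) = {}" using CL S_edges_eq by auto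
    fix l l1 l2 :: "'e \<Rightarrow> 3"
    assume l1: "\<And>a. a \<in> ?C - {e\<^sub>0} \<Longrightarrow> l a = l1 a" and l2: "\<And>b. b \<in> ?L \<union> ?J \<Longrightarrow> l b = l2 b"
    have 1: "eps (map (cut_label l p q v) (rot W (Inn v))) =
      eps (map (\<lambda>e'. if e' = leg W v then l2 (leg W v) else cut_label l1 p q v e') (rot W (Inn v)))"
      if v: "v \<in> ?S" for v
    proof (intro arg_cong[where f = eps] map_cong refl)
      fix e assume e: "e \<in> set (rot W (Inn v))"
      show "cut_label l p q v e = (if e = leg W v then l2 (leg W v) else cut_label l1 p q v e)"
      proof (cases "e = leg W v")
        case True
        then have "e \<noteq> e\<^sub>0" using e\<^sub>0_cycle leg(2)[OF v] by auto
        then show ?thesis using True l2[of e] v by (simp add: cut_label_def)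
      next
        case False
        then have "e \<in> ?C" using leg_unique[OF v e] by blast
        then show ?thesis using False l1[of e] by (simp add: cut_label_def)
      qed
    qed
    have 2: "(\<Prod>e\<in>(?C - {e\<^sub>0}) \<union> (?L \<union> ?J). w White e (l e) * w Black e (l e)) =
       (\<Prod>v\<in>?S. legs_weight w v (l2 (leg W v))) * (\<Prod>e\<in>?J. w White e (l2 e) * w Black e (l2 e))"
    proof -
      have wC: "w c e = (\<lambda>_. 1)" if "e \<in> ?C" for e c
        using that w cycle_in_sub[OF that] F(2) S_edges_eq unfolding in_sub_def unit_weight_def by auto
      have "(\<Prod>e\<in>(?C - {e\<^sub>0}) \<union> (?L \<union> ?J). w White e (l e) * w Black e (l e)) =
        (\<Prod>e\<in>?L \<union> ?J. w White e (l e) * w Black e (l e))"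
        by (rule prod.mono_neutral_right) (use wC fin finite_C in auto)
      also have "\<dots> = (\<Prod>e\<in>?L. w White e (l e) * w Black e (l e)) *
        (\<Prod>e\<in>?J. w White e (l e) * w Black e (l e))"
        using fin LJ by (rule prod.union_disjoint)
      also have "(\<Prod>e\<in>?L. w White e (l e) * w Black e (l e)) = (\<Prod>v\<in>?S. legs_weight w v (l2 (leg W v)))"
        unfolding prod.reindex[OF leg_inj] comp_def
        by (rule prod.cong[OF refl]) (simp add: leg_weight_eq[OF w _ legF] l2)
      also have "(\<Prod>e\<in>?J. w White e (l e) * w Black e (l e)) =
        (\<Prod>e\<in>?J. w White e (l2 e) * w Black e (l2 e))"
        by (rule prod.cong[OF refl]) (use l2 in simp)
      finally show ?thesis .
    qed
    have 3: "(\<Prod>e\<in>?L \<union> ?J. k l1 e (l2 e)) =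
      (\<Prod>v\<in>?S. eps (map (\<lambda>e'. if e' = leg W v then l2 (leg W v)
      else cut_label l1 p q v e') (rot W (Inn v))) * legs_weight w v (l2 (leg W v))) *
       (\<Prod>e\<in>?J. w White e (l2 e) * w Black e (l2 e))"
      using prod.union_disjoint[OF fin LJ, of "\<lambda>e. k l1 e (l2 e)"] kL[of "\<lambda>e z. z (l2 e)" l1] kJ[of
        "\<lambda>e z. z (l2 e)" l1] by simp
    have 4: "(\<Prod>v\<in>{} \<union> ?S. eps (map (cut_label l p q v) (rot W (Inn v)))) =
      (\<Prod>v\<in>?S. eps (map (\<lambda>e'. if e' = leg W v then l2 (leg W v)
        else cut_label l1 p q v e') (rot W (Inn v))))"
      unfolding Un_empty_left by (rule prod.cong[OF refl 1])
    show "(\<Prod>v\<in>{} \<union> ?S. eps (map (cut_label l p q v) (rot W (Inn v)))) *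
       (\<Prod>e\<in>(?C - {e\<^sub>0}) \<union> (?L \<union> ?J). w White e (l e) * w Black e (l e)) = (\<Prod>e\<in>?L \<union> ?J. k l1 e (l2 e))"
      unfolding 4 2 3 by (simp only: prod.distrib mult.assoc)
  qed
  also have "\<dots> = (\<Sum>l1 \<in> ?C - {e\<^sub>0} \<rightarrow>\<^sub>E UNIV. \<Prod>e\<in>?L \<union> ?J. \<Sum>s\<in>UNIV. k l1 e s)"
    by (intro sum.cong refl prod_sum_PiE[symmetric]) (use fin in auto)
  also have "\<dots> = (\<Sum>l1 \<in> ?C - {e\<^sub>0} \<rightarrow>\<^sub>E UNIV. loose F w * (\<Prod>v\<in>?S.
     \<Sum>s\<in>UNIV. eps (map (\<lambda>e. if e = leg W v then s else cut_label l1 p q v e) (rot W (Inn v))) *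
       legs_weight w v s))"
  proof (rule sum.cong[OF refl])
    fix l1 :: "'e \<Rightarrow> 3"
    show "(\<Prod>e\<in>?L \<union> ?J. \<Sum>s\<in>UNIV. k l1 e s) = loose F w * (\<Prod>v\<in>?S.
     \<Sum>s\<in>UNIV. eps (map (\<lambda>e. if e = leg W v then s else cut_label l1 p q v e) (rot W (Inn v))) *
       legs_weight w v s)"
      unfolding prod.union_disjoint[OF fin LJ] kL[of "\<lambda>e z. sum z UNIV" l1] kJ[of "\<lambda>e z. sum z UNIV"
        l1] loose_def
      by (rule mult.commute)
  qed
  finally show ?thesis by (simp only: sum_distrib_left)
qed

lemma cut_matrix_base:
  assumes F: "F \<subseteq> edges W" "S_edges W \<subseteq> F"
    and w: "unit_weight F w"
  shows "det (cut_matrix {} F w) = 0"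
    and "trace (cof (cut_matrix {} F w)) = (loose F w)\<^sup>2 *
      (\<Prod>e\<in>the_cycle W. \<Sum>s\<in>UNIV. legs_weight w (vend White e) s * legs_weight w (vend Black e) s)"
proof -
  obtain n vs es where n6: "6 \<le> n" and inj: "inj_on vs {..<n}" "inj_on es {..<n}" and last:
    "es (n - 1) = e\<^sub>0"
    and C: "the_cycle W = es ` {..<n}" and S: "S_verts W = vs ` {..<n}"
    and en: "\<And>i. i < n \<Longrightarrow> {endp W White (es i), endp W Black (es i)} =
      {Inn (vs i), Inn (vs (Suc i mod n))}"
    by (rule cycle_enumeration) blast
  obtain m where m: "n = Suc m" using n6 by (cases n) auto
  \<comment> \<open>The cycle edge that precedes \<open>es i\<close>, with \<open>e\<^sub>0\<close>
    before \<open>es 0\<close>; \<open>M i\<close> leads from it across \<open>vs i\<close> to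
    \<open>es i\<close>.\<close>
  define pe where "pe i = es (if i = 0 then m else i - 1)" for i
  define M :: "nat \<Rightarrow> complex^3^3" where "M i =
    (\<chi> \<alpha> \<beta>. \<Sum>s\<in>UNIV. eps (map (\<lambda>h. if h = leg W (vs i) then s else
    if h = pe i then \<alpha> else \<beta>) (rot W (Inn (vs i)))) * legs_weight w (vs i) s)" for i
  have vS: "vs i \<in> S_verts W" if "i < n" for i using S that by auto
  have esC: "es i \<in> the_cycle W" if "i < n" for i using C that by auto
  have peC: "pe i \<in> the_cycle W" if "i < n" for i using esC that m by (auto simp: pe_def)
  have ends1: "Inn (vs i) \<in> ends (es i)" if "i < n" for i using en[OF that] by (simp add: ends_def)
  have ends2: "Inn (vs i) \<in> ends (pe i)" if "i < n" for i
  proof -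
    define j where "j = (if i = 0 then m else i - 1)"
    have j: "j < n" "Suc j mod n = i" using that m by (auto simp: j_def)
    have "Inn (vs i) \<in> {Inn (vs j), Inn (vs (Suc j mod n))}" using j by simp
    then show ?thesis unfolding en[OF j(1), symmetric] ends_def pe_def j_def[symmetric] .
  qed
  have pene: "pe i \<noteq> es i" if "i < n" for i
    using that m n6 inj(2) unfolding pe_def by (auto dest!: inj_onD)
  have rots: "set (rot W (Inn (vs i))) = {pe i, es i, leg W (vs i)}"
    "distinct [pe i, es i, leg W (vs i)]"
     "length (rot W (Inn (vs i))) = 3" if i: "i < n" for i
  proof -
    have vi: "vs i \<in> internal W" using vS[OF i] S_verts_internal by auto
    have in_r: "pe i \<in> set (rot W (Inn (vs i)))" "es i \<in> set (rot W (Inn (vs i)))"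
      using ends_in_rot[OF vi] ends1[OF i] ends2[OF i] esC[OF i] peC[OF i] cycle_edges by blast+
    show d: "distinct [pe i, es i, leg W (vs i)]"
      using pene[OF i] peC[OF i] esC[OF i] leg(2)[OF vS[OF i]] by auto
    show l3: "length (rot W (Inn (vs i))) = 3" by (rule rot_internal(2)[OF vi])
    have "card (set (rot W (Inn (vs i)))) = 3" using l3 rot_internal(1)[OF vi] distinct_card by metis
    moreover have "card {pe i, es i, leg W (vs i)} = 3" using d by simp
    moreover have "{pe i, es i, leg W (vs i)} \<subseteq> set (rot W (Inn (vs i)))" using in_r leg(1)[OF vS[OF i]]
      by simp
    ultimately show "set (rot W (Inn (vs i))) = {pe i, es i, leg W (vs i)}"
      by (metis card_subset_eq finite_set)
  qed
  have cofM: "cof (M i) = (\<chi> r s. legs_weight w (vs i) r * legs_weight w (vs i) s)" and detM: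
    "det (M i) = 0" if "i < n" for i
    using cross_matrix[OF rots(2)[OF that] rots(1)[OF that] rots(3)[OF that]] unfolding M_def by blast+
  define lab where "lab p q v = (if icol W v = Black then q else (p::3))" for p q v
  have entry: "cut_matrix {} F w $ p $ q = loose F w * mprod M m $ lab p q (vs 0) $ lab p q (vs m)"
    for p q
  proof -
    have "(\<Sum>l \<in> (the_cycle W - {e\<^sub>0}) \<rightarrow>\<^sub>E UNIV. \<Prod>v\<in>S_verts W.
       \<Sum>s\<in>UNIV. eps (map (\<lambda>e. if e = leg W v then s else cut_label l p q v e) (rot W (Inn v))) *
         legs_weight w v s) =
     (\<Sum>t \<in> {..<m} \<rightarrow>\<^sub>E UNIV. \<Prod>i\<le>m. M i $ (if i = 0 then lab p q (vs 0) else t (i - 1)) $ (if i = m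
       then lab p q (vs m) else t i))"
    proof (rule sum_PiE_transfer[symmetric, of es])
      have "es ` {..<m} = the_cycle W - {e\<^sub>0}"
      proof -
        have "{..<n} = insert m {..<m}" using m by auto
        then have "the_cycle W = insert e\<^sub>0 (es ` {..<m})" using C last m by simp
        moreover have "e\<^sub>0 \<notin> es ` {..<m}" using last inj(2) m by (auto dest!: inj_onD)
        ultimately show ?thesis by auto
      qed
      moreover have "inj_on es {..<m}" using inj(2) m by (auto simp: inj_on_def)
      ultimately show "bij_betw es {..<m} (the_cycle W - {e\<^sub>0})" by (simp add: bij_betw_def)
      fix t :: "nat \<Rightarrow> 3" and l :: "'e \<Rightarrow> 3"
      assume t: "\<And>i. i \<in> {..<m} \<Longrightarrow> t i = l (es i)"
      have es_e0: "es i = e\<^sub>0 \<longleftrightarrow> i = m" if "i \<le> m" for i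
        using last inj(2) m that by (auto dest!: inj_onD)
      have "(\<Prod>v\<in>S_verts W.
       \<Sum>s\<in>UNIV. eps (map (\<lambda>e. if e = leg W v then s else cut_label l p q v e) (rot W (Inn v))) *
         legs_weight w v s) =
       (\<Prod>i\<le>m. \<Sum>s\<in>UNIV. eps (map (\<lambda>e.
         if e = leg W (vs i) then s else cut_label l p q (vs i) e) (rot W (Inn (vs i)))) * legs_weight w
         (vs i) s)"
        unfolding S prod.reindex[OF inj(1)] using m by (simp add: lessThan_Suc_atMost)
      also have "\<dots> = (\<Prod>i\<le>m. M i $ (if i = 0 then lab p q (vs 0) else t (i - 1)) $ (if i =
        m then lab p q (vs m) else t i))"
      proof (rule prod.cong[OF refl])
        fix i assume "i \<in> {..m}"
        then have i: "i < n" "i \<le> m" using m by auto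
        define \<alpha> where "\<alpha> = (if i = 0 then lab p q (vs 0) else t (i - 1))"
        define \<beta> where "\<beta> = (if i = m then lab p q (vs m) else t i)"
        have a: "cut_label l p q (vs i) (pe i) = \<alpha>"
          using i es_e0[of m] es_e0[of "i - 1"] t[of "i - 1"]
            by (auto simp: cut_label_def \<alpha>_def pe_def lab_def)
        have b: "cut_label l p q (vs i) (es i) = \<beta>"
          using i es_e0[of i] t[of i] by (auto simp: cut_label_def \<beta>_def lab_def)
        have mp: "map (\<lambda>e. if e =
          leg W (vs i) then s else cut_label l p q (vs i) e) (rot W (Inn (vs i))) =
          map (\<lambda>h. if h = leg W (vs i) then s else
            if h = pe i then \<alpha> else \<beta>) (rot W (Inn (vs i)))" for s
          by (rule map_cong[OF refl]) (use rots(1)[OF i(1)] a b in auto)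
        show "(\<Sum>s\<in>UNIV. eps (map (\<lambda>e. if e =
          leg W (vs i) then s else cut_label l p q (vs i) e) (rot W (Inn (vs i)))) * legs_weight w
          (vs i) s) =
          M i $ (if i = 0 then lab p q (vs 0) else t (i - 1)) $ (if i = m then lab p q (vs m) else t i)"
          unfolding M_def \<alpha>_def[symmetric] \<beta>_def[symmetric] by (simp only: mp vec_lambda_beta)
      qed
      finally show "(\<Prod>i\<le>m. M i $ (if i = 0 then lab p q (vs 0) else t (i - 1)) $ (if i =
        m then lab p q (vs m) else t i)) = (\<Prod>v\<in>S_verts W.
       \<Sum>s\<in>UNIV. eps (map (\<lambda>e. if e = leg W v then s else cut_label l p q v e) (rot W (Inn v))) *
         legs_weight w v s)" ..
    qed
    then show ?thesis unfolding cut_matrix_base_sum[OF F w] mprod_sum by simp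
  qed
  have col: "icol W (vs 0) \<noteq> icol W (vs m)"
  proof -
    have "Suc m mod n = 0" "es m = e\<^sub>0" using m last by auto
    then have "{Inn (vend White e\<^sub>0), Inn (vend Black e\<^sub>0)} = {Inn (vs m), Inn (vs 0)}"
      using en[of m] m vend(1)[OF e\<^sub>0_cycle] by simp
    then show ?thesis using vend(3)[OF e\<^sub>0_cycle]
      by (metis colour.distinct(1) doubleton_eq_iff vert.inject(2))
  qed
  define N where "N = (\<chi> i j. loose F w * mprod M m $ i $ j)"
  \<comment> \<open>The ends \<open>vs m\<close> and \<open>vs 0\<close> of \<open>e\<^sub>0\<close>
    differ in colour, but the direction of the enumeration does not say which of them is white. The
    transpose changes neither \<open>det\<close> nor the trace of \<open>cof\<close>.\<close>
  have "cut_matrix {} F w = N \<or> cut_matrix {} F w = transpose N"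
  proof (cases "icol W (vs 0) = Black")
    case True
    then have "cut_matrix {} F w = transpose N" using col
      by (simp add: vec_eq_iff entry lab_def N_def transpose_def)
    then show ?thesis ..
  next
    case False
    then have "icol W (vs m) = Black" using col by (cases "icol W (vs 0)"; cases "icol W (vs m)") auto
    then have "cut_matrix {} F w = N" using False by (simp add: vec_eq_iff entry lab_def N_def)
    then show ?thesis ..
  qed
  then have eqs: "det (cut_matrix {} F w) = det N" "trace (cof (cut_matrix {} F w)) = trace (cof N)"
    by (auto simp: det_transpose cof_transpose trace_transpose)
  have "det (mprod M m) = 0" by (rule det_mprod) (use detM[of 0] m in simp)
  then show "det (cut_matrix {} F w) = 0" unfolding eqs N_def det_scale_3 by simp
  have "mprod (\<lambda>i. cof (M i)) m = mprod (\<lambda>i. \<chi> r s. legs_weight w (vs i) r * legs_weight w (vs i) s) m"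
    by (rule mprod_cong) (use cofM m in simp)
  then have "trace (cof (mprod M m)) =
    (\<Prod>i<n. \<Sum>s\<in>UNIV. legs_weight w (vs i) s * legs_weight w (vs (Suc i mod n)) s)"
    unfolding cof_mprod using trace_mprod_rank_one[OF m, of "\<lambda>i. legs_weight w (vs i)"] by simp
  also have "\<dots> = (\<Prod>e\<in>the_cycle W. \<Sum>s\<in>UNIV. legs_weight w (vend White e) s *
    legs_weight w (vend Black e) s)"
    unfolding C prod.reindex[OF inj(2)]
  proof (rule prod.cong[OF refl])
    fix i assume "i \<in> {..<n}"
    then have i: "i < n" by simp
    have "{Inn (vend White (es i)), Inn (vend Black (es i))} = {Inn (vs i), Inn (vs (Suc i mod n))}"
      using en[OF i] vend(1)[OF esC[OF i]] by simp
    then have "vend White (es i) = vs i \<and> vend Black (es i) = vs (Suc i mod n) \<or> vend Black (es i) =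
      vs i \<and> vend White (es i) = vs (Suc i mod n)"
      by (auto simp: doubleton_eq_iff)
    then show "(\<Sum>s\<in>UNIV. legs_weight w (vs i) s * legs_weight w (vs (Suc i mod n)) s) =
      ((\<lambda>e. \<Sum>s\<in>UNIV. legs_weight w (vend White e) s * legs_weight w (vend Black e) s) \<circ> es) i"
      by (auto simp: mult.commute)
  qed
  finally show "trace (cof (cut_matrix {} F w)) = (loose F w)\<^sup>2 *
      (\<Prod>e\<in>the_cycle W. \<Sum>s\<in>UNIV. legs_weight w (vend White e) s * legs_weight w (vend Black e) s)"
    unfolding eqs N_def trace_cof_scale by simp
qed

text \<open>The two copies of a leg go to different joining edges, and each joining edge collects
  the outer ends of the legs at its two cycle vertices.\<close>

lemma prod_legs:
  assumes "S_edges W \<subseteq> F" "unit_weight F w"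
  shows "(\<Prod>e\<in>leg W ` S_verts W. \<Prod>i<2. w White e (l (slot e i)) * w Black e (l (slot e i))) =
    (\<Prod>e\<in>the_cycle W. legs_weight w (vend White e) (l (Join e)) * legs_weight w (vend Black e)
      (l (Join e)))"
proof -
  have "(\<Prod>e\<in>leg W ` S_verts W. \<Prod>i<2. w White e (l (slot e i)) * w Black e (l (slot e i))) =
      (\<Prod>v\<in>S_verts W. \<Prod>i<2. legs_weight w v (l (Join (joint (leg W v) i))))"
    unfolding prod.reindex[OF leg_inj] comp_def
  proof (intro prod.cong refl)
    fix v i assume v: "v \<in> S_verts W"
    then have "leg W v \<in> S_edges W" using S_edges_eq by auto
    then show "w White (leg W v) (l (slot (leg W v) i)) * w Black (leg W v) (l (slot (leg W v) i)) =
      legs_weight w v (l (Join (joint (leg W v) i)))"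
      using leg_weight_eq[OF assms(2) v] assms(1) by (auto simp: slot_def)
  qed
  also have "\<dots> = (\<Prod>e\<in>the_cycle W. legs_weight w (vend White e) (l (Join e)) *
    legs_weight w (vend Black e) (l (Join e)))"
    by (rule prod_joint)
  finally show ?thesis .
qed

text \<open>No vertex is left, so the labels of the slots are independent. A joining edge gives the
  pairing of the two legs that it joins, and the two copies of each loose edge give the
  square.\<close>

lemma double_sum_base:
  assumes F: "F \<subseteq> edges W" "S_edges W \<subseteq> F"
    and w: "unit_weight F w"
  shows "double_sum {} F w = (loose F w)\<^sup>2 *
      (\<Prod>e\<in>the_cycle W. \<Sum>s\<in>UNIV. legs_weight w (vend White e) s * legs_weight w (vend Black e) s)"
proof -
  let ?C = "the_cycle W" and ?S = "S_verts W" and ?L = "leg W ` S_verts W" and ?J = "F - S_edges W"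
  have finF: "finite F" using F(1) finite_edges finite_subset by blast
  have fin: "finite ?L" "finite ?J" using finite_S finF by auto
  have LJ: "?L \<inter> ?J = {}" using S_edges_eq by auto
  have FC: "F - ?C = ?L \<union> ?J" using F(2) S_edges_eq leg(2) by auto
  have legF: "leg W v \<in> F" if "v \<in> ?S" for v using F(2) S_edges_eq that by auto
  have Old: "{Old (Par e i) | e i. e \<in> ?J \<and> i < 2} =
    (\<lambda>(e, i). Old (Par e i) :: ('v, 'e) bedge) ` (?J \<times> {..<2})" by auto
  let ?JC = "Join ` the_cycle W :: ('v, 'e) bedge set"
  let ?O = "(\<lambda>(e, i). Old (Par e i) :: ('v, 'e) bedge) ` (?J \<times> {..<2})"
  have injO: "inj_on (\<lambda>(e, i). Old (Par e i) :: ('v, 'e) bedge) (?J \<times> {..<2})"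
    by (auto simp: inj_on_def)
  have injJ: "inj_on (Join :: 'e \<Rightarrow> ('v, 'e) bedge) ?C" by (auto simp: inj_on_def)
  \<comment> \<open>The \<open>case\<close> expressions recover an edge from its slot and turn
    products over edges into products over slots, as \<open>prod_sum_PiE\<close> requires.\<close>
  have kO: "(\<Prod>y\<in>?O. z (case y of Old (Par e i) \<Rightarrow> e) y) = (\<Prod>e\<in>?J. \<Prod>i<2. z e (Old (Par e i)))"
    for z :: "'e \<Rightarrow> ('v, 'e) bedge \<Rightarrow> complex"
    unfolding prod.reindex[OF injO] prod.cartesian_product by (rule prod.cong) auto
  have kC: "(\<Prod>y\<in>?JC. z (case y of Join e \<Rightarrow> e) (y :: ('v, 'e) bedge)) = (\<Prod>e\<in>?C. z e (Join e))"
    for z :: "'e \<Rightarrow> ('v, 'e) bedge \<Rightarrow> complex"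
    unfolding prod.reindex[OF injJ] by simp
  let ?u = "legs_weight w"
  have "double_sum {} F w = (\<Sum>l1 \<in> ?JC \<rightarrow>\<^sub>E UNIV. \<Sum>l2 \<in> ?O \<rightarrow>\<^sub>E UNIV.
     (\<Prod>e\<in>?C. ?u (vend White e) (l1 (Join e)) * ?u (vend Black e) (l1 (Join e))) *
     (\<Prod>e\<in>?J. \<Prod>i<2. w White e (l2 (Old (Par e i))) * w Black e (l2 (Old (Par e i)))))"
    unfolding double_sum_def slots_def Old FC
  proof (rule sum_PiE_union)
    show "?JC \<inter> ?O = {}" by auto
    fix l l1 l2 :: "('v, 'e) bedge \<Rightarrow> 3"
    assume l1: "\<And>a. a \<in> ?JC \<Longrightarrow> l a = l1 a" and l2: "\<And>b. b \<in> ?O \<Longrightarrow> l b = l2 b"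
    have 1: "(\<Prod>e\<in>?L. \<Prod>i<2. w White e (l (slot e i)) * w Black e (l (slot e i))) =
      (\<Prod>e\<in>?C. ?u (vend White e) (l1 (Join e)) * ?u (vend Black e) (l1 (Join e)))"
      unfolding prod_legs[OF F(2) w] by (intro prod.cong refl) (simp add: l1)
    have 2: "(\<Prod>e\<in>?J. \<Prod>i<2. w White e (l (slot e i)) * w Black e (l (slot e i))) =
      (\<Prod>e\<in>?J. \<Prod>i<2. w White e (l2 (Old (Par e i))) * w Black e (l2 (Old (Par e i))))"
    proof (intro prod.cong refl)
      fix e i assume e: "e \<in> ?J" and i: "i \<in> {..<2::nat}"
      then have "l (slot e i) = l2 (Old (Par e i))" using l2[of "Old (Par e i)"]
        by (force simp: slot_def)
      then show "w White e (l (slot e i)) * w Black e (l (slot e i)) =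
        w White e (l2 (Old (Par e i))) * w Black e (l2 (Old (Par e i)))" by simp
    qed
    show "(\<Prod>v\<in>{}. honeycomb_tensor (\<lambda>d t. l (slot (rot W (Inn v) ! d) (copy_at 2 (icol W v) t)))) *
       (\<Prod>e\<in>?L \<union> ?J. \<Prod>i<2. w White e (l (slot e i)) * w Black e (l (slot e i))) =
       (\<Prod>e\<in>?C. ?u (vend White e) (l1 (Join e)) * ?u (vend Black e) (l1 (Join e))) *
       (\<Prod>e\<in>?J. \<Prod>i<2. w White e (l2 (Old (Par e i))) * w Black e (l2 (Old (Par e i))))"
      unfolding prod.union_disjoint[OF fin LJ] 1 2 by simp
  qed
  also have "\<dots> = (\<Sum>l1 \<in> ?JC \<rightarrow>\<^sub>E UNIV.
    (\<Prod>e\<in>?C. ?u (vend White e) (l1 (Join e :: ('v, 'e) bedge)) * ?u (vend Black e) (l1 (Join e)))) *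
     (\<Sum>l2 \<in> ?O \<rightarrow>\<^sub>E UNIV. (\<Prod>e\<in>?J. \<Prod>i<2. w White e (l2 (Old (Par e i))) * w Black e
       (l2 (Old (Par e i)))))"
    by (rule sum_product[symmetric])
  also have "(\<Sum>l1 \<in> ?JC \<rightarrow>\<^sub>E UNIV.
    (\<Prod>e\<in>?C. ?u (vend White e) (l1 (Join e :: ('v, 'e) bedge)) * ?u (vend Black e) (l1 (Join e)))) =
     (\<Prod>e\<in>?C. \<Sum>s\<in>UNIV. ?u (vend White e) s * ?u (vend Black e) s)"
    unfolding kC[of "\<lambda>e y. ?u (vend White e) (_ y) * ?u (vend Black e) (_ y)", symmetric]
      kC[of "\<lambda>e y. \<Sum>s\<in>UNIV. ?u (vend White e) s * ?u (vend Black e) s", symmetric]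
    by (rule prod_sum_PiE[symmetric]) (use finite_C in auto)
  also have "(\<Sum>l2 \<in> ?O \<rightarrow>\<^sub>E UNIV.
    (\<Prod>e\<in>?J. \<Prod>i<2. w White e (l2 (Old (Par e i))) * w Black e (l2 (Old (Par e i))))) =
     (\<Prod>e\<in>?J. \<Prod>i<(2::nat). \<Sum>s\<in>UNIV. w White e s * w Black e s)"
    unfolding kO[of "\<lambda>e y. w White e (_ y) * w Black e (_ y)", symmetric]
      kO[of "\<lambda>e y. \<Sum>s\<in>UNIV. w White e s * w Black e s", symmetric]
    by (rule prod_sum_PiE[symmetric]) (use fin in auto)
  also have "\<dots> = (loose F w)\<^sup>2"
    by (simp add: loose_def prod_power_distrib)
  finally show ?thesis by (simp add: mult.commute)
qed

text \<open>Induction on the number of vertices off the cycle, with the weights arbitrary because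
  each application of \<open>cherry_step\<close> changes them. It ends at the cycle with its legs,
  where both sides are the same explicit product.\<close>

lemma elimination:
  assumes "U \<subseteq> internal W - S_verts W" "F \<subseteq> edges W" "\<forall>v\<in>U \<union> S_verts W. set (rot W (Inn v)) \<subseteq> F"
    and "unit_weight F w"
  shows "det (cut_matrix U F w) = 0 \<and> trace (cof (cut_matrix U F w)) = double_sum U F w"
  using assms
proof (induction "card U" arbitrary: U F w)
  case 0
  have "finite U" using 0(2) finite_internal finite_subset by blast
  then have U: "U = {}" using 0(1) by simp
  have "S_edges W \<subseteq> F"
  proof
    fix e assume "e \<in> S_edges W"
    then obtain c v where "e \<in> edges W" "v \<in> S_verts W" "endp W c e = Inn v" by (auto simp: S_edges_def)
    then show "e \<in> F" using in_rot[of e c v] 0(4) by blast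
  qed
  then show ?case unfolding U using cut_matrix_base[OF 0(3) _ 0(5)] double_sum_base[OF 0(3) _ 0(5)]
    by simp
next
  case (Suc k)
  have finU: "finite U" using Suc.prems(1) finite_internal finite_subset by blast
  have "U \<noteq> {}" using Suc(2) by auto
  then obtain v d where v: "v \<in> U" "d < 3"
    "\<forall>j<3. j \<noteq> d \<longrightarrow> endp W (opp (icol W v)) (rot W (Inn v) ! j) \<notin> Inn ` (U \<union> S_verts W)"
    using cherry_exists[OF Suc.prems(1)] by blast
  note step = cherry_step[OF Suc.prems(1-3) v]
  have vi: "v \<in> internal W" "v \<notin> S_verts W" using v(1) Suc.prems(1) by auto
  have r: "endp W (icol W v) (rot W (Inn v) ! d) = Inn v"
  proof -
    have "rot W (Inn v) ! d \<in> set (rot W (Inn v))" using rot_internal(2)[OF vi(1)] v(2) by simp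
    then show ?thesis unfolding rot_internal(3)[OF vi(1)] by simp
  qed
  have k: "k = card (U - {v})" using Suc(2) v(1) finU by simp
  \<comment> \<open>The changed weight sits at an end at \<open>v\<close>, off the cycle, so the
    ends on the cycle keep the weight 1.\<close>
  have unit: "unit_weight (F - G) (w(icol W v := (w (icol W v))(rot W (Inn v) ! d := X)))" for G X
    unfolding unit_weight_def
  proof (intro ballI allI impI)
    fix e c assume e: "e \<in> F - G" "endp W c e \<in> Inn ` S_verts W"
    then have "\<not> (c = icol W v \<and> e = rot W (Inn v) ! d)" using r vi(2) by auto
    moreover have "w c e = (\<lambda>_. 1)" using Suc.prems(4) e unfolding unit_weight_def by blast
    ultimately show "(w(icol W v := (w (icol W v))(rot W (Inn v) ! d := X))) c e = (\<lambda>_. 1)" by auto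
  qed
  show ?case
    unfolding step(1,2) using Suc.prems(1,2)
    by (intro Suc.hyps(1)[OF k _ _ step(3) unit]) blast+
qed

subsection \<open>The web \<open>B(W)\<close>\<close>

text \<open>Corner \<open>d\<close> is the only vertex of coordinate sum 1 in \<open>H_2\<close>
  whose coordinate \<open>d\<close> is positive, so the direction determines the inner edge.\<close>

abbreviation hon_edge :: "'v \<Rightarrow> nat \<Rightarrow> ('v, 'e) bedge" where
  "hon_edge v d \<equiv> Old (Hon v (unit_point d) d)"

lemma B_internal: "internal (B_web W) =
  (internal W - S_verts W) \<times> {[0, 0, 0], unit_point 0, unit_point 1, unit_point 2}"
proof -
  have "length x = 3 \<and> (sum_list x + 1 = 2 \<or> sum_list x + 2 = 2) \<longleftrightarrow>
    x \<in> {[0, 0, 0], unit_point 0, unit_point 1, unit_point 2}"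
    for x :: "nat list"
    unfolding conj_disj_distribL sum_list_1_conv sum_list_0_conv by blast
  then show ?thesis unfolding B_web_def thick_def tdiag.simps by blast
qed

lemma B_edges: "edges (B_web W) =
  slots (edges W) \<union> (\<lambda>(v, d). hon_edge v d) ` ((internal W - S_verts W) \<times> {..<3})"
proof -
  have x: "length x = 3 \<and> sum_list x + 1 = 2 \<and> d < 3 \<and> 0 < x ! d \<longleftrightarrow> d < 3 \<and> x = unit_point d"
    for x :: "nat list" and d
  proof -
    have "x \<in> {unit_point 0, unit_point 1, unit_point 2} \<and> d < 3 \<and> 0 < x ! d \<longleftrightarrow> d < 3 \<and> x = unit_point d"
    proof (cases "d < 3")
      case True
      then show ?thesis by (elim nat_less_3_cases) (simp_all add: unit_point_simps, auto)
    qed simp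
    then show ?thesis using sum_list_1_conv[of x] by blast
  qed
  have "edges (thick 2 W) - thick_S_edges W = {Par e i | e i. e \<in> edges W - S_edges W \<and> i < 2} \<union>
     {Hon v (unit_point d) d | v d. v \<in> internal W - S_verts W \<and> d < 3}"
  proof -
    have "edges (thick 2 W) =
      {Par e j | e j. e \<in> edges W \<and> j < 2} \<union>
      {Hon v x d | v x d. v \<in> internal W \<and> (d < 3 \<and> x = unit_point d)}"
      unfolding thick_def tdiag.simps x[symmetric] by simp
    then show ?thesis unfolding thick_S_edges_def by auto
  qed
  then show ?thesis unfolding B_web_def tdiag.simps slots_def by auto
qed

lemma B_rot_center:
  assumes "v \<in> internal W - S_verts W"
  shows "rot (B_web W) (Inn (v, [0, 0, 0])) = [hon_edge v 0, hon_edge v 1, hon_edge v 2]"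
  using assms by (simp add: B_web_def B_rot_def thick_def thick_S_edges_def unit_point_def)

text \<open>An edge of \<open>S\<close> at a vertex off the cycle is a leg met at its outer end, so
  \<open>v\<close> has just the colour for which \<open>joint_the\<close> resolves the lookup in
  \<open>B_rot\<close>.\<close>

lemma B_rot_par:
  assumes v: "v \<in> internal W - S_verts W" and e: "e \<in> set (rot W (Inn v))" and i: "i < 2"
  shows "(if Par e i \<in> thick_S_edges W then Join (THE e'. e' \<in> the_cycle W \<and> strand W (icol W v) e' =
    Par e i) else Old (Par e i)) = slot e i"
proof (cases "e \<in> S_edges W")
  case True
  have ev: "e \<in> edges W" "endp W (icol W v) e = Inn v" using rot_internal(3)[of v] v e by auto
  then have "e \<notin> the_cycle W" using cycle_in_sub[of e] v unfolding in_sub_def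
    by (metis DiffD2 imageE vert.inject(2))
  then obtain u where u: "u \<in> S_verts W" "e = leg W u" using True S_edges_eq by auto
  have "icol W u \<noteq> icol W v" using leg_edge[OF u(1)] ev u v by auto
  then have "icol W v = opp (icol W u)" by (cases "icol W u"; cases "icol W v") auto
  then show ?thesis using joint_the(2)[OF u(1) i] True u by (auto simp: thick_S_edges_def slot_def)
next
  case False
  then show ?thesis by (auto simp: thick_S_edges_def slot_def)
qed

text \<open>Together with the centre these lists are the index pattern of
  \<open>honeycomb_tensor\<close>.\<close>

lemma B_rot_corner:
  assumes v: "v \<in> internal W - S_verts W"
  defines "sl \<equiv> \<lambda>d t. slot (rot W (Inn v) ! d) (copy_at 2 (icol W v) t)"
  shows "rot (B_web W) (Inn (v, unit_point 0)) = [hon_edge v 0, sl 1 1, sl 2 0]"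
    and "rot (B_web W) (Inn (v, unit_point 1)) = [sl 0 0, hon_edge v 1, sl 2 1]"
    and "rot (B_web W) (Inn (v, unit_point 2)) = [sl 0 1, sl 1 0, hon_edge v 2]"
proof -
  have r: "rot W (Inn v) ! d \<in> set (rot W (Inn v))" if "d < 3" for d
    using rot_internal(2)[of v] v that by auto
  have vc: "vcol (thick 2 W) (Inn (v, unit_point 0)) = icol W v"
    "vcol (thick 2 W) (Inn (v, unit_point 1)) = icol W v"
    "vcol (thick 2 W) (Inn (v, unit_point 2)) = icol W v"
    by (simp_all add: thick_def unit_point_def)
  define pa :: "nat \<Rightarrow> nat \<Rightarrow> ('v, 'e) tedge" where "pa d t =
    Par (rot W (Inn v) ! d) (copy_at 2 (icol W v) t)" for d t
  have S: "Hon v y d \<notin> thick_S_edges W" for y d using v by (auto simp: thick_S_edges_def)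
  have cp: "copy_at 2 c t < 2" if "t < 2" for c t using that by (auto simp: copy_at_def)
  have lt: "0 < (3::nat)" "1 < (3::nat)" "2 < (3::nat)" "0 < (2::nat)" "1 < (2::nat)" by simp_all
  have P: "(if pa d t \<in> thick_S_edges W then Join (THE e'. e' \<in> the_cycle W \<and> strand W (icol W v) e' =
    pa d t) else Old (pa d t)) =
      slot (rot W (Inn v) ! d) (copy_at 2 (icol W v) t)" if "d < 3" "t < 2" for d t
    unfolding pa_def using B_rot_par[OF v r[OF that(1)] cp[OF that(2)]] .
  have th: "rot (thick 2 W) = thick_rot 2 W" by (simp add: thick_def)
  have br: "rot (B_web W) = B_rot W" by (simp add: B_web_def)
  show "rot (B_web W) (Inn (v, unit_point 0)) = [hon_edge v 0, sl 1 1, sl 2 0]"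
  proof -
    have "thick_rot 2 W (Inn (v, unit_point 0)) = [Hon v (unit_point 0) 0, pa 1 1, pa 2 0]"
      by (simp add: unit_point_simps pa_def)
    then show ?thesis
      unfolding br B_rot_def th sl_def
        by (simp only: list.map vc S if_False P[OF lt(2) lt(5)] P[OF lt(3) lt(4)])
  qed
  show "rot (B_web W) (Inn (v, unit_point 1)) = [sl 0 0, hon_edge v 1, sl 2 1]"
  proof -
    have "thick_rot 2 W (Inn (v, unit_point 1)) = [pa 0 0, Hon v (unit_point 1) 1, pa 2 1]"
      by (simp add: unit_point_simps pa_def)
    then show ?thesis
      unfolding br B_rot_def th sl_def
        by (simp only: list.map vc S if_False P[OF lt(1) lt(4)] P[OF lt(3) lt(5)])
  qed
  show "rot (B_web W) (Inn (v, unit_point 2)) = [sl 0 1, sl 1 0, hon_edge v 2]"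
  proof -
    have "thick_rot 2 W (Inn (v, unit_point 2)) = [pa 0 1, pa 1 0, Hon v (unit_point 2) 2]"
      by (simp add: unit_point_simps pa_def)
    then show ?thesis
      unfolding br B_rot_def th sl_def
        by (simp only: list.map vc S if_False P[OF lt(1) lt(5)] P[OF lt(2) lt(4)])
  qed
qed

lemma bcoord_thick_Par: "bcoord x (endp (thick 2 W) c (Par e i)) s = bweight x c e s"
proof (cases "endp W c e")
  case (Bd c' n)
  then show ?thesis by (cases c') (simp_all add: thick_def bweight_def)
next
  case (Inn v)
  then show ?thesis by (simp add: thick_def bweight_def)
qed

text \<open>The end of colour \<open>c\<close> of a joining edge is the outer end of the leg at its
  cycle vertex of the other colour, whence \<open>opp c\<close>.\<close>

lemma bcoord_B:
  shows "bcoord x (endp (B_web W) c (Old (Par e i))) s = bweight x c e s"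
    and "bcoord x (endp (B_web W) c (Old (Hon v y d))) s = 1"
    and "e \<in> the_cycle W \<Longrightarrow> bcoord x (endp (B_web W) c (Join e)) s =
      legs_weight (bweight x) (vend (opp c) e) s"
proof -
  show "bcoord x (endp (B_web W) c (Old (Par e i))) s = bweight x c e s"
    using bcoord_thick_Par by (simp add: B_web_def)
  show "bcoord x (endp (B_web W) c (Old (Hon v y d))) s = 1" by (simp add: B_web_def thick_def)
  assume e: "e \<in> the_cycle W"
  have "opp (icol W (vend (opp c) e)) = c" using vend(3)[OF e, of "opp c"] by (cases c) auto
  then show "bcoord x (endp (B_web W) c (Join e)) s = legs_weight (bweight x) (vend (opp c) e) s"
    using bcoord_thick_Par by (simp add: B_web_def strand_eq[OF e] legs_weight_def)
qed

lemma unit_weight_bweight: "unit_weight (edges W) (bweight x)"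
  unfolding unit_weight_def bweight_def by (auto simp: fun_eq_iff)

text \<open>The inner edges of a honeycomb belong to a single vertex of \<open>W\<close>. Summed
  first, they factor over the vertices and leave a \<open>honeycomb_tensor\<close> at each.\<close>

lemma invariant_B: "invariant (B_web W) x = double_sum (internal W - S_verts W) (edges W) (bweight x)"
proof -
  let ?U = "internal W - S_verts W" and ?C = "the_cycle W" and ?L = "leg W ` S_verts W" and ?J =
    "edges W - S_edges W"
  let ?HS = "(\<lambda>(v, d). hon_edge v d) ` (?U \<times> {..<3})"
  let ?w = "bweight x"
  define sl where "sl v d t = slot (rot W (Inn v) ! d) (copy_at 2 (icol W v) t)" for v d t
  define h where "h l1 v l2 = eps [l2 (hon_edge v 0), l2 (hon_edge v 1), l2 (hon_edge v 2)] *
    (eps [l2 (hon_edge v 0), l1 (sl v 1 1), l1 (sl v 2 0)] *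
      (eps [l1 (sl v 0 0), l2 (hon_edge v 1), l1 (sl v 2 1)] *
     eps [l1 (sl v 0 1), l1 (sl v 1 0), l2 (hon_edge v 2)]))" for l1 l2 :: "('v, 'e) bedge \<Rightarrow> 3" and v
  have finU: "finite ?U" using finite_internal by simp
  have SE: "S_edges W \<subseteq> edges W" by (auto simp: S_edges_def)
  have fin: "finite ?L" "finite ?J" using finite_S finite_edges by auto
  have LJ: "?L \<inter> ?J = {}" using S_edges_eq by auto
  have FC: "edges W - ?C = ?L \<union> ?J" using SE S_edges_eq leg(2) by auto
  have finsl: "finite (slots (edges W))"
  proof -
    have "slots (edges W) = Join ` ?C \<union> (\<lambda>(e, i). Old (Par e i)) ` (?J \<times> {..<2})"
      by (auto simp: slots_def)
    then show ?thesis using finite_C fin(2) by simp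
  qed
  have slsl: "sl v d t \<in> slots (edges W)" if "v \<in> ?U" "d < 3" "t < 2" for v d t
  proof -
    have e: "rot W (Inn v) ! d \<in> set (rot W (Inn v))" using rot_internal(2)[of v] that by auto
    then have eE: "rot W (Inn v) ! d \<in> edges W" "endp W (icol W v) (rot W (Inn v) ! d) = Inn v"
      using rot_internal(3)[of v] that by auto
    then have nC: "rot W (Inn v) ! d \<notin> ?C" using cycle_in_sub that(1) unfolding in_sub_def
      by (metis DiffD2 imageE vert.inject(2))
    have cp: "copy_at 2 (icol W v) t < 2" using that by (auto simp: copy_at_def)
    show ?thesis
    proof (cases "rot W (Inn v) ! d \<in> S_edges W")
      case True
      then obtain u where "u \<in> S_verts W" "rot W (Inn v) ! d = leg W u" using nC S_edges_eq by auto
      then show ?thesis using joint_the(1)[OF _ cp] True by (auto simp: sl_def slot_def slots_def)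
    next
      case False
      then show ?thesis using eE cp by (auto simp: sl_def slot_def slots_def)
    qed
  qed
  have "invariant (B_web W) x = (\<Sum>l1 \<in> slots (edges W) \<rightarrow>\<^sub>E UNIV. \<Sum>l2 \<in> ?HS \<rightarrow>\<^sub>E UNIV.
     (\<Prod>v\<in>?U. h l1 v l2) * (\<Prod>e\<in>edges W - ?C. \<Prod>i<2. ?w White e (l1 (slot e i)) * ?w Black e
       (l1 (slot e i))))"
    unfolding invariant_def B_edges
  proof (rule sum_PiE_union)
    show disj: "slots (edges W) \<inter> ?HS = {}" by (auto simp: slots_def)
    fix l l1 l2 :: "('v, 'e) bedge \<Rightarrow> 3"
    assume l1: "\<And>a. a \<in> slots (edges W) \<Longrightarrow> l a = l1 a" and l2: "\<And>b. b \<in> ?HS \<Longrightarrow> l b = l2 b"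
    have l2h: "l (hon_edge v d) = l2 (hon_edge v d)" if "v \<in> ?U" "d < 3" for v d
      using that by (intro l2) auto
    have "(\<Prod>u\<in>internal (B_web W). eps (map l (rot (B_web W) (Inn u)))) =
       (\<Prod>v\<in>?U. \<Prod>y\<in>{[0, 0, 0], unit_point 0, unit_point 1, unit_point 2}. eps
         (map l (rot (B_web W) (Inn (v, y)))))"
      unfolding B_internal prod.cartesian_product by (simp add: case_prod_unfold)
    also have "\<dots> = (\<Prod>v\<in>?U. h l1 v l2)"
    proof (rule prod.cong[OF refl])
      fix v assume v: "v \<in> ?U"
      have s: "l (sl v d t) = l1 (sl v d t)" if "d < 3" "t < 2" for d t using l1 slsl[OF v that]
        by blast
      have "(\<Prod>y\<in>{[0, 0, 0], unit_point 0, unit_point 1, unit_point 2}.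
        eps (map l (rot (B_web W) (Inn (v, y))))) =
        eps (map l (rot (B_web W) (Inn (v, [0, 0, 0])))) *
          (eps (map l (rot (B_web W) (Inn (v, unit_point 0)))) *
        (eps (map l (rot (B_web W) (Inn (v, unit_point 1)))) * eps
          (map l (rot (B_web W) (Inn (v, unit_point 2))))))"
        unfolding unit_point_simps by simp
      also have "\<dots> = h l1 v l2"
        unfolding B_rot_center[OF v] B_rot_corner[OF v] sl_def[symmetric] h_def list.map
        by (simp add: l2h[OF v] s del: One_nat_def)
      finally show "(\<Prod>y\<in>{[0, 0, 0], unit_point 0, unit_point 1, unit_point 2}.
        eps (map l (rot (B_web W) (Inn (v, y))))) = h l1 v l2" .
    qed
    finally have 1: "(\<Prod>u\<in>internal (B_web W). eps (map l (rot (B_web W) (Inn u)))) = (\<Prod>v\<in>?U. h l1 v l2)"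
      .
    let ?b = "\<lambda>e. bcoord x (endp (B_web W) White e) (l e) * bcoord x (endp (B_web W) Black e) (l e)"
    let ?O = "(\<lambda>(e, i). Old (Par e i) :: ('v, 'e) bedge) ` (?J \<times> {..<2})"
    let ?JC = "Join ` ?C :: ('v, 'e) bedge set"
    have injO: "inj_on (\<lambda>(e, i). Old (Par e i) :: ('v, 'e) bedge) (?J \<times> {..<2})"
      by (auto simp: inj_on_def)
    have injJ: "inj_on (Join :: 'e \<Rightarrow> ('v, 'e) bedge) ?C" by (auto simp: inj_on_def)
    have sO: "slots (edges W) = ?JC \<union> ?O" by (auto simp: slots_def)
    have "(\<Prod>e\<in>slots (edges W) \<union> ?HS. ?b e) = (\<Prod>e\<in>slots (edges W). ?b e)"
      by (rule prod.mono_neutral_right) (use finsl finU disj in \<open>auto simp: bcoord_B(2)\<close>)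
    also have "\<dots> = (\<Prod>e\<in>?JC. ?b e) * (\<Prod>e\<in>?O. ?b e)"
      unfolding sO by (rule prod.union_disjoint) (use finite_C fin in auto)
    also have "(\<Prod>e\<in>?JC. ?b e) = (\<Prod>e\<in>?L. \<Prod>i<2. ?w White e (l1 (slot e i)) * ?w Black e (l1 (slot e i)))"
    proof -
      have "l (Join e) = l1 (Join e)" if "e \<in> ?C" for e using l1[of "Join e"] that
        by (auto simp: slots_def)
      then have "(\<Prod>e\<in>?JC. ?b e) =
        (\<Prod>e\<in>?C. legs_weight ?w (vend White e) (l1 (Join e)) * legs_weight ?w (vend Black e)
        (l1 (Join e)))"
        unfolding prod.reindex[OF injJ] comp_def
        by (intro prod.cong refl) (simp add: bcoord_B(3))
      then show ?thesis unfolding prod_legs[OF SE unit_weight_bweight] .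
    qed
    also have "(\<Prod>e\<in>?O. ?b e) = (\<Prod>e\<in>?J. \<Prod>i<2. ?w White e (l1 (slot e i)) * ?w Black e (l1 (slot e i)))"
      unfolding prod.reindex[OF injO] prod.cartesian_product
    proof (rule prod.cong[OF refl])
      fix p assume p: "p \<in> ?J \<times> {..<2::nat}"
      obtain e i where ei: "p = (e, i)" by (cases p)
      have "slot e i = Old (Par e i)" using p ei by (simp add: slot_def)
      moreover have "l (Old (Par e i)) = l1 (Old (Par e i))" using p ei
        by (intro l1) (auto simp: slots_def)
      ultimately show "(?b \<circ> (\<lambda>(e, i). Old (Par e i))) p =
        (case p of (e, i) \<Rightarrow> ?w White e (l1 (slot e i)) * ?w Black e (l1 (slot e i)))"
        unfolding ei by (simp add: bcoord_B(1))
    qed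
    also have "(\<Prod>e\<in>?L. \<Prod>i<2. ?w White e (l1 (slot e i)) * ?w Black e (l1 (slot e i))) *
       (\<Prod>e\<in>?J. \<Prod>i<2. ?w White e (l1 (slot e i)) * ?w Black e (l1 (slot e i))) =
       (\<Prod>e\<in>edges W - ?C. \<Prod>i<2. ?w White e (l1 (slot e i)) * ?w Black e (l1 (slot e i)))"
      unfolding FC by (rule prod.union_disjoint[OF fin LJ, symmetric])
    finally show "(\<Prod>u\<in>internal (B_web W). eps (map l (rot (B_web W) (Inn u)))) *
      (\<Prod>e\<in>slots (edges W) \<union> ?HS. ?b e) =
      (\<Prod>v\<in>?U. h l1 v l2) * (\<Prod>e\<in>edges W - ?C. \<Prod>i<2. ?w White e (l1 (slot e i)) * ?w Black e
        (l1 (slot e i)))"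
      unfolding 1 by simp
  qed
  also have "\<dots> = double_sum ?U (edges W) ?w"
    unfolding double_sum_def sl_def[symmetric]
  proof (rule sum.cong[OF refl])
    fix l1 :: "('v, 'e) bedge \<Rightarrow> 3"
    have "(\<Sum>l2 \<in> ?HS \<rightarrow>\<^sub>E UNIV. \<Prod>v\<in>?U. h l1 v l2) =
      (\<Prod>v\<in>?U. \<Sum>l2 \<in> {e \<in> ?HS. (case e of Old (Hon v y d) \<Rightarrow> v) = v} \<rightarrow>\<^sub>E UNIV. h l1 v l2)"
    proof (rule sum_PiE_blocks)
      fix v and m :: "('v, 'e) bedge \<Rightarrow> 3" assume v: "v \<in> ?U"
      have "restrict m {e \<in> ?HS. (case e of Old (Hon v y d) \<Rightarrow> v) = v} (hon_edge v d) = m (hon_edge v d)"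
        if "d < 3" for d
        using v that by auto
      then show "h l1 v (restrict m {e \<in> ?HS. (case e of Old (Hon v y d) \<Rightarrow> v) = v}) = h l1 v m"
        unfolding h_def by (simp del: One_nat_def)
    qed (use finU in auto)
    also have "\<dots> = (\<Prod>v\<in>?U. honeycomb_tensor (\<lambda>d t. l1 (sl v d t)))"
    proof (rule prod.cong[OF refl])
      fix v assume v: "v \<in> ?U"
      have e3: "{e \<in> ?HS. (case e of Old (Hon v y d) \<Rightarrow> v) = v} =
        {hon_edge v 0, hon_edge v 1, hon_edge v 2}"
      proof -
        have "{e \<in> ?HS. (case e of Old (Hon v y d) \<Rightarrow> v) = v} = hon_edge v ` {..<3}" using v by auto
        moreover have "{..<3} = {0, 1, 2::nat}" by auto
        ultimately show ?thesis by simp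
      qed
      define z where "z ps = eps [ps ! 0, ps ! 1, ps ! 2] *
        (eps [ps ! 0, l1 (sl v 1 1), l1 (sl v 2 0)] *
         (eps [l1 (sl v 0 0), ps ! 1, l1 (sl v 2 1)] * eps [l1 (sl v 0 1), l1 (sl v 1 0), ps ! 2]))"
           for ps :: "3 list"
      have "(\<Sum>l2 \<in> {e \<in> ?HS. (case e of Old (Hon v y d) \<Rightarrow> v) = v} \<rightarrow>\<^sub>E UNIV. h l1 v l2) =
        (\<Sum>l2 \<in> {hon_edge v 0, hon_edge v 1, hon_edge v 2} \<rightarrow>\<^sub>E UNIV. z
          [l2 (hon_edge v 0), l2 (hon_edge v 1), l2 (hon_edge v 2)])"
        unfolding e3 h_def z_def by simp
      also have "\<dots> = (\<Sum>p\<in>UNIV. \<Sum>q\<in>UNIV. \<Sum>r\<in>UNIV. z [p, q, r])"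
        by (rule sum_PiE_three) simp
      also have "\<dots> = honeycomb_tensor (\<lambda>d t. l1 (sl v d t))"
        unfolding honeycomb_tensor_def z_def by (simp add: mult.assoc)
      finally show "(\<Sum>l2 \<in> {e \<in> ?HS. (case e of Old (Hon v y d) \<Rightarrow> v) = v} \<rightarrow>\<^sub>E UNIV. h l1 v l2) =
        honeycomb_tensor (\<lambda>d t. l1 (sl v d t))" .
    qed
    finally show "(\<Sum>l2 \<in> ?HS \<rightarrow>\<^sub>E UNIV. (\<Prod>v\<in>?U. h l1 v l2) *
      (\<Prod>e\<in>edges W - ?C. \<Prod>i<2. ?w White e (l1 (slot e i)) * ?w Black e (l1 (slot e i)))) =
       (\<Prod>v\<in>?U. honeycomb_tensor (\<lambda>d t. l1 (sl v d t))) *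
         (\<Prod>e\<in>edges W - ?C. \<Prod>i<2. ?w White e (l1 (slot e i)) * ?w Black e (l1 (slot e i)))"
      by (simp only: sum_distrib_right[symmetric])
  qed
  finally show ?thesis .
qed

end

text \<open>The matrix argument treats one configuration at a time; this carries its result over to
  the ring of functions.\<close>

lemma chebyshev_T_fun: "chebyshev_T k f g x = chebyshev_T k (f x) (g x)"
  for f g :: "'a \<Rightarrow> 'b::comm_ring_1"
  by (induction k f g rule: chebyshev_T.induct) simp_all

theorem theorem1p1:
  fixes a b k :: nat
    and W :: "('v, 'e) tdiag"
    and e\<^sub>0 :: 'e
  assumes "single_cycle_web a b W"
    and "\<not> boundary_quad_at_cycle W"
    and "e\<^sub>0 \<in> the_cycle W"
  shows "brac_invariant k W e\<^sub>0 = chebyshev_T k (invariant W) (invariant (B_web W))"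
proof -
  interpret single_cycle a b W e\<^sub>0
    using assms by unfold_locales
  show ?thesis
  proof (cases k)
    \<comment> \<open>Here the convention for the empty bracelet decides; the zeroth power of the
      matrix would give 3.\<close>
    case 0
    then show ?thesis by (simp add: brac_invariant_def)
  next
    case (Suc m)
    have "invariant (brac (Suc m) W e\<^sub>0) x =
      chebyshev_T (Suc m) (invariant W x) (invariant (B_web W) x)" for x
    proof -
      have "\<forall>v\<in>internal W - S_verts W \<union> S_verts W. set (rot W (Inn v)) \<subseteq> edges W"
        unfolding internal_split using rot_internal(3) by blast
      then have el: "det (full_matrix x) = 0" "trace (cof (full_matrix x)) = invariant (B_web W) x"
        using elimination[OF subset_refl subset_refl _ unit_weight_bweight] unfolding invariant_B
          by blast+
      \<comment> \<open>The bracelet produces powers of the transpose, which shares the trace, the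
        determinant and the trace of cofactors.\<close>
      have "det (transpose (full_matrix x)) = 0" using el(1) by (simp add: det_transpose)
      from trace_matpow_chebyshev[OF this] show ?thesis
        unfolding invariant_brac cof_transpose trace_transpose el(2) invariant_trace .
    qed
    then show ?thesis using Suc
      by (simp add: brac_invariant_def fun_eq_iff chebyshev_T_fun del: chebyshev_T.simps)
  qed
qed

end
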